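(* Assume (R) and (Q) from the context and let $L\ge1$ be an integer. Then for all sufficiently small $\beta>0$ (with $\sigma$ fixed), $$\mathcal I_{\mathrm{obs}}^{(W)}(\theta^\star;\beta)=\mathcal I_{\mathrm{GMoM}}^{(W)}(\theta^\star;\beta)+R_\beta,$$ where $R_\beta:W\to W$ is self-adjoint, positive semidefinite, and satisfies $\|R_\beta\|_{\mathrm{op}}=O(\mathrm{SNR}^{L+1})$ as $\beta\to0$, with $\mathrm{SNR}=\beta^2/\sigma^2$; that is, there exist $\beta_0>0$ and $C<\infty$ such that $\|R_\beta\|_{\mathrm{op}}\le C\,\mathrm{SNR}^{L+1}$ for all $0<\beta<\beta_0$.
   Context: Model. Fix integers $d,m\ge 1$ and $\sigma>0$. Let $(\mathcal Z,\mathcal F,\mu)$ be a probability space, $A:\mathcal Z\to\mathbb R^{d\times m}$ measurable, and $\Theta\subset\mathbb R^m$ a $C^2$ embedded submanifold of dimension $m$ (boundary allowed), with $\theta^\star$ an interior point of $\Theta$. For $\theta\in\mathbb R^m$, $\beta\ge0$ let $p_{\theta,\beta}(y)=\int_{\mathcal Z}\varphi_\sigma(y-\beta A(z)\theta)\,\mu(dz)$, where $\varphi_\sigma$ is the density of $\mathcal N(0,\sigma^2I_d)$. (R) $\Theta$ is compact; $\|A(z)\|_{\mathrm{op}}\le a_{\max}<\infty$ for $\mu$-a.e. $z$; and $\mathbb E_{Z\sim\mu}[A(Z)^\top A(Z)]$ is positive definite. Equivalence. $\theta\sim\theta'$ (for $\theta,\theta'\in\Theta$) if $A(Z)\theta$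 and $A(Z)\theta'$ have the same law under $Z\sim\mu$. $[\theta]=\{\theta'\in\Theta:\theta'\sim\theta\}$. (Q) There is an open neighborhood $U_\star\subset\Theta$ of $\theta^\star$ such that $U_\star/{\sim}$ admits a $C^2$ manifold structure for which the canonical projection $U_\star\to U_\star/{\sim}$ is a $C^2$ submersion. $T(\theta^\star)$ is the tangent space at $\theta^\star$ to $[\theta^\star]$ (velocities at $0$ of $C^1$ curves in $[\theta^\star]$ through $\theta^\star$ at time $0$), and $W=T(\theta^\star)^\perp\subset\mathbb R^m$. Fisher information. $\mathcal I_{\mathrm{obs}}(\theta;\beta)=\mathbb E_{Y\sim p_{\theta,\beta}}[\nabla_\theta\log p_{\theta,\beta}(Y)\nabla_\theta\log p_{\theta,\beta}(Y)^\top]$; $\mathcal I^{(W)}_{\mathrm{obs}}(\theta^\star;\beta):W\to W$ is the self-adjoint operator with $\langle h,\mathcal I^{(W)}_{\mathrm{obs}}(\theta^\star;\beta)g\rangle=h^\top\mathcal I_{\mathrm{obs}}(\theta^\star;\beta)g$ for $h,g\in W$. Features. $T_k(\theta)=\mathbb E_{Z\sim\mu}[(A(Z)\theta)^{\otimes k}]$. Hermite tensors: $H_k(x)=(-1)^ke^{\|x\|^2/2}\nabla_x^{\otimes k}e^{-\|x\|^2/2}$, a symmetric tensor in $(\mathbb R^d)^{\otimes k}$. Symmetric order-$j$ tensors are identified with their coordinate vectors in a fixed Frobenius-orthonormal basis of the space of symmetric order-$j$ tensors. $\psi(y)=(H_1(y/\sigma),\dots,H_L(y/\sigma))$ (stacked);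 $M(\theta;\beta)=\mathbb E_{Y\sim p_{\theta,\beta}}[\psi(Y)]=((\beta/\sigma)T_1(\theta),\dots,(\beta/\sigma)^LT_L(\theta))$; $\Sigma_L(\theta^\star;\beta)=\mathrm{Cov}_{Y\sim p_{\theta^\star,\beta}}(\psi(Y))$, which is invertible for all sufficiently small $\beta>0$. GMoM information. With $D_WM(\theta^\star;\beta)=DM(\theta^\star;\beta)|_W$ (derivative in $\theta$ restricted to $W$), $\mathcal I_{\mathrm{GMoM}}^{(W)}(\theta^\star;\beta)=D_WM(\theta^\star;\beta)^\top\Sigma_L(\theta^\star;\beta)^{-1}D_WM(\theta^\star;\beta):W\to W$. *)

theory Defs
  imports "HOL-Probability.Probability"
begin

section \<open>The observation model\<close>

definition gauss_density :: "real \<Rightarrow> real ^ 'd \<Rightarrow> real" where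
  "gauss_density \<sigma> y = exp (- (norm y)\<^sup>2 / (2 * \<sigma>\<^sup>2)) / (sqrt (2 * pi * \<sigma>\<^sup>2)) ^ CARD('d)"

definition obs_density ::
  "'z measure \<Rightarrow> ('z \<Rightarrow> real ^ 'm ^ 'd) \<Rightarrow> real \<Rightarrow> real ^ 'm \<Rightarrow> real \<Rightarrow> real ^ 'd \<Rightarrow> real" where
  "obs_density \<mu> A \<sigma> \<theta> \<beta> y = (\<integral>z. gauss_density \<sigma> (y - \<beta> *\<^sub>R (A z *v \<theta>)) \<partial>\<mu>)"

definition obs_law ::
  "'z measure \<Rightarrow> ('z \<Rightarrow> real ^ 'm ^ 'd) \<Rightarrow> real \<Rightarrow> real ^ 'm \<Rightarrow> real \<Rightarrow> (real ^ 'd) measure" where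
  "obs_law \<mu> A \<sigma> \<theta> \<beta> = density lborel (\<lambda>y. ennreal (obs_density \<mu> A \<sigma> \<theta> \<beta> y))"

definition snr :: "real \<Rightarrow> real \<Rightarrow> real" where
  "snr \<beta> \<sigma> = \<beta>\<^sup>2 / \<sigma>\<^sup>2"


section \<open>Maps of class \<open>C\<^sup>2\<close> and full-dimensional submanifolds\<close>

definition C2_on_open ::
  "'a::real_normed_vector set \<Rightarrow> ('a \<Rightarrow> 'b::real_normed_vector) \<Rightarrow> bool" where
  "C2_on_open U f \<longleftrightarrow> open U \<and>
     (\<exists>(f' :: 'a \<Rightarrow> 'a \<Rightarrow>\<^sub>L 'b) (f'' :: 'a \<Rightarrow> 'a \<Rightarrow>\<^sub>L ('a \<Rightarrow>\<^sub>L 'b)).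
        (\<forall>x\<in>U. (f has_derivative blinfun_apply (f' x)) (at x)) \<and>
        (\<forall>x\<in>U. (f' has_derivative blinfun_apply (f'' x)) (at x)) \<and>
        continuous_on U f'')"

text \<open>On an arbitrary subset of a Euclidean space, being \<open>C\<^sup>2\<close> means having local
  \<open>C\<^sup>2\<close> extensions to open sets of the ambient space.\<close>

definition C2_on ::
  "'a::real_normed_vector set \<Rightarrow> ('a \<Rightarrow> 'b::real_normed_vector) \<Rightarrow> bool" where
  "C2_on S f \<longleftrightarrow>
     (\<forall>x\<in>S. \<exists>U g. x \<in> U \<and> C2_on_open U g \<and> (\<forall>y \<in> U \<inter> S. g y = f y))"

text \<open>An embedded \<open>C\<^sup>2\<close> submanifold of \<open>\<real>\<^sup>m\<close> of full dimension \<open>m\<close>, possibly with boundary: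
  near each of its points it is carried onto a relatively open piece of a closed half-space by an
  ambient \<open>C\<^sup>2\<close> diffeomorphism (interior points have a chart whose image \<open>V\<close> lies in the open
  half-space).\<close>

definition C2_submanifold_full_dim :: "(real ^ 'm) set \<Rightarrow> bool" where
  "C2_submanifold_full_dim S \<longleftrightarrow>
     (\<forall>x\<in>S. \<exists>U V (\<Phi> :: real ^ 'm \<Rightarrow> real ^ 'm) (\<Psi> :: real ^ 'm \<Rightarrow> real ^ 'm) i.
        x \<in> U \<and> C2_on_open U \<Phi> \<and> C2_on_open V \<Psi> \<and>
        homeomorphism U V \<Phi> \<Psi> \<and> \<Phi> ` (U \<inter> S) = {y \<in> V. 0 \<le> y $ i})"


section \<open>Condition (R)\<close>

definition cond_R ::
  "'z measure \<Rightarrow> ('z \<Rightarrow> real ^ 'm ^ 'd) \<Rightarrow> (real ^ 'm) set \<Rightarrow> bool" where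
  "cond_R \<mu> A \<Theta> \<longleftrightarrow>
     compact \<Theta> \<and>
     (\<exists>a_max. AE z in \<mu>. onorm ((*v) (A z)) \<le> a_max) \<and>
     (\<forall>v. v \<noteq> 0 \<longrightarrow> v \<bullet> ((\<integral>z. transpose (A z) ** A z \<partial>\<mu>) *v v) > 0)"


section \<open>Statistical equivalence and condition (Q)\<close>

definition equiv_param ::
  "'z measure \<Rightarrow> ('z \<Rightarrow> real ^ 'm ^ 'd) \<Rightarrow> real ^ 'm \<Rightarrow> real ^ 'm \<Rightarrow> bool" where
  "equiv_param \<mu> A \<theta> \<theta>' \<longleftrightarrow>
     distr \<mu> borel (\<lambda>z. A z *v \<theta>) = distr \<mu> borel (\<lambda>z. A z *v \<theta>')"

text \<open>\<open>equiv_on \<mu> A S\<close> is the relation restricted to \<open>S\<close>; the class of \<open>\<theta>\<close> in \<open>S\<close> is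
  \<open>equiv_on \<mu> A S `` {\<theta>}\<close> and the quotient is \<open>S // equiv_on \<mu> A S\<close>.\<close>

definition equiv_on ::
  "'z measure \<Rightarrow> ('z \<Rightarrow> real ^ 'm ^ 'd) \<Rightarrow> (real ^ 'm) set \<Rightarrow> (real ^ 'm) rel" where
  "equiv_on \<mu> A S = {(\<theta>, \<theta>'). \<theta> \<in> S \<and> \<theta>' \<in> S \<and> equiv_param \<mu> A \<theta> \<theta>'}"

text \<open>A \<open>C\<^sup>2\<close> manifold structure on (the topological space) \<open>X\<close>. The charts take values in a
  linear subspace \<open>E\<close> of some Euclidean space, which plays the role of \<open>\<real>\<^sup>k\<close> with \<open>k = dim E\<close>;
  thus \<open>k\<close> can vary, and \<open>k = 0\<close> is included.\<close>

definition C2_manifold ::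
  "'q topology \<Rightarrow> 'e::euclidean_space set \<Rightarrow> ('q set \<times> ('q \<Rightarrow> 'e)) set \<Rightarrow> bool" where
  "C2_manifold X E \<A> \<longleftrightarrow>
     subspace E \<and> Hausdorff_space X \<and> second_countable X \<and>
     (\<Union>(D, \<phi>)\<in>\<A>. D) = topspace X \<and>
     (\<forall>(D, \<phi>)\<in>\<A>. openin X D \<and> openin (top_of_set E) (\<phi> ` D) \<and>
        homeomorphic_map (subtopology X D) (top_of_set (\<phi> ` D)) \<phi>) \<and>
     (\<forall>(D, \<phi>)\<in>\<A>. \<forall>(D', \<phi>')\<in>\<A>. C2_on (\<phi> ` (D \<inter> D')) (\<phi>' \<circ> inv_into D \<phi>))"

definition C2_submersion ::
  "'a::euclidean_space set \<Rightarrow> 'q topology \<Rightarrow> 'e::euclidean_space set \<Rightarrow>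
   ('q set \<times> ('q \<Rightarrow> 'e)) set \<Rightarrow> ('a \<Rightarrow> 'q) \<Rightarrow> bool" where
  "C2_submersion U X E \<A> f \<longleftrightarrow>
     continuous_map (top_of_set U) X f \<and>
     (\<forall>(D, \<phi>)\<in>\<A>. C2_on {x \<in> U. f x \<in> D} (\<phi> \<circ> f) \<and>
        (\<forall>x\<in>U. f x \<in> D \<longrightarrow>
           (\<exists>f'. ((\<phi> \<circ> f) has_derivative f') (at x within U) \<and> range f' = E)))"

text \<open>The charts of the quotient are modelled on a subspace of \<open>\<real>\<^sup>m\<close> itself. This loses nothing:
  the quotient is the image of a submersion from an \<open>m\<close>-dimensional manifold, so its dimension
  is at most \<open>m\<close>.\<close>

definition cond_Q ::
  "'z measure \<Rightarrow> ('z \<Rightarrow> real ^ 'm ^ 'd) \<Rightarrow> (real ^ 'm) set \<Rightarrow> real ^ 'm \<Rightarrow> bool" where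
  "cond_Q \<mu> A \<Theta> \<theta>s \<longleftrightarrow>
     (\<exists>U. openin (top_of_set \<Theta>) U \<and> \<theta>s \<in> U \<and>
       (\<exists>(X :: (real ^ 'm) set topology) (E :: (real ^ 'm) set) \<A>.
          topspace X = U // equiv_on \<mu> A U \<and>
          C2_manifold X E \<A> \<and>
          C2_submersion U X E \<A> (\<lambda>\<theta>. equiv_on \<mu> A U `` {\<theta>})))"


section \<open>The tangent space to a class and its orthogonal complement\<close>

definition class_tangent ::
  "'z measure \<Rightarrow> ('z \<Rightarrow> real ^ 'm ^ 'd) \<Rightarrow> (real ^ 'm) set \<Rightarrow> real ^ 'm \<Rightarrow> (real ^ 'm) set" where
  "class_tangent \<mu> A \<Theta> \<theta>s =
     {v. \<exists>\<epsilon>>0. \<exists>\<gamma>. \<gamma> C1_differentiable_on {-\<epsilon><..<\<epsilon>} \<and> \<gamma> 0 = \<theta>s \<and>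
          \<gamma> ` {-\<epsilon><..<\<epsilon>} \<subseteq> equiv_on \<mu> A \<Theta> `` {\<theta>s} \<and>
          (\<gamma> has_vector_derivative v) (at 0)}"

definition class_normal ::
  "'z measure \<Rightarrow> ('z \<Rightarrow> real ^ 'm ^ 'd) \<Rightarrow> (real ^ 'm) set \<Rightarrow> real ^ 'm \<Rightarrow> (real ^ 'm) set" where
  "class_normal \<mu> A \<Theta> \<theta>s = orthogonal_comp (class_tangent \<mu> A \<Theta> \<theta>s)"


section \<open>Operators on a subspace\<close>

text \<open>An operator on a subspace \<open>W\<close> is a function on the ambient space of which only the values
  on \<open>W\<close> matter.\<close>

definition operator_on :: "'a::real_inner set \<Rightarrow> ('a \<Rightarrow> 'a) \<Rightarrow> bool" where
  "operator_on W T \<longleftrightarrow>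
     (\<forall>g\<in>W. T g \<in> W) \<and> (\<forall>g\<in>W. \<forall>h\<in>W. T (g + h) = T g + T h) \<and>
     (\<forall>c. \<forall>g\<in>W. T (c *\<^sub>R g) = c *\<^sub>R T g)"

definition self_adjoint_on :: "'a::real_inner set \<Rightarrow> ('a \<Rightarrow> 'a) \<Rightarrow> bool" where
  "self_adjoint_on W T \<longleftrightarrow> (\<forall>h\<in>W. \<forall>g\<in>W. h \<bullet> T g = T h \<bullet> g)"

definition psd_on :: "'a::real_inner set \<Rightarrow> ('a \<Rightarrow> 'a) \<Rightarrow> bool" where
  "psd_on W T \<longleftrightarrow> (\<forall>g\<in>W. 0 \<le> g \<bullet> T g)"

definition onorm_on :: "'a::real_inner set \<Rightarrow> ('a \<Rightarrow> 'a) \<Rightarrow> real" where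
  "onorm_on W T = (SUP g\<in>W. norm (T g) / norm g)"

definition riesz_on :: "'a::real_inner set \<Rightarrow> ('a \<Rightarrow> real) \<Rightarrow> 'a" where
  "riesz_on W l = (THE v. v \<in> W \<and> (\<forall>h\<in>W. h \<bullet> v = l h))"

text \<open>The adjoint, as a map into \<open>W\<close>, of the restriction of \<open>F\<close> to \<open>W\<close>.\<close>

definition adjoint_on ::
  "'a::real_inner set \<Rightarrow> ('a \<Rightarrow> 'b::real_inner) \<Rightarrow> 'b \<Rightarrow> 'a" where
  "adjoint_on W F y = riesz_on W (\<lambda>h. F h \<bullet> y)"


section \<open>Fisher information\<close>

definition gradient :: "('a::real_inner \<Rightarrow> real) \<Rightarrow> 'a \<Rightarrow> 'a" where
  "gradient f x = (THE D. GDERIV f x :> D)"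

definition score ::
  "'z measure \<Rightarrow> ('z \<Rightarrow> real ^ 'm ^ 'd) \<Rightarrow> real \<Rightarrow> real ^ 'm \<Rightarrow> real \<Rightarrow> real ^ 'd \<Rightarrow> real ^ 'm" where
  "score \<mu> A \<sigma> \<theta> \<beta> y = gradient (\<lambda>t. ln (obs_density \<mu> A \<sigma> t \<beta> y)) \<theta>"

definition fisher_obs ::
  "'z measure \<Rightarrow> ('z \<Rightarrow> real ^ 'm ^ 'd) \<Rightarrow> real \<Rightarrow> real ^ 'm \<Rightarrow> real \<Rightarrow> real ^ 'm ^ 'm" where
  "fisher_obs \<mu> A \<sigma> \<theta> \<beta> =
     (\<integral>y. (\<chi> i j. score \<mu> A \<sigma> \<theta> \<beta> y $ i * score \<mu> A \<sigma> \<theta> \<beta> y $ j)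
        \<partial>(obs_law \<mu> A \<sigma> \<theta> \<beta>))"

definition fisher_obs_on ::
  "(real ^ 'm) set \<Rightarrow> 'z measure \<Rightarrow> ('z \<Rightarrow> real ^ 'm ^ 'd) \<Rightarrow> real \<Rightarrow> real ^ 'm \<Rightarrow> real
   \<Rightarrow> real ^ 'm \<Rightarrow> real ^ 'm" where
  "fisher_obs_on W \<mu> A \<sigma> \<theta> \<beta> g = riesz_on W (\<lambda>h. h \<bullet> (fisher_obs \<mu> A \<sigma> \<theta> \<beta> *v g))"


section \<open>Symmetric tensors and Hermite tensors\<close>

text \<open>An order-\<open>k\<close> tensor on \<open>\<real>\<^sup>d\<close> is given by its entries, indexed by the lists of length \<open>k\<close>
  over the index type; values at lists of other lengths are irrelevant.\<close>

definition symmetric_tensor :: "nat \<Rightarrow> ('d list \<Rightarrow> real) \<Rightarrow> bool" where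
  "symmetric_tensor k S \<longleftrightarrow>
     (\<forall>xs ys. length xs = k \<longrightarrow> mset xs = mset ys \<longrightarrow> S xs = S ys)"

definition frobenius :: "nat \<Rightarrow> ('d::finite list \<Rightarrow> real) \<Rightarrow> ('d list \<Rightarrow> real) \<Rightarrow> real" where
  "frobenius k S T = (\<Sum>xs | length xs = k. S xs * T xs)"

text \<open>A choice, for each order \<open>k = 1, \<dots>, L\<close>, of a Frobenius-orthonormal basis of the symmetric
  order-\<open>k\<close> tensors. All the bases are indexed jointly by a finite type \<open>'n\<close>: \<open>deg i\<close> is the
  order of the basis tensor \<open>B i\<close>. Hence \<open>real ^ 'n\<close> is the space of stacked coordinate vectors, and
  the cardinality of \<open>'n\<close> is forced to be the sum of the dimensions of the tensor spaces.\<close>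

definition symmetric_tensor_onbs ::
  "nat \<Rightarrow> ('n::finite \<Rightarrow> nat) \<Rightarrow> ('n \<Rightarrow> 'd::finite list \<Rightarrow> real) \<Rightarrow> bool" where
  "symmetric_tensor_onbs L deg B \<longleftrightarrow>
     (\<forall>i. deg i \<in> {1..L} \<and> symmetric_tensor (deg i) (B i)) \<and>
     (\<forall>i j. deg i = deg j \<longrightarrow> frobenius (deg i) (B i) (B j) = (if i = j then 1 else 0)) \<and>
     (\<forall>k\<in>{1..L}. \<forall>S. symmetric_tensor k S \<longrightarrow>
        (\<exists>c. \<forall>xs. length xs = k \<longrightarrow> S xs = (\<Sum>i | deg i = k. c i * B i xs)))"

fun iterated_partial :: "'d::finite list \<Rightarrow> (real ^ 'd \<Rightarrow> real) \<Rightarrow> real ^ 'd \<Rightarrow> real" where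
  "iterated_partial [] f x = f x"
| "iterated_partial (i # is) f x = deriv (\<lambda>t. iterated_partial is f (x + t *\<^sub>R axis i 1)) 0"

definition hermite_tensor :: "real ^ 'd \<Rightarrow> 'd::finite list \<Rightarrow> real" where
  "hermite_tensor x xs =
     (-1) ^ length xs * exp ((norm x)\<^sup>2 / 2) *
     iterated_partial xs (\<lambda>u. exp (- (norm u)\<^sup>2 / 2)) x"


section \<open>Features and GMoM information\<close>

definition features ::
  "('n::finite \<Rightarrow> nat) \<Rightarrow> ('n \<Rightarrow> 'd::finite list \<Rightarrow> real) \<Rightarrow> real \<Rightarrow> real ^ 'd \<Rightarrow> real ^ 'n" where
  "features deg B \<sigma> y = (\<chi> i. frobenius (deg i) (B i) (hermite_tensor ((1 / \<sigma>) *\<^sub>R y)))"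

definition feature_mean ::
  "('n::finite \<Rightarrow> nat) \<Rightarrow> ('n \<Rightarrow> 'd::finite list \<Rightarrow> real) \<Rightarrow> 'z measure \<Rightarrow>
   ('z \<Rightarrow> real ^ 'm ^ 'd) \<Rightarrow> real \<Rightarrow> real ^ 'm \<Rightarrow> real \<Rightarrow> real ^ 'n" where
  "feature_mean deg B \<mu> A \<sigma> \<theta> \<beta> = (\<integral>y. features deg B \<sigma> y \<partial>(obs_law \<mu> A \<sigma> \<theta> \<beta>))"

definition feature_cov ::
  "('n::finite \<Rightarrow> nat) \<Rightarrow> ('n \<Rightarrow> 'd::finite list \<Rightarrow> real) \<Rightarrow> 'z measure \<Rightarrow>
   ('z \<Rightarrow> real ^ 'm ^ 'd) \<Rightarrow> real \<Rightarrow> real ^ 'm \<Rightarrow> real \<Rightarrow> real ^ 'n ^ 'n" where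
  "feature_cov deg B \<mu> A \<sigma> \<theta> \<beta> =
     (\<integral>y. (\<chi> i j. (features deg B \<sigma> y - feature_mean deg B \<mu> A \<sigma> \<theta> \<beta>) $ i *
                  (features deg B \<sigma> y - feature_mean deg B \<mu> A \<sigma> \<theta> \<beta>) $ j)
        \<partial>(obs_law \<mu> A \<sigma> \<theta> \<beta>))"

definition feature_mean_deriv ::
  "('n::finite \<Rightarrow> nat) \<Rightarrow> ('n \<Rightarrow> 'd::finite list \<Rightarrow> real) \<Rightarrow> 'z measure \<Rightarrow>
   ('z \<Rightarrow> real ^ 'm ^ 'd) \<Rightarrow> real \<Rightarrow> real ^ 'm \<Rightarrow> real \<Rightarrow> real ^ 'm \<Rightarrow> real ^ 'n" where
  "feature_mean_deriv deg B \<mu> A \<sigma> \<theta> \<beta> =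
     frechet_derivative (\<lambda>t. feature_mean deg B \<mu> A \<sigma> t \<beta>) (at \<theta>)"

definition fisher_gmom_on ::
  "(real ^ 'm) set \<Rightarrow> ('n::finite \<Rightarrow> nat) \<Rightarrow> ('n \<Rightarrow> 'd::finite list \<Rightarrow> real) \<Rightarrow> 'z measure \<Rightarrow>
   ('z \<Rightarrow> real ^ 'm ^ 'd) \<Rightarrow> real \<Rightarrow> real ^ 'm \<Rightarrow> real \<Rightarrow> real ^ 'm \<Rightarrow> real ^ 'm" where
  "fisher_gmom_on W deg B \<mu> A \<sigma> \<theta> \<beta> g =
     adjoint_on W (feature_mean_deriv deg B \<mu> A \<sigma> \<theta> \<beta>)
       (matrix_inv (feature_cov deg B \<mu> A \<sigma> \<theta> \<beta>) *v feature_mean_deriv deg B \<mu> A \<sigma> \<theta> \<beta> g)"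

end

theory Submission
  imports Defs
begin

text \<open>The score \<open>s\<close> in a fixed direction has mean zero and its covariance with the features is the derivative
  of the feature mean. Hence the GMoM information is the variance of the best affine prediction of
  \<open>s\<close> by the features, and the remainder is the variance of the residual, which is positive
  semidefinite and at most \<open>E (s - P)\<^sup>2\<close> for every \<open>P\<close> in the span of the constants and the features,
  that is, for every polynomial \<open>P\<close> of degree at most \<open>L\<close>. Relative to pure noise the density is
  \<open>r = E exp ((\<beta> y \<bullet> A \<theta> - \<beta>\<^sup>2 \<bar>A \<theta>\<bar>\<^sup>2 / 2) / \<sigma>\<^sup>2)\<close>, where every power of \<open>\<beta>\<close> carries a polynomial in \<open>y\<close>
  of at most that degree. The same holds for the quotient \<open>s = r' / r\<close>, so truncating its expansion
  at order \<open>L\<close> gives such a \<open>P\<close> with error \<open>O(\<beta> ^ (L + 1))\<close>, up to a factor that is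
  exponentially bounded in \<open>y\<close> and thus square integrable.\<close>


subsection \<open>Hermite polynomials in several variables\<close>

text \<open>The obstacle is uniformity: the coefficients of the expansion in \<beta> grow with y, so
  an error O(\<beta> ^ (L + 1)) uniform in y cannot be expected. Every error is therefore allowed a
  factor C * exp (C * |y|) with C independent of \<beta>; such factors are closed under sums and
  products, and a Gaussian integrates them. Averaging over the latent variable and multiplying keep
  the degree tied to the power of \<beta>; the quotient follows because 1 / r has the same growth.
  All estimates hold for 0 \<le> \<beta> \<le> 1, which is why 1 serves as the threshold. The
  covariance of the features is invertible on that whole interval, since the density is positive and
  the constants and features are linearly independent. The two information operators are compared on
  all of \<open>real ^ 'm\<close>; orthogonal projection onto \<open>W\<close> then preserves
  symmetry, positivity and the norm bound. The rate L + 1 in the SNR comes from squaring: the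
  prediction error is of order \<beta> ^ (L + 1), and its mean square is of order (L + 1) in the
  square of \<beta>.\<close>

fun hermite1 :: "nat \<Rightarrow> real \<Rightarrow> real" where
  "hermite1 0 t = 1"
| "hermite1 (Suc 0) t = t"
| "hermite1 (Suc (Suc n)) t = t * hermite1 (Suc n) t - real (Suc n) * hermite1 n t"

text \<open>At n = 0 the truncated index n - 1 is harmless because its coefficient vanishes. This
  removes the case split from everything that follows.\<close>

lemma hermite1_Suc: "hermite1 (Suc n) t = t * hermite1 n t - real n * hermite1 (n - 1) t"
  by (cases n) auto

lemma hermite1_has_derivative: "(hermite1 n has_real_derivative real n * hermite1 (n - 1) t) (at t)"
proof (induction n t rule: hermite1.induct)
  case (3 n t)
  have "((\<lambda>t. t * hermite1 (Suc n) t - real (Suc n) * hermite1 n t) has_real_derivative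
     (1 * hermite1 (Suc n) t + real (Suc n) * hermite1 n t * t) - real (Suc n) * (real n * hermite1 (n - 1) t)) (at t)"
    using 3 by (intro DERIV_diff DERIV_mult DERIV_cmult DERIV_ident) auto
  moreover have "(1 * hermite1 (Suc n) t + real (Suc n) * hermite1 n t * t) - real (Suc n) * (real n * hermite1 (n - 1) t)
     = real (Suc (Suc n)) * hermite1 (Suc n) t"
  proof -
    \<comment> \<open>The recurrence is read backwards to eliminate the lowest of the three
      indices.\<close>
    have "real n * hermite1 (n - 1) t = t * hermite1 n t - hermite1 (Suc n) t" using hermite1_Suc[of n t] by simp
    then show ?thesis by (simp only:) (simp add: algebra_simps)
  qed
  ultimately show ?case by simp
qed (auto intro!: derivative_eq_intros)

lemma continuous_on_hermite1 [continuous_intros]: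
  "continuous_on S f \<Longrightarrow> continuous_on S (\<lambda>x. hermite1 n (f x))"
  by (rule continuous_on_compose2[of UNIV "hermite1 n"])
     (auto intro!: continuous_at_imp_continuous_on DERIV_isCont hermite1_has_derivative)

text \<open>Products of probabilists' Hermite polynomials. A multiset is the right index because an
  entry of the Hermite tensor depends on how often each coordinate occurs, not on the order.\<close>

definition hermite_mv :: "'d multiset \<Rightarrow> real ^ 'd::finite \<Rightarrow> real" where
  "hermite_mv M x = (\<Prod>i\<in>UNIV. hermite1 (count M i) (x $ i))"

lemma hermite_mv_empty [simp]: "hermite_mv {#} x = 1"
  by (simp add: hermite_mv_def)

lemma hermite_mv_split: "hermite_mv M x = hermite1 (count M i) (x $ i) * (\<Prod>j\<in>UNIV - {i}. hermite1 (count M j) (x $ j))"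
  unfolding hermite_mv_def by (rule prod.remove) auto

text \<open>Only the factor at coordinate i changes, so this is the one-dimensional recurrence times
  a common product. If i is not in M, the last term has coefficient 0.\<close>

lemma hermite_mv_add_mset:
  "hermite_mv (add_mset i M) x = x $ i * hermite_mv M x - real (count M i) * hermite_mv (M - {#i#}) x"
proof -
  let ?P = "\<Prod>j\<in>UNIV - {i}. hermite1 (count M j) (x $ j)"
  have "hermite_mv (add_mset i M) x = hermite1 (Suc (count M i)) (x $ i) * ?P"
    by (subst hermite_mv_split[of _ _ i]) (auto intro!: prod.cong)
  moreover have "hermite_mv (M - {#i#}) x = hermite1 (count M i - 1) (x $ i) * ?P"
    by (subst hermite_mv_split[of _ _ i]) (auto intro!: prod.cong)
  moreover have "hermite_mv M x = hermite1 (count M i) (x $ i) * ?P" by (rule hermite_mv_split)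
  ultimately show ?thesis by (simp add: hermite1_Suc algebra_simps)
qed

lemma hermite_mv_has_partial_derivative:
  "((\<lambda>t. hermite_mv M (x + t *\<^sub>R axis i 1)) has_real_derivative
     real (count M i) * hermite_mv (M - {#i#}) x) (at 0)"
proof -
  let ?P = "\<Prod>j\<in>UNIV - {i}. hermite1 (count M j) (x $ j)"
  have "hermite_mv M (x + t *\<^sub>R axis i 1) = hermite1 (count M i) (x $ i + t) * ?P" for t
    by (subst hermite_mv_split[of _ _ i]) (auto intro!: prod.cong simp: axis_def)
  moreover have "hermite_mv (M - {#i#}) x = hermite1 (count M i - 1) (x $ i) * ?P"
    by (subst hermite_mv_split[of _ _ i]) (auto intro!: prod.cong)
  moreover have "((\<lambda>t. hermite1 (count M i) (x $ i + t)) has_real_derivative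
      real (count M i) * hermite1 (count M i - 1) (x $ i)) (at 0)"
    using hermite1_has_derivative[of "count M i" "x $ i"]
      DERIV_shift[of "hermite1 (count M i)" "real (count M i) * hermite1 (count M i - 1) (x $ i)" 0 "x $ i"]
    by (simp only: add.commute[of "x $ i"] add_0)
  ultimately show ?thesis
    using DERIV_mult[OF _ DERIV_const[of ?P]] by (fastforce simp: mult.assoc)
qed

lemma gauss_has_partial_derivative:
  "((\<lambda>t. exp (- (norm (x + t *\<^sub>R axis i 1))\<^sup>2 / 2)) has_real_derivative
     - (x $ i) * exp (- (norm x)\<^sup>2 / 2)) (at 0)"
proof -
  have "(norm (x + t *\<^sub>R axis i 1))\<^sup>2 = (norm x)\<^sup>2 + 2 * t * (x $ i) + t\<^sup>2" for t
    unfolding power2_norm_eq_inner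
    by (simp add: inner_add_left inner_add_right inner_axis inner_commute[of "axis i 1"]
        power2_eq_square algebra_simps)
  then show ?thesis
    by (auto intro!: derivative_eq_intros)
qed

text \<open>Rodrigues' formula. By the product rule one more derivative produces the lowered
  polynomial minus \<open>x $ i\<close> times the old one, which is the recurrence with opposite
  sign; each derivative thus contributes one factor -1.\<close>

lemma iterated_partial_gauss:
  "iterated_partial xs (\<lambda>u. exp (- (norm u)\<^sup>2 / 2)) x =
     (-1) ^ length xs * hermite_mv (mset xs) x * exp (- (norm x)\<^sup>2 / 2)"
proof (induction xs arbitrary: x)
  case (Cons i xs)
  let ?M = "mset xs"
  have "((\<lambda>t. (-1) ^ length xs * hermite_mv ?M (x + t *\<^sub>R axis i 1) * exp (- (norm (x + t *\<^sub>R axis i 1))\<^sup>2 / 2))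
     has_real_derivative
      (-1) ^ length xs * (real (count ?M i) * hermite_mv (?M - {#i#}) x) * exp (- (norm (x + 0 *\<^sub>R axis i 1))\<^sup>2 / 2)
      + - (x $ i) * exp (- (norm x)\<^sup>2 / 2) * ((-1) ^ length xs * hermite_mv ?M (x + 0 *\<^sub>R axis i 1))) (at 0)"
    by (intro DERIV_mult DERIV_cmult hermite_mv_has_partial_derivative gauss_has_partial_derivative)
  from DERIV_imp_deriv[OF this] show ?case
    by (simp only: iterated_partial.simps Cons.IH) (simp add: hermite_mv_add_mset algebra_simps)
qed simp

lemma hermite_tensor_eq_hermite_mv: "hermite_tensor x xs = hermite_mv (mset xs) x"
proof -
  have "(-1) ^ n * e * ((-1) ^ n * h * e') = h" if "e * e' = 1" for n and e e' h :: real
  proof -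
    have "(-1) ^ n * e * ((-1) ^ n * h * e') = ((-1) * (-1)) ^ n * (e * e') * h"
      by (simp only: power_mult_distrib mult_ac)
    with that show ?thesis by simp
  qed
  then show ?thesis
    unfolding hermite_tensor_def iterated_partial_gauss
    by (simp add: exp_add[symmetric])
qed

text \<open>Induction on the degree bound. Differentiating a vanishing combination in direction i
  kills the terms without i and lowers the others, so all coefficients at nonempty multisets vanish;
  what is left is a constant.\<close>

lemma hermite_mv_linear_independent:
  fixes c :: "'d::finite multiset \<Rightarrow> real"
  assumes "finite F" "\<And>M. M \<in> F \<Longrightarrow> size M \<le> N" "\<And>x. (\<Sum>M\<in>F. c M * hermite_mv M x) = 0" "M \<in> F"
  shows "c M = 0"
  using assms
proof (induction N arbitrary: F c M)
  case 0
  then have "F = {{#}}" "M = {#}" by auto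
  with 0(3) show ?case by simp
next
  case (Suc N)
  have nonempty: "c K = 0" if K: "K \<in> F" "i \<in># K" for K i
  proof -
    let ?F = "(\<lambda>K. K - {#i#}) ` {K \<in> F. i \<in># K}"
    \<comment> \<open>Injectivity ensures that no two terms merge, so each lowered coefficient is
      one old coefficient times a positive multiplicity.\<close>
    have inj: "inj_on (\<lambda>K. K - {#i#}) {K \<in> F. i \<in># K}"
      by (rule inj_onI) (metis (mono_tags) insert_DiffM mem_Collect_eq)
    have "((\<lambda>t. \<Sum>M\<in>F. c M * hermite_mv M (x + t *\<^sub>R axis i 1)) has_real_derivative
        (\<Sum>M\<in>F. c M * (real (count M i) * hermite_mv (M - {#i#}) x))) (at 0)" for x
      by (intro DERIV_sum DERIV_cmult hermite_mv_has_partial_derivative)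
    then have "(\<Sum>M\<in>F. c M * (real (count M i) * hermite_mv (M - {#i#}) x)) = 0" for x
      using Suc.prems(3) DERIV_const[of 0] DERIV_unique by (metis (no_types, lifting) ext)
    moreover have "(\<Sum>M\<in>F. c M * (real (count M i) * hermite_mv (M - {#i#}) x)) =
       (\<Sum>M\<in>{K \<in> F. i \<in># K}. c M * (real (count M i) * hermite_mv (M - {#i#}) x))" for x
      by (rule sum.mono_neutral_right) (auto simp: Suc.prems not_in_iff)
    moreover have "\<dots> x =
       (\<Sum>M\<in>?F. (c (add_mset i M) * real (count (add_mset i M) i)) * hermite_mv M x)" for x
      by (subst sum.reindex[OF inj]) (auto intro!: sum.cong)
    ultimately have "(\<Sum>M\<in>?F. (c (add_mset i M) * real (count (add_mset i M) i)) * hermite_mv M x) = 0" for x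
      by simp
    moreover have "size M \<le> N" if "M \<in> ?F" for M
      using that Suc.prems(2) by (fastforce simp: size_Diff_singleton)
    ultimately have "c (add_mset i (K - {#i#})) * real (count (add_mset i (K - {#i#})) i) = 0"
      using Suc.prems(1) K by (intro Suc.IH[of ?F "\<lambda>M. c (add_mset i M) * real (count (add_mset i M) i)"]) auto
    moreover have "count K i \<noteq> 0" using K by simp
    ultimately show ?thesis using K by simp
  qed
  show ?case
  proof (cases "M = {#}")
    case True
    have "(\<Sum>K\<in>F. c K * hermite_mv K 0) = (\<Sum>K\<in>{{#}}. c K * hermite_mv K 0)"
    proof (rule sum.mono_neutral_right)
      show "\<forall>K\<in>F - {{#}}. c K * hermite_mv K 0 = 0"
        using nonempty by (metis DiffE insertI1 mult_zero_left multiset_nonemptyE)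
    qed (use Suc.prems True in auto)
    with Suc.prems(3)[of 0] True show ?thesis by simp
  next
    case False
    with nonempty Suc.prems(4) show ?thesis by (meson multiset_nonemptyE)
  qed
qed

section \<open>Features as coordinates of Hermite tensors\<close>

lemma finite_lists_of_length: "finite {xs :: 'd::finite list. length xs = k}"
  using finite_lists_length_eq[of "UNIV :: 'd set" k] by simp

lemma features_nth:
  "features deg B \<sigma> y $ i =
     (\<Sum>xs | length xs = deg i. B i xs * hermite_mv (mset xs) ((1 / \<sigma>) *\<^sub>R y))"
  by (simp add: features_def frobenius_def hermite_tensor_eq_hermite_mv)

lemma sum_over_onb:
  assumes "symmetric_tensor_onbs L deg B" "k \<in> {1..L}" "symmetric_tensor k S"
  obtains c where "\<And>xs. length xs = k \<Longrightarrow> S xs = (\<Sum>i | deg i = k. c i * B i xs)"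
proof -
  have "\<exists>c. \<forall>xs. length xs = k \<longrightarrow> S xs = (\<Sum>i | deg i = k. c i * B i xs)"
    using assms(1)[unfolded symmetric_tensor_onbs_def, THEN conjunct2, THEN conjunct2] assms(2,3)
    by blast
  with that show thesis by blast
qed

text \<open>The indicator of the lists that arrange M is a symmetric tensor. Expanding it in the
  basis and contracting with the Hermite tensor returns the polynomial of M once for every
  arrangement.\<close>

lemma hermite_mv_in_span_features:
  fixes B :: "'n::finite \<Rightarrow> 'd::finite list \<Rightarrow> real"
  assumes onb: "symmetric_tensor_onbs L deg B" and M: "size M \<in> {1..L}"
  shows "\<exists>a. \<forall>y. hermite_mv M ((1 / \<sigma>) *\<^sub>R y) = a \<bullet> features deg B \<sigma> y"
proof -
  define k where "k = size M"
  define S :: "'d list \<Rightarrow> real" where "S = (\<lambda>xs. if mset xs = M then 1 else 0)"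
  define X where "X = {xs :: 'd list. length xs = k}"
  \<comment> \<open>The number of arrangements of M, to be divided out; it is positive because every
    finite multiset comes from some list.\<close>
  define m where "m = real (card {xs \<in> X. mset xs = M})"
  have fin: "finite X" unfolding X_def by (rule finite_lists_of_length)
  have "symmetric_tensor k S" by (auto simp: symmetric_tensor_def S_def)
  then obtain c where c: "\<And>xs. length xs = k \<Longrightarrow> S xs = (\<Sum>i | deg i = k. c i * B i xs)"
    by (rule sum_over_onb[OF onb M[folded k_def]]) blast
  obtain xs where "mset xs = M" using ex_mset by blast
  then have "xs \<in> {xs \<in> X. mset xs = M}" by (auto simp: X_def k_def)
  then have m: "m > 0" unfolding m_def using fin by (auto simp: card_gt_0_iff)
  define a :: "real ^ 'n" where "a = (\<chi> i. if deg i = k then c i / m else 0)"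
  have "a \<bullet> features deg B \<sigma> y = hermite_mv M ((1 / \<sigma>) *\<^sub>R y)" for y
  proof -
    let ?H = "\<lambda>M. hermite_mv M ((1 / \<sigma>) *\<^sub>R y)"
    have "a \<bullet> features deg B \<sigma> y =
        (\<Sum>i\<in>UNIV. if deg i = k then c i / m * (\<Sum>xs\<in>X. B i xs * ?H (mset xs)) else 0)"
      unfolding inner_vec_def by (auto intro!: sum.cong simp: a_def features_nth X_def)
    also have "\<dots> = (\<Sum>i | deg i = k. c i / m * (\<Sum>xs\<in>X. B i xs * ?H (mset xs)))"
      by (subst sum.inter_filter[symmetric]) auto
    also have "\<dots> = (\<Sum>xs\<in>X. (\<Sum>i | deg i = k. c i * B i xs) * ?H (mset xs)) / m"
      by (simp add: sum_distrib_left sum_distrib_right sum_divide_distrib) (subst sum.swap, simp add: mult_ac)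
    also have "\<dots> = (\<Sum>xs\<in>X. S xs * ?H (mset xs)) / m"
      by (simp add: X_def c[symmetric])
    also have "(\<Sum>xs\<in>X. S xs * ?H (mset xs)) = (\<Sum>xs\<in>X. if mset xs = M then ?H M else 0)"
      by (auto intro!: sum.cong simp: S_def)
    also have "\<dots> = m * ?H M"
      by (subst sum.inter_filter[symmetric]) (auto simp: fin m_def)
    finally show ?thesis using m by simp
  qed
  then show ?thesis by (intro exI[of _ a]) simp
qed

text \<open>The relation is rewritten as a vanishing combination of Hermite polynomials, so the
  symmetric tensor S with coordinates a vanishes in every order, and orthonormality recovers a from
  S. This is what makes the feature covariance nonsingular.\<close>

lemma features_affinely_independent:
  fixes B :: "'n::finite \<Rightarrow> 'd::finite list \<Rightarrow> real"
  assumes onb: "symmetric_tensor_onbs L deg B" and \<sigma>: "\<sigma> > 0"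
    and const: "\<And>y. a \<bullet> features deg B \<sigma> y = c"
  shows "a = 0"
proof -
  define X where "X = {xs :: 'd list. length xs \<le> L}"
  define S where "S = (\<lambda>xs. \<Sum>i | deg i = length xs. a $ i * B i xs)"
  \<comment> \<open>The constant c becomes a coefficient at the empty list, whose Hermite polynomial
    is 1. Since all orders of basis tensors are at least 1, S itself has no contribution
    there.\<close>
  define S' where "S' = (\<lambda>xs. S xs - (if xs = [] then c else 0))"
  have fin: "finite X"
    using finite_lists_length_le[of "UNIV :: 'd set" L] by (simp add: X_def)
  have deg: "deg i \<in> {1..L}" for i using onb unfolding symmetric_tensor_onbs_def by blast
  have sum: "(\<Sum>xs\<in>X. S' xs * hermite_mv (mset xs) x) = 0" for x
  proof -
    have "c = a \<bullet> features deg B \<sigma> (\<sigma> *\<^sub>R x)" using const by simp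
    also have "\<dots> = (\<Sum>i\<in>UNIV. a $ i * (\<Sum>xs | length xs = deg i. B i xs * hermite_mv (mset xs) x))"
      unfolding inner_vec_def using \<sigma> by (simp add: features_nth)
    also have "\<dots> = (\<Sum>i\<in>UNIV. \<Sum>xs\<in>X. if deg i = length xs then a $ i * B i xs * hermite_mv (mset xs) x else 0)"
    proof (rule sum.cong[OF refl])
      fix i
      have "{xs \<in> X. deg i = length xs} = {xs. length xs = deg i}"
        using deg[of i] by (auto simp: X_def)
      then show "a $ i * (\<Sum>xs | length xs = deg i. B i xs * hermite_mv (mset xs) x) =
          (\<Sum>xs\<in>X. if deg i = length xs then a $ i * B i xs * hermite_mv (mset xs) x else 0)"
        by (simp add: sum.inter_filter[symmetric] fin sum_distrib_left mult_ac)
    qed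
    also have "\<dots> = (\<Sum>xs\<in>X. \<Sum>i\<in>UNIV. if deg i = length xs then a $ i * B i xs * hermite_mv (mset xs) x else 0)"
      by (rule sum.swap)
    also have "\<dots> = (\<Sum>xs\<in>X. S xs * hermite_mv (mset xs) x)"
      by (simp add: S_def sum.inter_filter[symmetric] sum_distrib_right)
    finally have "(\<Sum>xs\<in>X. S xs * hermite_mv (mset xs) x) = c" by simp
    moreover have "(\<Sum>xs\<in>X. (if xs = [] then c else 0) * hermite_mv (mset xs) x) = (\<Sum>xs\<in>X. (if xs = [] then c else 0))"
      by (rule sum.cong) auto
    moreover have "\<dots> = c" using fin by (simp add: X_def)
    ultimately show ?thesis by (simp add: S'_def left_diff_distrib sum_subtractf)
  qed
  have sym: "S xs = S ys" if "mset xs = mset ys" for xs ys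
  proof -
    have "length xs = length ys" using that by (metis size_mset)
    moreover have "B i xs = B i ys" if "deg i = length xs" for i
      using onb that \<open>mset xs = mset ys\<close> unfolding symmetric_tensor_onbs_def symmetric_tensor_def by metis
    ultimately show ?thesis by (auto simp: S_def intro!: sum.cong)
  qed
  have S0: "S xs = 0" if xs: "xs \<in> X" "xs \<noteq> []" for xs
  proof -
    \<comment> \<open>Lists with equal multisets give the same polynomial, so independence only
      yields that coefficient sums over arrangements vanish; symmetry of S turns such a sum into a
      positive multiple of one entry.\<close>
    have "(\<Sum>M\<in>mset ` X. (\<Sum>xs | xs \<in> X \<and> mset xs = M. S' xs) * hermite_mv M x) = 0" for x
    proof -
      have "(\<Sum>xs\<in>X. S' xs * hermite_mv (mset xs) x) =
        (\<Sum>M\<in>mset ` X. \<Sum>xs | xs \<in> X \<and> mset xs = M. S' xs * hermite_mv (mset xs) x)"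
        by (rule sum.image_gen[OF fin])
      also have "\<dots> = (\<Sum>M\<in>mset ` X. (\<Sum>xs | xs \<in> X \<and> mset xs = M. S' xs) * hermite_mv M x)"
        by (simp add: sum_distrib_right)
      finally show ?thesis using sum by simp
    qed
    then have "(\<Sum>ys | ys \<in> X \<and> mset ys = mset xs. S' ys) = 0"
      using fin xs by (intro hermite_mv_linear_independent[of "mset ` X" L
        "\<lambda>M. \<Sum>ys | ys \<in> X \<and> mset ys = M. S' ys"]) (auto simp: X_def)
    moreover have "(\<Sum>ys | ys \<in> X \<and> mset ys = mset xs. S' ys) =
        (\<Sum>ys | ys \<in> X \<and> mset ys = mset xs. S xs)"
    proof (rule sum.cong[OF refl])
      fix ys assume "ys \<in> {ys. ys \<in> X \<and> mset ys = mset xs}"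
      then have "ys \<noteq> []" "S ys = S xs" using xs sym[of ys xs] by auto
      then show "S' ys = S xs" by (simp add: S'_def)
    qed
    ultimately have "real (card {ys \<in> X. mset ys = mset xs}) * S xs = 0" by simp
    moreover have "card {ys \<in> X. mset ys = mset xs} \<noteq> 0"
      using fin xs by (auto simp: card_eq_0_iff)
    ultimately show ?thesis by simp
  qed
  have "a $ j = 0" for j
  proof -
    \<comment> \<open>Pairing the vanishing tensor with \<open>B j\<close> isolates
      \<open>a $ j\<close> by orthonormality.\<close>
    have "0 = (\<Sum>xs | length xs = deg j. S xs * B j xs)"
      by (rule sum.neutral[symmetric]) (use deg[of j] in \<open>auto simp: X_def intro!: S0\<close>)
    also have "\<dots> = (\<Sum>xs | length xs = deg j. \<Sum>i | deg i = deg j. a $ i * (B i xs * B j xs))"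
      by (simp add: S_def sum_distrib_right mult.assoc)
    also have "\<dots> = (\<Sum>i | deg i = deg j. a $ i * frobenius (deg i) (B i) (B j))"
      by (subst sum.swap) (simp add: frobenius_def sum_distrib_left)
    also have "\<dots> = (\<Sum>i | deg i = deg j. if i = j then a $ i else 0)"
    proof (rule sum.cong[OF refl])
      fix i assume "i \<in> {i. deg i = deg j}"
      then have "frobenius (deg i) (B i) (B j) = (if i = j then 1 else 0)"
        using onb unfolding symmetric_tensor_onbs_def by blast
      then show "a $ i * frobenius (deg i) (B i) (B j) = (if i = j then a $ i else 0)" by simp
    qed
    also have "\<dots> = a $ j" by simp
    finally show ?thesis by simp
  qed
  then show ?thesis by (simp add: vec_eq_iff)
qed


subsection \<open>Polynomials and exponentially bounded functions\<close>

text \<open>Total degree at most n, generated by multiplying with one coordinate at a time: this is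
  the operation that the Hermite recurrence describes, so conversion to \<open>hermite_span\<close>
  goes rule by rule.\<close>

inductive poly_deg :: "nat \<Rightarrow> (real ^ 'd::finite \<Rightarrow> real) \<Rightarrow> bool" where
  poly_deg_const: "poly_deg n (\<lambda>x. c)"
| poly_deg_add: "poly_deg n f \<Longrightarrow> poly_deg n g \<Longrightarrow> poly_deg n (\<lambda>x. f x + g x)"
| poly_deg_coord: "poly_deg n f \<Longrightarrow> poly_deg (Suc n) (\<lambda>x. x $ i * f x)"

lemma poly_deg_mono: "poly_deg n f \<Longrightarrow> n \<le> m \<Longrightarrow> poly_deg m f"
proof (induction arbitrary: m rule: poly_deg.induct)
  case (poly_deg_coord n f i)
  then show ?case by (cases m) (auto intro: poly_deg.intros)
qed (auto intro: poly_deg.intros)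

lemma poly_deg_cmult: "poly_deg n f \<Longrightarrow> poly_deg n (\<lambda>x. c * f x)"
proof (induction rule: poly_deg.induct)
  case (poly_deg_add n f g)
  then show ?case by (simp add: distrib_left poly_deg.poly_deg_add)
next
  case (poly_deg_coord n f i)
  then show ?case using poly_deg.poly_deg_coord[of n "\<lambda>x. c * f x" i] by (simp add: mult_ac)
qed (auto intro: poly_deg.intros)

lemma poly_deg_mult: "poly_deg n f \<Longrightarrow> poly_deg m g \<Longrightarrow> poly_deg (n + m) (\<lambda>x. f x * g x)"
proof (induction rule: poly_deg.induct)
  case (poly_deg_const n c)
  then show ?case by (auto intro: poly_deg_mono[OF poly_deg_cmult])
next
  case (poly_deg_add n f g)
  then show ?case by (simp add: distrib_right poly_deg.poly_deg_add)
next
  case (poly_deg_coord n f i)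
  then show ?case using poly_deg.poly_deg_coord[of "n + m" "\<lambda>x. f x * g x" i] by (simp add: mult_ac)
qed

lemma poly_deg_scale: "poly_deg n f \<Longrightarrow> poly_deg n (\<lambda>x. f (c *\<^sub>R x))"
proof (induction rule: poly_deg.induct)
  case (poly_deg_coord n f i)
  then show ?case
    using poly_deg_cmult[OF poly_deg.poly_deg_coord[of n "\<lambda>x. f (c *\<^sub>R x)" i], of c]
    by (simp add: mult_ac)
qed (auto intro: poly_deg.intros)

lemma poly_deg_nth: "poly_deg (Suc 0) (\<lambda>x. x $ i)"
  using poly_deg_coord[OF poly_deg_const[of 0 1], of i] by simp

lemma continuous_on_poly_deg: "poly_deg n f \<Longrightarrow> continuous_on UNIV f"
  by (induction rule: poly_deg.induct) (intro continuous_intros; assumption)+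

text \<open>One constant serves all parameters p, which later are \<beta> or pairs of z and \<beta>.
  It is both prefactor and rate, so that a single witness has to be carried around;
  \<open>exp_boundedI\<close> accepts two.\<close>

definition exp_bounded :: "'p set \<Rightarrow> ('p \<Rightarrow> 'a::real_normed_vector \<Rightarrow> real) \<Rightarrow> bool" where
  "exp_bounded S f \<longleftrightarrow> (\<exists>C\<ge>0. \<forall>p\<in>S. \<forall>y. \<bar>f p y\<bar> \<le> C * exp (C * norm y))"

lemma exp_boundedI:
  assumes "K \<ge> 0" "K' \<ge> 0" "\<And>p y. p \<in> S \<Longrightarrow> \<bar>f p y\<bar> \<le> K * exp (K' * norm y)"
  shows "exp_bounded S f"
  unfolding exp_bounded_def
proof (intro exI[of _ "K + K'"] conjI ballI allI)
  fix p y assume "p \<in> S"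
  then have "\<bar>f p y\<bar> \<le> K * exp (K' * norm y)" by (rule assms(3))
  also have "\<dots> \<le> (K + K') * exp ((K + K') * norm y)"
    using assms(1,2) by (intro mult_mono) (auto intro!: mult_right_mono)
  finally show "\<bar>f p y\<bar> \<le> (K + K') * exp ((K + K') * norm y)" .
qed (use assms in auto)

lemma exp_bounded_mono:
  assumes "exp_bounded S g" "\<And>p y. p \<in> S \<Longrightarrow> \<bar>f p y\<bar> \<le> \<bar>g p y\<bar>"
  shows "exp_bounded S f"
  using assms unfolding exp_bounded_def by (meson order_trans)

lemma exp_bounded_reindex:
  assumes "exp_bounded S f" "\<And>t. t \<in> T \<Longrightarrow> h t \<in> S"
  shows "exp_bounded T (\<lambda>t. f (h t))"
  using assms unfolding exp_bounded_def by metis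

lemma exp_bounded_const: "exp_bounded S (\<lambda>p y. c)"
  by (rule exp_boundedI[of "\<bar>c\<bar>" 0]) auto

lemma exp_bounded_param: "(\<And>p. p \<in> S \<Longrightarrow> \<bar>g p\<bar> \<le> K) \<Longrightarrow> exp_bounded S (\<lambda>p y. g p)"
  by (rule exp_boundedI[of "\<bar>K\<bar>" 0]) fastforce+

lemma exp_bounded_norm: "exp_bounded S (\<lambda>p y. norm y)"
proof (rule exp_boundedI[of 1 1])
  fix y :: 'b
  show "\<bar>norm y\<bar> \<le> 1 * exp (1 * norm y)" using exp_ge_add_one_self[of "norm y"] norm_ge_zero[of y]
    unfolding mult_1 by linarith
qed auto

lemma exp_bounded_exp: "K \<ge> 0 \<Longrightarrow> exp_bounded S (\<lambda>p y. exp (K * (1 + norm y)))"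
  by (rule exp_boundedI[of "exp K" K]) (auto simp: algebra_simps exp_add)

lemma exp_bounded_add:
  assumes "exp_bounded S f" "exp_bounded S g"
  shows "exp_bounded S (\<lambda>p y. f p y + g p y)"
proof -
  from assms obtain C D where C: "C \<ge> 0" "\<And>p y. p \<in> S \<Longrightarrow> \<bar>f p y\<bar> \<le> C * exp (C * norm y)"
    and D: "D \<ge> 0" "\<And>p y. p \<in> S \<Longrightarrow> \<bar>g p y\<bar> \<le> D * exp (D * norm y)"
    unfolding exp_bounded_def by metis
  show ?thesis
  proof (rule exp_boundedI[of "C + D" "C + D"])
    fix p y assume p: "p \<in> S"
    have "\<bar>f p y + g p y\<bar> \<le> \<bar>f p y\<bar> + \<bar>g p y\<bar>" by simp
    also have "\<dots> \<le> C * exp ((C + D) * norm y) + D * exp ((C + D) * norm y)"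
      using C(1) D(1)
      by (intro add_mono order_trans[OF C(2)[OF p]] order_trans[OF D(2)[OF p]] mult_left_mono)
         (auto intro!: mult_right_mono)
    finally show "\<bar>f p y + g p y\<bar> \<le> (C + D) * exp ((C + D) * norm y)" by (simp add: algebra_simps)
  qed (use C D in auto)
qed

lemma exp_bounded_mult:
  assumes "exp_bounded S f" "exp_bounded S g"
  shows "exp_bounded S (\<lambda>p y. f p y * g p y)"
proof -
  from assms obtain C D where C: "C \<ge> 0" "\<And>p y. p \<in> S \<Longrightarrow> \<bar>f p y\<bar> \<le> C * exp (C * norm y)"
    and D: "D \<ge> 0" "\<And>p y. p \<in> S \<Longrightarrow> \<bar>g p y\<bar> \<le> D * exp (D * norm y)"
    unfolding exp_bounded_def by metis
  show ?thesis
  proof (rule exp_boundedI[of "C * D" "C + D"])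
    fix p y assume p: "p \<in> S"
    have "\<bar>f p y * g p y\<bar> \<le> (C * exp (C * norm y)) * (D * exp (D * norm y))"
      unfolding abs_mult using C D p by (intro mult_mono) auto
    then show "\<bar>f p y * g p y\<bar> \<le> C * D * exp ((C + D) * norm y)"
      by (simp add: algebra_simps exp_add)
  qed (use C D in auto)
qed

lemma exp_bounded_power: "exp_bounded S f \<Longrightarrow> exp_bounded S (\<lambda>p y. f p y ^ n)"
  by (induction n) (auto intro: exp_bounded_const exp_bounded_mult)

lemma exp_bounded_sum:
  "(\<And>i. i \<in> I \<Longrightarrow> exp_bounded S (f i)) \<Longrightarrow> exp_bounded S (\<lambda>p y. \<Sum>i\<in>I. f i p y)"
  by (induction I rule: infinite_finite_induct) (auto intro: exp_bounded_const exp_bounded_add)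

lemma exp_bounded_abs: "exp_bounded S f \<Longrightarrow> exp_bounded S (\<lambda>p y. \<bar>f p y\<bar>)"
  by (erule exp_bounded_mono) auto

lemma exp_bounded_diff:
  assumes "exp_bounded S f" "exp_bounded S g"
  shows "exp_bounded S (\<lambda>p y. f p y - g p y)"
  using exp_bounded_add[OF assms(1) exp_bounded_mult[OF exp_bounded_const[of S "-1"] assms(2)]]
  by simp

lemmas exp_bounded_intros = exp_bounded_const exp_bounded_norm exp_bounded_exp exp_bounded_add
  exp_bounded_mult exp_bounded_power exp_bounded_sum exp_bounded_abs exp_bounded_diff

lemma exp_bounded_poly_deg: "poly_deg n f \<Longrightarrow> exp_bounded S (\<lambda>p. f)"
proof (induction rule: poly_deg.induct)
  case (poly_deg_coord n f i)
  have "exp_bounded S (\<lambda>p (x :: real ^ 'a). x $ i)"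
    by (rule exp_bounded_mono[OF exp_bounded_norm]) (simp add: component_le_norm_cart)
  then show ?case using poly_deg_coord by (intro exp_bounded_mult)
qed (auto intro: exp_bounded_intros)


subsection \<open>Polynomials graded by powers of the signal strength\<close>

text \<open>Truncating such a function in \<open>\<beta>\<close> at order \<open>L\<close> leaves a polynomial of degree at most \<open>L\<close> in \<open>y\<close>,
  whatever the value of the latent variable \<open>z\<close>.\<close>

inductive graded :: "'z measure \<Rightarrow> ('z \<Rightarrow> real \<Rightarrow> real ^ 'd::finite \<Rightarrow> real) \<Rightarrow> bool" for M where
  graded_term: "b \<in> borel_measurable M \<Longrightarrow> (\<And>z. \<bar>b z\<bar> \<le> K) \<Longrightarrow> poly_deg k c \<Longrightarrow>
     graded M (\<lambda>z \<beta> y. b z * (\<beta> ^ k * c y))"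
| graded_add: "graded M f \<Longrightarrow> graded M g \<Longrightarrow> graded M (\<lambda>z \<beta> y. f z \<beta> y + g z \<beta> y)"

lemma graded_const: "graded M (\<lambda>z \<beta> y. c)"
  using graded_term[of "\<lambda>z. c" M "\<bar>c\<bar>" 0 "\<lambda>y. 1"] by (simp add: poly_deg_const)

lemma graded_mult: "graded M f \<Longrightarrow> graded M g \<Longrightarrow> graded M (\<lambda>z \<beta> y. f z \<beta> y * g z \<beta> y)"
proof (induction rule: graded.induct)
  case f: (graded_term b K k c)
  from f(4) show ?case
  proof (induction rule: graded.induct)
    case g: (graded_term b' K' k' c')
    have "\<bar>b z * b' z\<bar> \<le> K * K'" for z
      unfolding abs_mult using f(2)[of z] g(2)[of z] by (intro mult_mono) auto
    then have "graded M (\<lambda>z \<beta> y. b z * b' z * (\<beta> ^ (k + k') * (c y * c' y)))"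
      using f g by (intro graded.graded_term poly_deg_mult) auto
    then show ?case by (simp add: power_add mult_ac)
  next
    case (graded_add f g)
    then show ?case using graded.graded_add by (fastforce simp: distrib_left)
  qed
next
  case (graded_add f f')
  then show ?case using graded.graded_add by (fastforce simp: distrib_right)
qed

lemma graded_sum:
  "(\<And>i. i \<in> I \<Longrightarrow> graded M (f i)) \<Longrightarrow> graded M (\<lambda>z \<beta> y. \<Sum>i\<in>I. f i z \<beta> y)"
  by (induction I rule: infinite_finite_induct) (auto intro: graded_const graded_add)

lemma graded_power: "graded M f \<Longrightarrow> graded M (\<lambda>z \<beta> y. f z \<beta> y ^ n)"
  by (induction n) (auto intro: graded_const graded_mult)

lemma graded_measurable: "graded M f \<Longrightarrow> (\<lambda>z. f z \<beta> y) \<in> borel_measurable M"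
  by (induction rule: graded.induct) auto

lemma graded_bounded: "graded M f \<Longrightarrow> \<exists>K. \<forall>z. \<bar>f z \<beta> y\<bar> \<le> K"
proof (induction rule: graded.induct)
  case (graded_term b K k c)
  then have "\<bar>b z * (\<beta> ^ k * c y)\<bar> \<le> K * \<bar>\<beta> ^ k * c y\<bar>" for z
    by (subst abs_mult) (intro mult_right_mono, auto)
  then show ?case by blast
next
  case (graded_add f g)
  then obtain K K' where "\<forall>z. \<bar>f z \<beta> y\<bar> \<le> K" "\<forall>z. \<bar>g z \<beta> y\<bar> \<le> K'" by blast
  then have "\<bar>f z \<beta> y + g z \<beta> y\<bar> \<le> K + K'" for z by (meson abs_triangle_ineq add_mono order_trans)
  then show ?case by blast
qed

lemma graded_exp_bounded:
  fixes M :: "'z measure"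
  shows "graded M f \<Longrightarrow> exp_bounded (UNIV \<times> {0..1}) (\<lambda>(z, \<beta>). f z \<beta>)"
proof (induction rule: graded.induct)
  case (graded_term b K k c)
  have "exp_bounded (UNIV \<times> {0..1::real}) (\<lambda>p y. (case p of (z, \<beta>) \<Rightarrow> b z * \<beta> ^ k) * c y)"
  proof (intro exp_bounded_mult exp_bounded_poly_deg[OF graded_term(3)] exp_bounded_param)
    fix p :: "'z \<times> real" assume p: "p \<in> UNIV \<times> {0..1}"
    have "\<bar>b (fst p) * snd p ^ k\<bar> \<le> K * 1"
      unfolding abs_mult using p graded_term(2)[of "fst p"]
      by (intro mult_mono) (auto simp: power_le_one power_abs)
    then show "\<bar>case p of (z, \<beta>) \<Rightarrow> b z * \<beta> ^ k\<bar> \<le> K" by (simp add: case_prod_unfold)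
  qed
  then show ?case by (simp add: case_prod_unfold mult.assoc)
next
  case (graded_add f g)
  then show ?case using exp_bounded_add by (fastforce simp: case_prod_unfold)
qed

lemma (in prob_space) integrable_graded: "graded M f \<Longrightarrow> integrable M (\<lambda>z. f z \<beta> y)"
  using graded_bounded[of M f \<beta> y] graded_measurable[of M f \<beta> y] integrable_const_bound
  by (metis AE_I2 real_norm_def)

text \<open>Averaging replaces the bounded coefficient b by its mean and leaves the power of \<beta>
  attached to the same polynomial.\<close>

lemma (in prob_space) graded_integral:
  "graded M f \<Longrightarrow> graded M (\<lambda>_ \<beta> y. \<integral>z. f z \<beta> y \<partial>M)"
proof (induction rule: graded.induct)
  case (graded_term b K k c)
  have "graded M (\<lambda>_ \<beta> y. (\<integral>z. b z \<partial>M) * (\<beta> ^ k * c y))"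
    using graded_term(3) by (intro graded.graded_term[of _ _ "\<bar>\<integral>z. b z \<partial>M\<bar>"]) auto
  then show ?case by (simp add: mult.assoc)
next
  case (graded_add f g)
  then show ?case by (simp add: integrable_graded graded.graded_add)
qed

lemma graded_truncate:
  "graded M f \<Longrightarrow> \<exists>r. exp_bounded {0..1} r \<and>
     (\<forall>\<beta>\<in>{0..1}. \<exists>p. poly_deg L p \<and> (\<forall>y. \<bar>f z \<beta> y - p y\<bar> \<le> \<beta> ^ Suc L * r \<beta> y))"
proof (induction rule: graded.induct)
  case (graded_term b K k c)
  show ?case
  proof (cases "k \<le> L")
    case True
    have "poly_deg L (\<lambda>y. b z * (\<beta> ^ k * c y))" for \<beta>
      by (intro poly_deg_cmult poly_deg_mono[OF graded_term(3) True])
    then show ?thesis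
      by (intro exI[of _ "\<lambda>_ _. 0"] conjI exp_bounded_const ballI exI, assumption) auto
  next
    case False
    \<comment> \<open>A term of order above L is dropped altogether. On the unit interval its power
      of \<beta> is at most \<beta> ^ (L + 1).\<close>
    have "\<bar>b z * (\<beta> ^ k * c y) - 0\<bar> \<le> \<beta> ^ Suc L * (\<bar>b z\<bar> * \<bar>c y\<bar>)" if "\<beta> \<in> {0..1}" for \<beta> y
    proof -
      have "\<beta> ^ k \<le> \<beta> ^ Suc L" using that False by (intro power_decreasing) auto
      then have "\<beta> ^ k * (\<bar>b z\<bar> * \<bar>c y\<bar>) \<le> \<beta> ^ Suc L * (\<bar>b z\<bar> * \<bar>c y\<bar>)"
        by (intro mult_right_mono) auto
      then show ?thesis using that by (simp add: abs_mult power_abs mult_ac)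
    qed
    moreover have "exp_bounded {0..1::real} (\<lambda>_ y. \<bar>b z\<bar> * \<bar>c y\<bar>)"
      by (intro exp_bounded_intros exp_bounded_poly_deg[OF graded_term(3)])
    ultimately show ?thesis using poly_deg_const[of L 0] by blast
  qed
next
  case (graded_add f g)
  then obtain r r' where r: "exp_bounded {0..1} r" "exp_bounded {0..1} r'"
    "\<And>\<beta>. \<beta> \<in> {0..1} \<Longrightarrow> \<exists>p. poly_deg L p \<and> (\<forall>y. \<bar>f z \<beta> y - p y\<bar> \<le> \<beta> ^ Suc L * r \<beta> y)"
    "\<And>\<beta>. \<beta> \<in> {0..1} \<Longrightarrow> \<exists>p. poly_deg L p \<and> (\<forall>y. \<bar>g z \<beta> y - p y\<bar> \<le> \<beta> ^ Suc L * r' \<beta> y)"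
    by blast
  have "\<exists>p. poly_deg L p \<and> (\<forall>y. \<bar>f z \<beta> y + g z \<beta> y - p y\<bar> \<le> \<beta> ^ Suc L * (r \<beta> y + r' \<beta> y))"
    if \<beta>: "\<beta> \<in> {0..1}" for \<beta>
  proof -
    obtain p p' where p: "poly_deg L p" "poly_deg L p'"
      "\<And>y. \<bar>f z \<beta> y - p y\<bar> \<le> \<beta> ^ Suc L * r \<beta> y" "\<And>y. \<bar>g z \<beta> y - p' y\<bar> \<le> \<beta> ^ Suc L * r' \<beta> y"
      using r(3,4)[OF \<beta>] by blast
    have "\<bar>f z \<beta> y + g z \<beta> y - (p y + p' y)\<bar> \<le> \<beta> ^ Suc L * (r \<beta> y + r' \<beta> y)" for y
      unfolding distrib_left using p(3,4)[of y] by linarith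
    with p(1,2) show ?thesis by (intro exI[of _ "\<lambda>y. p y + p' y"]) (auto intro: poly_deg_add)
  qed
  with r(1,2) show ?case by (intro exI[of _ "\<lambda>\<beta> y. r \<beta> y + r' \<beta> y"]) (auto intro: exp_bounded_add)
qed

text \<open>Graded modulo \<beta> ^ (L + 1) times an exponentially bounded factor. The graded part q
  may contain orders above L, which makes closure under products immediate; truncation is postponed
  to \<open>graded_upto_truncate\<close>.\<close>

definition graded_upto :: "'z measure \<Rightarrow> nat \<Rightarrow> (real \<Rightarrow> real ^ 'd::finite \<Rightarrow> real) \<Rightarrow> bool" where
  "graded_upto M L f \<longleftrightarrow> (\<exists>q r. graded M (\<lambda>_. q) \<and> exp_bounded {0..1} r \<and>
     (\<forall>\<beta>\<in>{0..1}. \<forall>y. \<bar>f \<beta> y - q \<beta> y\<bar> \<le> \<beta> ^ Suc L * r \<beta> y))"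

lemma graded_imp_graded_upto: "graded M (\<lambda>_. q) \<Longrightarrow> graded_upto M L q"
  unfolding graded_upto_def
  by (intro exI[of _ q] exI[of _ "\<lambda>_ _. 0"]) (auto intro: exp_bounded_const)

lemma graded_const_exp_bounded: "graded M (\<lambda>_. q) \<Longrightarrow> exp_bounded {0..1} q"
  using exp_bounded_reindex[OF graded_exp_bounded[of M "\<lambda>_. q"], of "{0..1}" "\<lambda>\<beta>. (undefined, \<beta>)"]
  by simp

lemma graded_upto_exp_bounded:
  fixes f :: "real \<Rightarrow> real ^ 'd::finite \<Rightarrow> real"
  assumes "graded_upto M L f"
  shows "exp_bounded {0..1} f"
proof -
  obtain q r where q: "graded M (\<lambda>_. q)" "exp_bounded {0..1} r"
    "\<And>\<beta> y. \<beta> \<in> {0..1} \<Longrightarrow> \<bar>f \<beta> y - q \<beta> y\<bar> \<le> \<beta> ^ Suc L * r \<beta> y"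
    using assms unfolding graded_upto_def by blast
  have "exp_bounded {0..1} (\<lambda>\<beta> y. \<bar>q \<beta> y\<bar> + \<bar>r \<beta> y\<bar>)"
    by (intro exp_bounded_intros q graded_const_exp_bounded[OF q(1)])
  then show ?thesis
  proof (rule exp_bounded_mono)
    fix \<beta> :: real and y :: "real ^ 'd" assume \<beta>: "\<beta> \<in> {0..1}"
    have "\<beta> ^ Suc L * r \<beta> y \<le> \<beta> ^ Suc L * \<bar>r \<beta> y\<bar>"
      using \<beta> by (intro mult_left_mono) auto
    also have "\<dots> \<le> 1 * \<bar>r \<beta> y\<bar>"
      using \<beta> by (intro mult_right_mono power_le_one) auto
    finally have "\<beta> ^ Suc L * r \<beta> y \<le> 1 * \<bar>r \<beta> y\<bar>" .
    with q(3)[OF \<beta>, of y] show "\<bar>f \<beta> y\<bar> \<le> \<bar>\<bar>q \<beta> y\<bar> + \<bar>r \<beta> y\<bar>\<bar>" by linarith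
  qed
qed

lemma graded_upto_perturb:
  assumes "graded_upto M L f" "exp_bounded {0..1} r"
    and "\<And>\<beta> y. \<beta> \<in> {0..1} \<Longrightarrow> \<bar>g \<beta> y - f \<beta> y\<bar> \<le> \<beta> ^ Suc L * r \<beta> y"
  shows "graded_upto M L g"
proof -
  obtain q r' where q: "graded M (\<lambda>_. q)" "exp_bounded {0..1} r'"
    "\<And>\<beta> y. \<beta> \<in> {0..1} \<Longrightarrow> \<bar>f \<beta> y - q \<beta> y\<bar> \<le> \<beta> ^ Suc L * r' \<beta> y"
    using assms unfolding graded_upto_def by blast
  have "\<bar>g \<beta> y - q \<beta> y\<bar> \<le> \<beta> ^ Suc L * (r \<beta> y + r' \<beta> y)" if "\<beta> \<in> {0..1}" for \<beta> y
    unfolding distrib_left using q(3)[OF that, of y] assms(3)[OF that, of y] by linarith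
  with q show ?thesis unfolding graded_upto_def
    by (intro exI[of _ q] exI[of _ "\<lambda>\<beta> y. r \<beta> y + r' \<beta> y"]) (auto intro: exp_bounded_add assms)
qed

lemma graded_upto_add:
  assumes f: "graded_upto M L f" and g: "graded_upto M L g"
  shows "graded_upto M L (\<lambda>\<beta> y. f \<beta> y + g \<beta> y)"
proof -
  obtain q r where q: "graded M (\<lambda>_. q)" "exp_bounded {0..1} r"
    "\<And>\<beta> y. \<beta> \<in> {0..1} \<Longrightarrow> \<bar>f \<beta> y - q \<beta> y\<bar> \<le> \<beta> ^ Suc L * r \<beta> y"
    using f unfolding graded_upto_def by blast
  obtain q' r' where q': "graded M (\<lambda>_. q')" "exp_bounded {0..1} r'"
    "\<And>\<beta> y. \<beta> \<in> {0..1} \<Longrightarrow> \<bar>g \<beta> y - q' \<beta> y\<bar> \<le> \<beta> ^ Suc L * r' \<beta> y"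
    using g unfolding graded_upto_def by blast
  have "\<bar>f \<beta> y + g \<beta> y - (q \<beta> y + q' \<beta> y)\<bar> \<le> \<beta> ^ Suc L * (r \<beta> y + r' \<beta> y)"
    if "\<beta> \<in> {0..1}" for \<beta> y
    unfolding distrib_left using q(3)[OF that, of y] q'(3)[OF that, of y] by linarith
  with q q' show ?thesis unfolding graded_upto_def
    by (intro exI[of _ "\<lambda>\<beta> y. q \<beta> y + q' \<beta> y"] exI[of _ "\<lambda>\<beta> y. r \<beta> y + r' \<beta> y"])
       (auto intro: exp_bounded_add graded_add)
qed

lemma graded_upto_mult:
  assumes f: "graded_upto M L f" and g: "graded_upto M L g"
  shows "graded_upto M L (\<lambda>\<beta> y. f \<beta> y * g \<beta> y)"
proof -
  obtain q r where q: "graded M (\<lambda>_. q)" "exp_bounded {0..1} r"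
    "\<And>\<beta> y. \<beta> \<in> {0..1} \<Longrightarrow> \<bar>f \<beta> y - q \<beta> y\<bar> \<le> \<beta> ^ Suc L * r \<beta> y"
    using f unfolding graded_upto_def by blast
  obtain q' r' where q': "graded M (\<lambda>_. q')" "exp_bounded {0..1} r'"
    "\<And>\<beta> y. \<beta> \<in> {0..1} \<Longrightarrow> \<bar>g \<beta> y - q' \<beta> y\<bar> \<le> \<beta> ^ Suc L * r' \<beta> y"
    using g unfolding graded_upto_def by blast
  have "\<bar>f \<beta> y * g \<beta> y - q \<beta> y * q' \<beta> y\<bar> \<le> \<beta> ^ Suc L * (\<bar>f \<beta> y\<bar> * r' \<beta> y + \<bar>q' \<beta> y\<bar> * r \<beta> y)"
    if \<beta>: "\<beta> \<in> {0..1}" for \<beta> y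
  proof -
    \<comment> \<open>One factor is exchanged at a time, so each summand contains a single
      approximation error.\<close>
    have "f \<beta> y * g \<beta> y - q \<beta> y * q' \<beta> y = f \<beta> y * (g \<beta> y - q' \<beta> y) + q' \<beta> y * (f \<beta> y - q \<beta> y)"
      by (simp add: algebra_simps)
    also have "\<bar>\<dots>\<bar> \<le> \<bar>f \<beta> y\<bar> * \<bar>g \<beta> y - q' \<beta> y\<bar> + \<bar>q' \<beta> y\<bar> * \<bar>f \<beta> y - q \<beta> y\<bar>"
      by (metis abs_mult abs_triangle_ineq)
    also have "\<dots> \<le> \<bar>f \<beta> y\<bar> * (\<beta> ^ Suc L * r' \<beta> y) + \<bar>q' \<beta> y\<bar> * (\<beta> ^ Suc L * r \<beta> y)"
      by (intro add_mono mult_left_mono q(3)[OF \<beta>] q'(3)[OF \<beta>]) auto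
    finally show ?thesis by (simp add: algebra_simps)
  qed
  moreover have "exp_bounded {0..1} (\<lambda>\<beta> y. \<bar>f \<beta> y\<bar> * r' \<beta> y + \<bar>q' \<beta> y\<bar> * r \<beta> y)"
    by (intro exp_bounded_intros q q' graded_upto_exp_bounded[OF f] graded_const_exp_bounded[OF q'(1)])
  ultimately show ?thesis unfolding graded_upto_def using graded_mult[OF q(1) q'(1)] by blast
qed

lemma graded_upto_const: "graded_upto M L (\<lambda>_ _. c)"
  by (rule graded_imp_graded_upto[OF graded_const])

lemma graded_upto_power: "graded_upto M L f \<Longrightarrow> graded_upto M L (\<lambda>\<beta> y. f \<beta> y ^ n)"
  by (induction n) (auto intro: graded_upto_const graded_upto_mult)

lemma graded_upto_sum:
  "(\<And>i. i \<in> I \<Longrightarrow> graded_upto M L (f i)) \<Longrightarrow> graded_upto M L (\<lambda>\<beta> y. \<Sum>i\<in>I. f i \<beta> y)"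
  by (induction I rule: infinite_finite_induct) (auto intro: graded_upto_const graded_upto_add)

text \<open>The denominator is inverted by a geometric series in \<open>1 - D\<close>, which is of order \<open>\<beta>\<close>.\<close>

lemma graded_upto_divide:
  fixes N D e :: "real \<Rightarrow> real ^ 'd::finite \<Rightarrow> real"
  assumes N: "graded_upto M L N" and D: "graded_upto M L D"
    and D0: "\<And>\<beta> y. \<beta> \<in> {0..1} \<Longrightarrow> D \<beta> y \<noteq> 0"
    and inv: "exp_bounded {0..1} (\<lambda>\<beta> y. 1 / D \<beta> y)"
    and e: "exp_bounded {0..1} e" "\<And>\<beta> y. \<beta> \<in> {0..1} \<Longrightarrow> \<bar>1 - D \<beta> y\<bar> \<le> \<beta> * e \<beta> y"
  shows "graded_upto M L (\<lambda>\<beta> y. N \<beta> y / D \<beta> y)"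
proof (rule graded_upto_perturb)
  have "graded_upto M L (\<lambda>\<beta> y. 1 + (-1) * D \<beta> y)"
    by (intro graded_upto_add graded_upto_mult graded_upto_const D)
  then show "graded_upto M L (\<lambda>\<beta> y. N \<beta> y * (\<Sum>j<Suc L. (1 - D \<beta> y) ^ j))"
    by (intro graded_upto_mult graded_upto_sum graded_upto_power N) simp
  show "exp_bounded {0..1} (\<lambda>\<beta> y. \<bar>N \<beta> y\<bar> * \<bar>e \<beta> y\<bar> ^ Suc L * \<bar>1 / D \<beta> y\<bar>)"
    by (intro exp_bounded_intros graded_upto_exp_bounded[OF N] e inv)
  fix \<beta> :: real and y :: "real ^ 'd" assume \<beta>: "\<beta> \<in> {0..1}"
  \<comment> \<open>The finite geometric identity is exact for every D, also where 1 - D is large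
    because y is. Its remainder contains L + 1 factors 1 - D, each worth one \<beta>.\<close>
  have "D \<beta> y * (\<Sum>j<Suc L. (1 - D \<beta> y) ^ j) = 1 - (1 - D \<beta> y) ^ Suc L"
    using one_diff_power_eq[of "1 - D \<beta> y" "Suc L"] by simp
  then have "(\<Sum>j<Suc L. (1 - D \<beta> y) ^ j) = (1 - (1 - D \<beta> y) ^ Suc L) / D \<beta> y"
    using D0[OF \<beta>, of y] by (simp add: field_simps del: sum.lessThan_Suc power_Suc)
  then have "N \<beta> y / D \<beta> y - N \<beta> y * (\<Sum>j<Suc L. (1 - D \<beta> y) ^ j) =
      N \<beta> y * (1 - D \<beta> y) ^ Suc L * (1 / D \<beta> y)"
    using D0[OF \<beta>, of y] by (simp only:) (simp add: field_simps del: power_Suc)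
  moreover have "\<bar>1 - D \<beta> y\<bar> ^ Suc L \<le> (\<beta> * \<bar>e \<beta> y\<bar>) ^ Suc L"
  proof (intro power_mono)
    have "\<beta> * e \<beta> y \<le> \<beta> * \<bar>e \<beta> y\<bar>" using \<beta> by (intro mult_left_mono) auto
    then show "\<bar>1 - D \<beta> y\<bar> \<le> \<beta> * \<bar>e \<beta> y\<bar>" using e(2)[OF \<beta>, of y] by linarith
  qed auto
  ultimately have "\<bar>N \<beta> y / D \<beta> y - N \<beta> y * (\<Sum>j<Suc L. (1 - D \<beta> y) ^ j)\<bar> \<le>
      \<bar>N \<beta> y\<bar> * (\<beta> * \<bar>e \<beta> y\<bar>) ^ Suc L * \<bar>1 / D \<beta> y\<bar>"
    by (simp only: abs_mult power_abs) (intro mult_right_mono mult_left_mono, auto)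
  then show "\<bar>N \<beta> y / D \<beta> y - N \<beta> y * (\<Sum>j<Suc L. (1 - D \<beta> y) ^ j)\<bar> \<le>
      \<beta> ^ Suc L * (\<bar>N \<beta> y\<bar> * \<bar>e \<beta> y\<bar> ^ Suc L * \<bar>1 / D \<beta> y\<bar>)"
    by (simp only: power_mult_distrib mult_ac)
qed

section \<open>Taylor expansion of an averaged exponential\<close>

lemma exp_taylor_bound:
  fixes u :: real
  shows "\<bar>exp u - (\<Sum>k<n. u ^ k / fact k)\<bar> \<le> \<bar>u\<bar> ^ n * exp \<bar>u\<bar>"
proof -
  obtain t where t: "\<bar>t\<bar> \<le> \<bar>u\<bar>" "exp u = (\<Sum>k<n. u ^ k / fact k) + exp t / fact n * u ^ n"
    using Maclaurin_exp_le[of u n] by auto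
  have "exp t / fact n \<le> exp \<bar>u\<bar> / 1"
    using t(1) by (intro frac_le) auto
  then have "\<bar>u\<bar> ^ n * (exp t / fact n) \<le> \<bar>u\<bar> ^ n * exp \<bar>u\<bar>"
    by (intro mult_left_mono) auto
  then show ?thesis using t(2) by (simp add: abs_mult power_abs mult_ac)
qed

text \<open>The Taylor polynomial of the exponential at u is graded because u is. The remainder is
  controlled by the power L + 1 of |u|, and the assumed bound gives one \<beta> for each
  factor.\<close>

lemma (in prob_space) graded_upto_integral_exp:
  fixes g u :: "'a \<Rightarrow> real \<Rightarrow> real ^ 'd::finite \<Rightarrow> real"
  assumes g: "graded M g" and u: "graded M u" and K: "K \<ge> 0"
    and bound: "\<And>z \<beta> y. \<beta> \<in> {0..1} \<Longrightarrow> \<bar>u z \<beta> y\<bar> \<le> \<beta> * (K * (1 + norm y))"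
  shows "graded_upto M L (\<lambda>\<beta> y. \<integral>z. g z \<beta> y * exp (u z \<beta> y) \<partial>M)"
proof -
  obtain C where C: "C \<ge> 0" "\<And>z \<beta> y. \<beta> \<in> {0..1} \<Longrightarrow> \<bar>g z \<beta> y\<bar> \<le> C * exp (C * norm y)"
    using graded_exp_bounded[OF g] unfolding exp_bounded_def by auto
  \<comment> \<open>The powers run from 0 to L, so the first omitted one is exactly L + 1.\<close>
  let ?T = "\<lambda>z \<beta> y. g z \<beta> y * (\<Sum>k<Suc L. 1 / fact k * u z \<beta> y ^ k)"
  have T: "graded M ?T"
    by (intro graded_mult graded_sum graded_power g u graded_const)
  show ?thesis
  proof (rule graded_upto_perturb)
    show "graded_upto M L (\<lambda>\<beta> y. \<integral>z. ?T z \<beta> y \<partial>M)"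
      by (rule graded_imp_graded_upto[OF graded_integral[OF T]])
    let ?r = "\<lambda>y :: real ^ 'd. C * exp (C * norm y) * ((K * (1 + norm y)) ^ Suc L * exp (K * (1 + norm y)))"
    have "exp_bounded {0..1::real} (\<lambda>_ y :: real ^ 'd. C * exp (C * norm y))"
      using C(1) by (intro exp_boundedI[of C C]) auto
    then show "exp_bounded {0..1} (\<lambda>_ :: real. ?r)"
      by (rule exp_bounded_mult) (intro exp_bounded_intros K)
    fix \<beta> :: real and y :: "real ^ 'd" assume \<beta>: "\<beta> \<in> {0..1}"
    have meas: "(\<lambda>z. g z \<beta> y * exp (u z \<beta> y)) \<in> borel_measurable M"
      using graded_measurable[OF g, of \<beta> y] graded_measurable[OF u, of \<beta> y] by measurable
    have "\<bar>g z \<beta> y * exp (u z \<beta> y)\<bar> \<le> C * exp (C * norm y) * exp (\<beta> * (K * (1 + norm y)))" for z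
      unfolding abs_mult using C(2)[OF \<beta>, of z y] bound[OF \<beta>, of z y] C(1) by (intro mult_mono) auto
    then have int: "integrable M (\<lambda>z. g z \<beta> y * exp (u z \<beta> y))"
      using meas by (intro integrable_const_bound[where B = "C * exp (C * norm y) * exp (\<beta> * (K * (1 + norm y)))"] AE_I2)
        auto
    have "\<bar>g z \<beta> y * exp (u z \<beta> y) - ?T z \<beta> y\<bar> \<le> \<beta> ^ Suc L * ?r y" for z
    proof -
      have "\<beta> * (K * (1 + norm y)) \<le> 1 * (K * (1 + norm y))"
        using \<beta> K by (intro mult_right_mono) auto
      then have u': "\<bar>u z \<beta> y\<bar> \<le> K * (1 + norm y)" using bound[OF \<beta>, of z y] by simp
      have "g z \<beta> y * exp (u z \<beta> y) - ?T z \<beta> y = g z \<beta> y * (exp (u z \<beta> y) - (\<Sum>k<Suc L. u z \<beta> y ^ k / fact k))"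
        by (simp add: right_diff_distrib)
      also have "\<bar>\<dots>\<bar> \<le> (C * exp (C * norm y)) *
          ((\<beta> * (K * (1 + norm y))) ^ Suc L * exp (K * (1 + norm y)))"
        unfolding abs_mult
      proof (intro mult_mono C(2)[OF \<beta>] order_trans[OF exp_taylor_bound])
        show "\<bar>u z \<beta> y\<bar> ^ Suc L \<le> (\<beta> * (K * (1 + norm y))) ^ Suc L"
          by (intro power_mono bound[OF \<beta>]) auto
      qed (use u' C(1) K \<beta> in auto)
      finally show ?thesis by (simp only: power_mult_distrib mult_ac)
    qed
    then have "\<bar>\<integral>z. g z \<beta> y * exp (u z \<beta> y) - ?T z \<beta> y \<partial>M\<bar> \<le> \<beta> ^ Suc L * ?r y"
      by (intro order_trans[OF integral_abs_bound] integral_le_const integrable_abs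
          Bochner_Integration.integrable_diff int integrable_graded[OF T]) auto
    then show "\<bar>(\<integral>z. g z \<beta> y * exp (u z \<beta> y) \<partial>M) - (\<integral>z. ?T z \<beta> y \<partial>M)\<bar> \<le> \<beta> ^ Suc L * ?r y"
      by (simp only: Bochner_Integration.integral_diff[OF int integrable_graded[OF T]])
  qed
qed


subsection \<open>Gaussian integrals\<close>

lemma gauss_density_eq_prod:
  fixes y :: "real ^ 'd::finite"
  assumes "\<sigma> > 0"
  shows "gauss_density \<sigma> y = (\<Prod>b\<in>Basis. normal_density 0 \<sigma> (y \<bullet> b))"
proof -
  have "(norm y)\<^sup>2 = (\<Sum>b\<in>Basis. (y \<bullet> b)\<^sup>2)"
    unfolding power2_norm_eq_inner by (subst euclidean_inner) (simp add: power2_eq_square)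
  then have "exp (- (norm y)\<^sup>2 / (2 * \<sigma>\<^sup>2)) = (\<Prod>b\<in>Basis. exp (- (y \<bullet> b)\<^sup>2 / (2 * \<sigma>\<^sup>2)))"
    by (simp add: exp_sum[symmetric] sum_negf sum_divide_distrib)
  then show ?thesis
    unfolding gauss_density_def normal_density_def
    by (simp add: prod.distrib prod_dividef power_one_over)
qed

lemma gauss_density_pos: "\<sigma> > 0 \<Longrightarrow> 0 < gauss_density \<sigma> y"
  by (simp add: gauss_density_def)

lemma gauss_density_measurable [measurable]: "gauss_density \<sigma> \<in> borel_measurable borel"
  unfolding gauss_density_def by measurable

lemma nn_integral_gauss_density:
  assumes "\<sigma> > 0"
  shows "(\<integral>\<^sup>+y. ennreal (gauss_density \<sigma> (y :: real ^ 'd::finite)) \<partial>lborel) = 1"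
proof -
  have "(\<integral>\<^sup>+y. ennreal (gauss_density \<sigma> (y :: real ^ 'd)) \<partial>lborel) =
      (\<integral>\<^sup>+(y :: real ^ 'd). (\<Prod>b\<in>Basis. ennreal (normal_density 0 \<sigma> (y \<bullet> b))) \<partial>lborel)"
    by (simp add: gauss_density_eq_prod[OF assms] prod_ennreal)
  also have "\<dots> = (\<Prod>b\<in>(Basis :: (real ^ 'd) set). (\<integral>\<^sup>+x. ennreal (normal_density 0 \<sigma> x) \<partial>lborel))"
    by (rule nn_integral_lborel_prod[of "\<lambda>_ x. ennreal (normal_density 0 \<sigma> x)"]) auto
  also have "(\<integral>\<^sup>+x. ennreal (normal_density 0 \<sigma> x) \<partial>lborel) = 1"
    using assms by (subst nn_integral_eq_integral) auto
  finally show ?thesis by simp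
qed

lemma nn_integral_gauss_density_shift:
  fixes v :: "real ^ 'd::finite"
  assumes "\<sigma> > 0"
  shows "(\<integral>\<^sup>+y. ennreal (gauss_density \<sigma> (y - v)) \<partial>lborel) = 1"
proof -
  have "(\<integral>\<^sup>+(y :: real ^ 'd). ennreal (gauss_density \<sigma> y) \<partial>lborel) =
    (\<integral>\<^sup>+y. ennreal (gauss_density \<sigma> y) \<partial>distr lborel borel ((+) (- v)))"
    by (simp add: lborel_distr_plus)
  also have "\<dots> = (\<integral>\<^sup>+y. ennreal (gauss_density \<sigma> (y - v)) \<partial>lborel)"
    by (subst nn_integral_distr) auto
  finally show ?thesis using nn_integral_gauss_density[OF assms, where 'd = 'd] by simp
qed

text \<open>Completing the square, an exponential tilt of a normal density is a multiple of a normal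
  density with shifted mean. The absolute value is handled by adding the tilts of both
  signs.\<close>

lemma integrable_exp_normal_density:
  assumes "\<sigma> > 0"
  shows "integrable lborel (\<lambda>x. exp (C * \<bar>x\<bar>) * normal_density 0 \<sigma> x)"
proof (rule Bochner_Integration.integrable_bound)
  have eq: "exp (c * x) * normal_density 0 \<sigma> x = exp (c\<^sup>2 * \<sigma>\<^sup>2 / 2) * normal_density (c * \<sigma>\<^sup>2) \<sigma> x" for c x
  proof -
    have "c * x + - (x - 0)\<^sup>2 / (2 * \<sigma>\<^sup>2) = c\<^sup>2 * \<sigma>\<^sup>2 / 2 + - (x - c * \<sigma>\<^sup>2)\<^sup>2 / (2 * \<sigma>\<^sup>2)"
      using assms by (simp add: field_simps power2_eq_square)
    then have "exp (c * x) * exp (- (x - 0)\<^sup>2 / (2 * \<sigma>\<^sup>2)) =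
        exp (c\<^sup>2 * \<sigma>\<^sup>2 / 2) * exp (- (x - c * \<sigma>\<^sup>2)\<^sup>2 / (2 * \<sigma>\<^sup>2))"
      by (simp only: exp_add[symmetric])
    then show ?thesis
      unfolding normal_density_def by (simp only: mult.left_commute[of "exp _" "1 / _"])
  qed
  show "integrable lborel (\<lambda>x. exp (C * x) * normal_density 0 \<sigma> x + exp (- C * x) * normal_density 0 \<sigma> x)"
    unfolding eq using assms by (intro Bochner_Integration.integrable_add integrable_mult_right integrable_normal_density)
  show "AE x in lborel. norm (exp (C * \<bar>x\<bar>) * normal_density 0 \<sigma> x)
     \<le> norm (exp (C * x) * normal_density 0 \<sigma> x + exp (- C * x) * normal_density 0 \<sigma> x)"
  proof (rule AE_I2)
    fix x
    have "0 \<le> exp (C * x) * normal_density 0 \<sigma> x" "0 \<le> exp (- C * x) * normal_density 0 \<sigma> x"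
      by simp_all
    then show "norm (exp (C * \<bar>x\<bar>) * normal_density 0 \<sigma> x)
     \<le> norm (exp (C * x) * normal_density 0 \<sigma> x + exp (- C * x) * normal_density 0 \<sigma> x)"
      by (cases "x < 0") (simp_all add: abs_mult)
  qed
qed auto

text \<open>Bounding the Euclidean norm by the sum of absolute coordinates turns the integrand into
  a product over coordinates, and the integral factorizes.\<close>

lemma integrable_exp_gauss_density:
  assumes "\<sigma> > 0" "C \<ge> 0"
  shows "integrable lborel (\<lambda>y :: real ^ 'd::finite. gauss_density \<sigma> y * exp (C * norm y))"
proof (rule integrableI_bounded)
  have "(\<integral>\<^sup>+y. ennreal (norm (gauss_density \<sigma> y * exp (C * norm (y :: real ^ 'd)))) \<partial>lborel) \<le>
      (\<integral>\<^sup>+(y :: real ^ 'd). (\<Prod>b\<in>Basis. ennreal (exp (C * \<bar>y \<bullet> b\<bar>) * normal_density 0 \<sigma> (y \<bullet> b))) \<partial>lborel)"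
  proof (rule nn_integral_mono)
    fix y :: "real ^ 'd"
    have "exp (C * norm y) \<le> exp (C * (\<Sum>b\<in>Basis. \<bar>y \<bullet> b\<bar>))"
      using assms by (simp add: mult_left_mono norm_le_l1)
    also have "\<dots> = (\<Prod>b\<in>Basis. exp (C * \<bar>y \<bullet> b\<bar>))"
      by (simp add: exp_sum sum_distrib_left)
    finally have "gauss_density \<sigma> y * exp (C * norm y) \<le>
        (\<Prod>b\<in>Basis. exp (C * \<bar>y \<bullet> b\<bar>)) * (\<Prod>b\<in>Basis. normal_density 0 \<sigma> (y \<bullet> b))"
      unfolding gauss_density_eq_prod[OF assms(1)]
      by (subst mult.commute) (intro mult_right_mono prod_nonneg, auto)
    then show "ennreal (norm (gauss_density \<sigma> y * exp (C * norm y))) \<le>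
       (\<Prod>b\<in>Basis. ennreal (exp (C * \<bar>y \<bullet> b\<bar>) * normal_density 0 \<sigma> (y \<bullet> b)))"
      using gauss_density_pos[OF assms(1), of y]
      by (simp add: prod_ennreal prod.distrib ennreal_leI)
  qed
  also have "\<dots> = (\<Prod>b\<in>(Basis :: (real ^ 'd) set). (\<integral>\<^sup>+x. ennreal (exp (C * \<bar>x\<bar>) * normal_density 0 \<sigma> x) \<partial>lborel))"
    by (rule nn_integral_lborel_prod[of "\<lambda>_ x. ennreal (exp (C * \<bar>x\<bar>) * normal_density 0 \<sigma> x)"]) auto
  also have "(\<integral>\<^sup>+x. ennreal (exp (C * \<bar>x\<bar>) * normal_density 0 \<sigma> x) \<partial>lborel) =
      ennreal (\<integral>x. exp (C * \<bar>x\<bar>) * normal_density 0 \<sigma> x \<partial>lborel)"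
    by (intro nn_integral_eq_integral integrable_exp_normal_density assms) auto
  finally show "(\<integral>\<^sup>+y. ennreal (norm (gauss_density \<sigma> y * exp (C * norm (y :: real ^ 'd)))) \<partial>lborel) < \<infinity>"
    by (auto simp: ennreal_power intro: le_less_trans)
qed auto

lemma exp_bounded_integrable_gauss:
  fixes f :: "'p \<Rightarrow> real ^ 'd::finite \<Rightarrow> real"
  assumes "\<sigma> > 0" "exp_bounded S f" "p \<in> S" "f p \<in> borel_measurable borel"
  shows "integrable lborel (\<lambda>y. gauss_density \<sigma> y * f p y)"
proof -
  obtain C where C: "C \<ge> 0" "\<And>y. \<bar>f p y\<bar> \<le> C * exp (C * norm y)"
    using assms unfolding exp_bounded_def by metis
  show ?thesis
  proof (rule Bochner_Integration.integrable_bound)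
    show "integrable lborel (\<lambda>y :: real ^ 'd. C * (gauss_density \<sigma> y * exp (C * norm y)))"
      by (intro integrable_mult_right integrable_exp_gauss_density assms C)
    show "AE y in lborel. norm (gauss_density \<sigma> y * f p y) \<le> norm (C * (gauss_density \<sigma> y * exp (C * norm y)))"
    proof (rule AE_I2)
      fix y
      have "gauss_density \<sigma> y * \<bar>f p y\<bar> \<le> gauss_density \<sigma> y * (C * exp (C * norm y))"
        using gauss_density_pos[OF assms(1), of y] C by (intro mult_left_mono) auto
      then show "norm (gauss_density \<sigma> y * f p y) \<le> norm (C * (gauss_density \<sigma> y * exp (C * norm y)))"
        using gauss_density_pos[OF assms(1), of y] C(1) by (simp add: abs_mult mult_ac)
    qed
  qed (use assms in measurable)
qed

text \<open>The bound depends on the family only through its growth constant, hence is the same for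
  all parameters.\<close>

lemma exp_bounded_integral_gauss_bound:
  fixes f :: "'p \<Rightarrow> real ^ 'd::finite \<Rightarrow> real"
  assumes "\<sigma> > 0" "exp_bounded S f" "\<And>p. p \<in> S \<Longrightarrow> f p \<in> borel_measurable borel"
  obtains K where "K \<ge> 0" "\<And>p. p \<in> S \<Longrightarrow> \<bar>\<integral>y. gauss_density \<sigma> y * f p y \<partial>lborel\<bar> \<le> K"
proof -
  obtain C where C: "C \<ge> 0" "\<And>p y. p \<in> S \<Longrightarrow> \<bar>f p y\<bar> \<le> C * exp (C * norm y)"
    using assms unfolding exp_bounded_def by metis
  define K where "K = (\<integral>(y :: real ^ 'd). C * (gauss_density \<sigma> y * exp (C * norm y)) \<partial>lborel)"
  have K: "K \<ge> 0" unfolding K_def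
    using C(1) assms(1)
    by (intro integral_nonneg_AE AE_I2 mult_nonneg_nonneg) (auto intro: less_imp_le gauss_density_pos)
  have "\<bar>\<integral>y. gauss_density \<sigma> y * f p y \<partial>lborel\<bar> \<le> K" if "p \<in> S" for p
  proof -
    have "norm (\<integral>y. gauss_density \<sigma> y * f p y \<partial>lborel) \<le> K"
      unfolding K_def
    proof (rule Bochner_Integration.integral_norm_bound_integral)
      show "integrable lborel (\<lambda>y. gauss_density \<sigma> y * f p y)"
        by (rule exp_bounded_integrable_gauss[OF assms(1,2) that assms(3)[OF that]])
      fix y :: "real ^ 'd"
      have "gauss_density \<sigma> y * \<bar>f p y\<bar> \<le> gauss_density \<sigma> y * (C * exp (C * norm y))"
        using gauss_density_pos[OF assms(1), of y] C that by (intro mult_left_mono) auto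
      then show "norm (gauss_density \<sigma> y * f p y) \<le> C * (gauss_density \<sigma> y * exp (C * norm y))"
        using gauss_density_pos[OF assms(1), of y] by (simp add: abs_mult mult_ac)
    qed (intro integrable_mult_right integrable_exp_gauss_density assms C)
    then show ?thesis by simp
  qed
  with K that show thesis by blast
qed

lemma AE_lborel_continuous_zero:
  fixes f :: "'a::euclidean_space \<Rightarrow> real"
  assumes "continuous_on UNIV f" "AE y in lborel. f y = 0"
  shows "f y = 0"
proof -
  have "closed {y. f y = 0}"
    using continuous_closed_vimage[of "{0}" f] assms(1)
    by (simp add: vimage_def continuous_on_eq_continuous_at)
  moreover have "AE y\<in>UNIV in lebesgue. y \<in> {y. f y = 0}"
    using AE_completion[OF assms(2)] by simp
  ultimately show ?thesis
    using mem_closed_if_AE_lebesgue_open[of UNIV "{y. f y = 0}" y] by simp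
qed


subsection \<open>Linear algebra\<close>

lemma linear_axis_expansion:
  fixes f :: "real ^ 'm::finite \<Rightarrow> real"
  assumes "linear f"
  shows "f h = h \<bullet> (\<chi> i. f (axis i 1))"
proof -
  have "f h = f (\<Sum>i\<in>UNIV. h $ i *\<^sub>R axis i 1)"
    using basis_expansion[of h] by (simp add: scalar_mult_eq_scaleR)
  also have "\<dots> = (\<Sum>i\<in>UNIV. h $ i * f (axis i 1))"
    by (simp add: linear_sum[OF assms] linear_scale[OF assms])
  finally show ?thesis by (simp add: inner_vec_def)
qed

text \<open>A way to differentiate under an integral: a quadratic remainder bound survives
  integration as soon as its majorant is integrable. It serves both the likelihood ratio and
  expectations under the law.\<close>

lemma has_derivative_quadratic_remainder:
  fixes f :: "'a::real_normed_vector \<Rightarrow> 'b::real_normed_vector"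
  assumes F: "bounded_linear F"
    and rem: "\<And>h. norm h \<le> 1 \<Longrightarrow> norm (f (x + h) - f x - F h) \<le> K * (norm h)\<^sup>2"
  shows "(f has_derivative F) (at x)"
proof (rule has_derivativeI_sandwich[where e = 1 and H = "\<lambda>y. K * norm (y - x)"])
  show "((\<lambda>y. K * norm (y - x)) \<longlongrightarrow> 0) (at x)"
    by (rule tendsto_eq_intros | simp)+
  fix y assume y: "y \<noteq> x" "dist y x < 1"
  then have "norm (f y - f x - F (y - x)) \<le> K * (norm (y - x))\<^sup>2"
    using rem[of "y - x"] by (simp add: dist_norm)
  with y show "norm (f y - f x - F (y - x)) / norm (y - x) \<le> K * norm (y - x)"
    by (simp add: divide_simps power2_eq_square mult_ac)
qed (use F in auto)

text \<open>The representative on W of the functional given by x is the orthogonal projection of x.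
  This gives the definite description in \<open>riesz_on\<close> its existence and
  uniqueness.\<close>

lemma riesz_on_properties:
  fixes x :: "'a::euclidean_space"
  assumes W: "subspace W"
  shows "riesz_on W (\<lambda>h. h \<bullet> x) \<in> W"
    and "h \<in> W \<Longrightarrow> h \<bullet> riesz_on W (\<lambda>h. h \<bullet> x) = h \<bullet> x"
proof -
  obtain y z where y: "y \<in> span W" and z: "\<And>w. w \<in> span W \<Longrightarrow> orthogonal z w" and x: "x = y + z"
    using orthogonal_subspace_decomp_exists[of W x] by metis
  have span: "span W = W" using W by (simp add: span_eq_iff)
  have yW: "y \<in> W" "\<And>h. h \<in> W \<Longrightarrow> h \<bullet> y = h \<bullet> x"
    using y z x span by (auto simp: orthogonal_def inner_add_right inner_commute)
  have "riesz_on W (\<lambda>h. h \<bullet> x) = y"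
    unfolding riesz_on_def
  proof (rule the_equality)
    fix v assume v: "v \<in> W \<and> (\<forall>h\<in>W. h \<bullet> v = h \<bullet> x)"
    then have "v - y \<in> W" using yW W by (auto intro: subspace_diff)
    then have "(v - y) \<bullet> v = (v - y) \<bullet> y" using v yW by auto
    then have "(v - y) \<bullet> (v - y) = 0" by (simp add: inner_diff_right)
    then show "v = y" by simp
  qed (use yW in auto)
  with yW show "riesz_on W (\<lambda>h. h \<bullet> x) \<in> W"
    and "h \<in> W \<Longrightarrow> h \<bullet> riesz_on W (\<lambda>h. h \<bullet> x) = h \<bullet> x"
    by auto
qed

lemma riesz_on_eqI:
  fixes x :: "'a::euclidean_space"
  assumes W: "subspace W" "v \<in> W" and v: "\<And>h. h \<in> W \<Longrightarrow> h \<bullet> v = h \<bullet> x"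
  shows "riesz_on W (\<lambda>h. h \<bullet> x) = v"
proof -
  let ?r = "riesz_on W (\<lambda>h. h \<bullet> x)"
  have "?r - v \<in> W" using W riesz_on_properties(1)[OF W(1)] by (intro subspace_diff)
  then have "(?r - v) \<bullet> (?r - v) = 0"
    using riesz_on_properties(2)[OF W(1), of "?r - v" x] v by (simp add: inner_diff_right)
  then show ?thesis by simp
qed

lemma norm_riesz_on_le:
  fixes x :: "'a::euclidean_space"
  assumes W: "subspace W"
  shows "norm (riesz_on W (\<lambda>h. h \<bullet> x)) \<le> norm x"
proof -
  let ?r = "riesz_on W (\<lambda>h. h \<bullet> x)"
  have "(norm ?r)\<^sup>2 = ?r \<bullet> x"
    using riesz_on_properties[OF W] by (simp add: power2_norm_eq_inner)
  also have "\<dots> \<le> norm ?r * norm x" by (rule norm_cauchy_schwarz)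
  finally show ?thesis by (cases "norm ?r = 0") (auto simp: power2_eq_square)
qed

text \<open>For a positive semidefinite form, nonnegativity at e_i + e_j and e_i - e_j bounds each
  off-diagonal entry by the mean of two diagonal ones. Hence bounds in the coordinate directions
  suffice; the dimension squared comes from summing over all entries.\<close>

lemma psd_norm_bound:
  fixes D :: "real ^ 'm::finite \<Rightarrow> real ^ 'm"
  assumes D: "linear D" and sym: "\<And>h g. h \<bullet> D g = D h \<bullet> g" and psd: "\<And>h. 0 \<le> h \<bullet> D h"
    and diag: "\<And>i. axis i 1 \<bullet> D (axis i 1) \<le> K"
  shows "norm (D g) \<le> (real CARD('m))\<^sup>2 * K * norm g"
proof -
  have entry: "\<bar>axis i 1 \<bullet> D (axis j 1)\<bar> \<le> K" for i j
  proof -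
    let ?e = "\<lambda>i. axis i 1 :: real ^ 'm"
    have "0 \<le> (?e i + ?e j) \<bullet> D (?e i + ?e j)" "0 \<le> (?e i - ?e j) \<bullet> D (?e i - ?e j)"
      by (rule psd)+
    moreover have "?e j \<bullet> D (?e i) = ?e i \<bullet> D (?e j)" using sym[of "?e j" "?e i"] by (simp add: inner_commute)
    ultimately show ?thesis using diag[of i] diag[of j]
      unfolding linear_add[OF D] linear_diff[OF D] inner_add_left inner_add_right inner_diff_left inner_diff_right
      by linarith
  qed
  have K: "K \<ge> 0" using entry[of undefined undefined] by linarith
  have "norm (D g) \<le> (\<Sum>i\<in>UNIV. \<bar>D g $ i\<bar>)" by (rule norm_le_l1_cart)
  also have "\<dots> \<le> (\<Sum>i\<in>(UNIV :: 'm set). real CARD('m) * K * norm g)"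
  proof (rule sum_mono)
    fix i :: 'm
    have lin: "linear (\<lambda>g. axis i 1 \<bullet> D g)"
      using D by (intro linear_compose[OF D, unfolded o_def] bounded_linear.linear bounded_linear_inner_right)
    have "D g $ i = axis i 1 \<bullet> D g" by (simp add: inner_axis')
    also have "\<dots> = (\<Sum>j\<in>UNIV. g $ j * (axis i 1 \<bullet> D (axis j 1)))"
      by (subst linear_axis_expansion[OF lin]) (simp add: inner_vec_def)
    also have "\<bar>\<dots>\<bar> \<le> (\<Sum>j\<in>(UNIV :: 'm set). norm g * K)"
      by (intro order_trans[OF sum_abs] sum_mono)
         (auto simp: abs_mult intro!: mult_mono entry component_le_norm_cart)
    finally show "\<bar>D g $ i\<bar> \<le> real CARD('m) * K * norm g" by (simp add: mult_ac)
  qed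
  finally show ?thesis by (simp add: power2_eq_square mult_ac)
qed

lemma matrix_inv_mult_vec:
  fixes S :: "real ^ 'n::finite ^ 'n"
  assumes "\<And>x. S *v x = 0 \<Longrightarrow> x = 0"
  shows "S *v (matrix_inv S *v v) = v"
proof -
  have "invertible S"
    using assms matrix_left_invertible_ker[of S] by (auto simp: invertible_left_inverse)
  then have "S ** matrix_inv S = mat 1"
    unfolding invertible_def matrix_inv_def by (rule someI2_ex) auto
  then show ?thesis by (simp add: matrix_vector_mul_assoc)
qed

lemma integrable_cart:
  fixes f :: "'a \<Rightarrow> 'b::euclidean_space ^ 'n::finite"
  assumes "\<And>i. integrable M (\<lambda>x. f x $ i)"
  shows "integrable M f"
proof -
  have "f = (\<lambda>x. \<Sum>i\<in>UNIV. axis i (f x $ i))"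
    by (auto simp: fun_eq_iff vec_eq_iff axis_def)
  moreover have "bounded_linear (axis i :: 'b \<Rightarrow> 'b ^ 'n)" for i
    by (rule bounded_linearI'[OF _ _]) (auto simp: axis_def vec_eq_iff)
  then have "integrable M (\<lambda>x. axis i (f x $ i))" for i
    by (rule integrable_bounded_linear[OF _ assms])
  then have "integrable M (\<lambda>x. \<Sum>i\<in>UNIV. axis i (f x $ i))" by (rule Bochner_Integration.integrable_sum)
  ultimately show ?thesis by simp
qed


subsection \<open>The likelihood ratio against pure noise\<close>

lemma matrix_vector_mult_measurable:
  fixes A :: "'z \<Rightarrow> real ^ 'm::finite ^ 'd::finite"
  assumes "A \<in> borel_measurable M"
  shows "(\<lambda>z. A z *v v) \<in> borel_measurable M"
proof -
  have "linear (\<lambda>B :: real ^ 'm ^ 'd. B *v v)"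
    by (intro linearI) (auto simp: matrix_vector_mult_def vec_eq_iff algebra_simps sum.distrib sum_distrib_left)
  then have "continuous_on UNIV (\<lambda>B :: real ^ 'm ^ 'd. B *v v)"
    by (intro linear_continuous_on) (simp add: linear_conv_bounded_linear)
  then show ?thesis by (rule borel_measurable_continuous_on[OF _ assms])
qed

text \<open>The bound on A is imposed at every z so that it supplies the pointwise bounded
  coefficients of \<open>graded_term\<close>. The almost sure bound of \<open>cond_R\<close> is
  reduced to this at the end.\<close>

locale obs_model = prob_space \<mu> for \<mu> :: "'z measure" +
  fixes A :: "'z \<Rightarrow> real ^ 'm::finite ^ 'd::finite" and \<sigma> a :: real
  assumes A_measurable [measurable]: "A \<in> borel_measurable \<mu>"
    and \<sigma>_pos: "\<sigma> > 0" and a_nonneg: "a \<ge> 0"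
    and A_bound: "norm (A z *v v) \<le> a * norm v"
begin

text \<open>Logarithm of the shifted Gaussian density over the centred one. \<open>dexpo\<close> is
  its derivative in \<theta> along h, and \<open>ratio\<close> the likelihood ratio of the mixture
  against pure noise.\<close>

definition expo :: "real ^ 'm \<Rightarrow> 'z \<Rightarrow> real \<Rightarrow> real ^ 'd \<Rightarrow> real" where
  "expo \<theta> z \<beta> y = (\<beta> * (y \<bullet> (A z *v \<theta>)) - \<beta>\<^sup>2 / 2 * (norm (A z *v \<theta>))\<^sup>2) / \<sigma>\<^sup>2"

definition dexpo :: "real ^ 'm \<Rightarrow> real ^ 'm \<Rightarrow> 'z \<Rightarrow> real \<Rightarrow> real ^ 'd \<Rightarrow> real" where
  "dexpo \<theta> h z \<beta> y = (\<beta> * (y \<bullet> (A z *v h)) - \<beta>\<^sup>2 * ((A z *v \<theta>) \<bullet> (A z *v h))) / \<sigma>\<^sup>2"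

definition ratio :: "real ^ 'm \<Rightarrow> real \<Rightarrow> real ^ 'd \<Rightarrow> real" where
  "ratio \<theta> \<beta> y = (\<integral>z. exp (expo \<theta> z \<beta> y) \<partial>\<mu>)"

definition dratio :: "real ^ 'm \<Rightarrow> real ^ 'm \<Rightarrow> real \<Rightarrow> real ^ 'd \<Rightarrow> real" where
  "dratio \<theta> h \<beta> y = (\<integral>z. dexpo \<theta> h z \<beta> y * exp (expo \<theta> z \<beta> y) \<partial>\<mu>)"

text \<open>\<open>K\<^sub>0\<close> and \<open>K\<^sub>1\<close> are the constants that come out of
  Cauchy-Schwarz for \<open>expo\<close> and \<open>dexpo\<close>: the linear plus the quadratic
  contribution.\<close>

definition K\<^sub>0 :: "real ^ 'm \<Rightarrow> real" where
  "K\<^sub>0 \<theta> = (a * norm \<theta> + (a * norm \<theta>)\<^sup>2) / \<sigma>\<^sup>2"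

definition K\<^sub>1 :: "real ^ 'm \<Rightarrow> real" where
  "K\<^sub>1 \<theta> = (a + a * norm \<theta> * a) / \<sigma>\<^sup>2"

lemma K_nonneg: "K\<^sub>0 \<theta> \<ge> 0" "K\<^sub>1 \<theta> \<ge> 0"
  using a_nonneg by (simp_all add: K\<^sub>0_def K\<^sub>1_def)

lemma A_mult_measurable [measurable]: "(\<lambda>z. A z *v v) \<in> borel_measurable \<mu>"
  by (rule matrix_vector_mult_measurable[OF A_measurable])

text \<open>Common shape of \<open>expo\<close> and \<open>dexpo\<close>. The term linear in y
  carries \<beta>, and the term with the square of \<beta> is constant in y, so no degree exceeds
  its power.\<close>

lemma graded_inner_A:
  "graded \<mu> (\<lambda>z \<beta> y. (\<beta> * (y \<bullet> (A z *v v)) - \<beta>\<^sup>2 * (c * ((A z *v u) \<bullet> (A z *v w)))) / \<sigma>\<^sup>2)"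
proof -
  have "graded \<mu> (\<lambda>z \<beta> y. (\<Sum>i\<in>UNIV. ((A z *v v) $ i / \<sigma>\<^sup>2) * (\<beta> ^ 1 * y $ i))
      + (- c * ((A z *v u) \<bullet> (A z *v w)) / \<sigma>\<^sup>2) * (\<beta> ^ 2 * 1))"
  proof (intro graded_add graded_sum)
    fix i
    show "graded \<mu> (\<lambda>z \<beta> (y :: real ^ 'd). ((A z *v v) $ i / \<sigma>\<^sup>2) * (\<beta> ^ 1 * y $ i))"
    proof (rule graded_term)
      fix z
      show "\<bar>(A z *v v) $ i / \<sigma>\<^sup>2\<bar> \<le> a * norm v / \<sigma>\<^sup>2"
        using order_trans[OF component_le_norm_cart A_bound, of z v i]
        by (simp add: divide_right_mono)
    qed (use poly_deg_nth in \<open>auto intro!: borel_measurable_continuous_on[where f = "\<lambda>x. x $ i"] continuous_intros borel_measurable_divide\<close>)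
    show "graded \<mu> (\<lambda>z \<beta> (y :: real ^ 'd). (- c * ((A z *v u) \<bullet> (A z *v w)) / \<sigma>\<^sup>2) * (\<beta> ^ 2 * 1))"
    proof (rule graded_term)
      fix z
      have "\<bar>(A z *v u) \<bullet> (A z *v w)\<bar> \<le> norm (A z *v u) * norm (A z *v w)"
        by (rule Cauchy_Schwarz_ineq2)
      also have "\<dots> \<le> (a * norm u) * (a * norm w)"
        using a_nonneg by (intro mult_mono A_bound) auto
      finally show "\<bar>- c * ((A z *v u) \<bullet> (A z *v w)) / \<sigma>\<^sup>2\<bar> \<le> \<bar>c\<bar> * ((a * norm u) * (a * norm w)) / \<sigma>\<^sup>2"
        by (simp add: abs_mult divide_right_mono mult_left_mono)
    qed (auto intro: poly_deg_const)
  qed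
  moreover have "(\<Sum>i\<in>UNIV. ((A z *v v) $ i / \<sigma>\<^sup>2) * (\<beta> ^ 1 * y $ i))
      + (- c * ((A z *v u) \<bullet> (A z *v w)) / \<sigma>\<^sup>2) * (\<beta> ^ 2 * 1)
      = (\<beta> * (y \<bullet> (A z *v v)) - \<beta>\<^sup>2 * (c * ((A z *v u) \<bullet> (A z *v w)))) / \<sigma>\<^sup>2" for z \<beta> y
    unfolding inner_vec_def[of y]
    by (simp add: sum_distrib_left sum_divide_distrib diff_divide_distrib mult_ac)
  ultimately show ?thesis by simp
qed

lemma graded_expo: "graded \<mu> (expo \<theta>)"
  using graded_inner_A[of \<theta> "1/2" \<theta> \<theta>]
  by (simp add: expo_def[abs_def] power2_norm_eq_inner)

lemma graded_dexpo: "graded \<mu> (dexpo \<theta> h)"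
  using graded_inner_A[of h 1 \<theta> h] by (simp add: dexpo_def[abs_def])

lemma inner_A_bound: "\<bar>(A z *v u) \<bullet> (A z *v w)\<bar> \<le> (a * norm u) * (a * norm w)"
  using a_nonneg by (intro order_trans[OF Cauchy_Schwarz_ineq2] mult_mono A_bound) auto

lemma inner_y_A_bound: "\<bar>y \<bullet> (A z *v h)\<bar> \<le> norm y * (a * norm h)"
  by (intro order_trans[OF Cauchy_Schwarz_ineq2] mult_left_mono A_bound) auto

text \<open>The factor \<beta> must stay in front: the Taylor remainder and the smallness of 1 -
  \<open>ratio\<close> are both drawn from it. The quadratic term yields it because the square of
  \<beta> is at most \<beta> here.\<close>

lemma expo_bound:
  assumes \<beta>: "\<beta> \<in> {0..1}"
  shows "\<bar>expo \<theta> z \<beta> y\<bar> \<le> \<beta> * (K\<^sub>0 \<theta> * (1 + norm y))"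
proof -
  let ?t = "a * norm \<theta>"
  have t: "?t \<ge> 0" using a_nonneg by simp
  have "\<bar>\<beta> * (y \<bullet> (A z *v \<theta>)) - \<beta>\<^sup>2 / 2 * (norm (A z *v \<theta>))\<^sup>2\<bar> \<le>
      \<bar>\<beta> * (y \<bullet> (A z *v \<theta>))\<bar> + \<bar>\<beta>\<^sup>2 / 2 * (norm (A z *v \<theta>))\<^sup>2\<bar>" by (rule abs_triangle_ineq4)
  also have "\<dots> \<le> \<beta> * (norm y * ?t) + \<beta> * ?t\<^sup>2"
  proof (intro add_mono)
    show "\<bar>\<beta> * (y \<bullet> (A z *v \<theta>))\<bar> \<le> \<beta> * (norm y * ?t)"
      unfolding abs_mult using \<beta> inner_y_A_bound[of y z \<theta>] by (intro mult_mono) auto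
    have "\<beta>\<^sup>2 / 2 * (norm (A z *v \<theta>))\<^sup>2 \<le> \<beta> * ?t\<^sup>2"
    proof (intro mult_mono power_mono A_bound)
      show "\<beta>\<^sup>2 / 2 \<le> \<beta>" using \<beta> by (auto simp: power2_eq_square intro: order_trans[OF mult_left_le])
    qed (use \<beta> in auto)
    then show "\<bar>\<beta>\<^sup>2 / 2 * (norm (A z *v \<theta>))\<^sup>2\<bar> \<le> \<beta> * ?t\<^sup>2" by simp
  qed
  also have "\<dots> \<le> \<beta> * ((?t + ?t\<^sup>2) * (1 + norm y))"
    unfolding distrib_left[symmetric]
  proof (intro mult_left_mono)
    show "norm y * ?t + ?t\<^sup>2 \<le> (?t + ?t\<^sup>2) * (1 + norm y)" using t by (simp add: algebra_simps)
  qed (use \<beta> in auto)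
  finally show ?thesis
    unfolding expo_def K\<^sub>0_def using \<sigma>_pos by (simp add: divide_right_mono)
qed

text \<open>Here the factor kept is \<open>norm h\<close>, for the second-order remainder in
  \<theta>, while \<beta> is merely bounded by 1.\<close>

lemma dexpo_bound:
  assumes \<beta>: "\<beta> \<in> {0..1}"
  shows "\<bar>dexpo \<theta> h z \<beta> y\<bar> \<le> norm h * (K\<^sub>1 \<theta> * (1 + norm y))"
proof -
  have \<beta>2: "\<beta>\<^sup>2 \<le> 1" using \<beta> by (auto intro: power_le_one)
  have "\<bar>\<beta> * (y \<bullet> (A z *v h)) - \<beta>\<^sup>2 * ((A z *v \<theta>) \<bullet> (A z *v h))\<bar> \<le>
      \<bar>\<beta> * (y \<bullet> (A z *v h))\<bar> + \<bar>\<beta>\<^sup>2 * ((A z *v \<theta>) \<bullet> (A z *v h))\<bar>" by (rule abs_triangle_ineq4)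
  also have "\<dots> \<le> 1 * (norm y * (a * norm h)) + 1 * ((a * norm \<theta>) * (a * norm h))"
    unfolding abs_mult[of \<beta>] abs_mult[of "\<beta>\<^sup>2"] using \<beta> \<beta>2 inner_y_A_bound[of y z h] inner_A_bound[of z \<theta> h]
    by (intro add_mono mult_mono) auto
  also have "\<dots> \<le> norm h * ((a + a * norm \<theta> * a) * (1 + norm y))"
    using a_nonneg by (simp add: algebra_simps)
  finally show ?thesis
    unfolding dexpo_def K\<^sub>1_def using \<sigma>_pos by (simp add: divide_right_mono)
qed

lemma expo_bound': "\<beta> \<in> {0..1} \<Longrightarrow> \<bar>expo \<theta> z \<beta> y\<bar> \<le> K\<^sub>0 \<theta> * (1 + norm y)"
  using mult_right_mono[of \<beta> 1 "K\<^sub>0 \<theta> * (1 + norm y)"] K_nonneg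
  by (intro order_trans[OF expo_bound]) auto

lemma expo_measurable [measurable]: "(\<lambda>z. expo \<theta> z \<beta> y) \<in> borel_measurable \<mu>"
  by (rule graded_measurable[OF graded_expo])

lemma dexpo_measurable [measurable]: "(\<lambda>z. dexpo \<theta> h z \<beta> y) \<in> borel_measurable \<mu>"
  by (rule graded_measurable[OF graded_dexpo])

lemma integrable_mult_exp_expo:
  assumes "\<beta> \<in> {0..1}" "f \<in> borel_measurable \<mu>" "\<And>z. \<bar>f z\<bar> \<le> K"
  shows "integrable \<mu> (\<lambda>z. f z * exp (expo \<theta> z \<beta> y))"
proof (rule integrable_const_bound[where B = "K * exp (K\<^sub>0 \<theta> * (1 + norm y))"])
  have "\<bar>f z\<bar> * exp (expo \<theta> z \<beta> y) \<le> K * exp (K\<^sub>0 \<theta> * (1 + norm y))" for z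
    using expo_bound'[OF assms(1), of \<theta> z y] assms(3)[of z] by (intro mult_mono) auto
  then show "AE z in \<mu>. norm (f z * exp (expo \<theta> z \<beta> y)) \<le> K * exp (K\<^sub>0 \<theta> * (1 + norm y))"
    by (simp add: abs_mult)
qed (use assms in measurable)

lemma integrable_exp_expo: "\<beta> \<in> {0..1} \<Longrightarrow> integrable \<mu> (\<lambda>z. exp (expo \<theta> z \<beta> y))"
  using integrable_mult_exp_expo[of \<beta> "\<lambda>_. 1" 1 \<theta> y] by simp

lemma integrable_dexpo_exp_expo:
  "\<beta> \<in> {0..1} \<Longrightarrow> integrable \<mu> (\<lambda>z. dexpo \<theta> h z \<beta> y * exp (expo \<theta> z \<beta> y))"
  by (rule integrable_mult_exp_expo[OF _ dexpo_measurable dexpo_bound])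

text \<open>The lower bound is the important half: it places 1 / \<open>ratio\<close> in the
  exponential growth class and makes the density strictly positive.\<close>

lemma ratio_bounds:
  assumes "\<beta> \<in> {0..1}"
  shows "exp (- (K\<^sub>0 \<theta> * (1 + norm y))) \<le> ratio \<theta> \<beta> y" "ratio \<theta> \<beta> y \<le> exp (K\<^sub>0 \<theta> * (1 + norm y))"
  unfolding ratio_def using expo_bound'[OF assms, of \<theta> _ y] integrable_exp_expo[OF assms]
  by (auto intro!: integral_ge_const integral_le_const simp: abs_le_iff minus_le_iff)

lemma ratio_pos: "\<beta> \<in> {0..1} \<Longrightarrow> 0 < ratio \<theta> \<beta> y"
  using ratio_bounds(1) exp_gt_zero less_le_trans by blast

lemma gauss_density_shift:
  "gauss_density \<sigma> (y - \<beta> *\<^sub>R (A z *v \<theta>)) = gauss_density \<sigma> y * exp (expo \<theta> z \<beta> y)"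
proof -
  have "- (norm (y - \<beta> *\<^sub>R (A z *v \<theta>)))\<^sup>2 / (2 * \<sigma>\<^sup>2) = - (norm y)\<^sup>2 / (2 * \<sigma>\<^sup>2) + expo \<theta> z \<beta> y"
    unfolding expo_def power2_norm_eq_inner using \<sigma>_pos
    by (simp add: inner_diff_left inner_diff_right inner_commute field_simps power2_eq_square)
  then show ?thesis unfolding gauss_density_def by (simp only: exp_add times_divide_eq_left)
qed

lemma obs_density_eq: "obs_density \<mu> A \<sigma> \<theta> \<beta> y = gauss_density \<sigma> y * ratio \<theta> \<beta> y"
  by (simp add: obs_density_def gauss_density_shift ratio_def)

lemma A_mult_snd_measurable [measurable]:
  "(\<lambda>p. A (snd p) *v v) \<in> borel_measurable (borel \<Otimes>\<^sub>M \<mu>)"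
  using measurable_compose[OF measurable_snd A_mult_measurable] .

lemma ratio_measurable [measurable]: "ratio \<theta> \<beta> \<in> borel_measurable borel"
  unfolding ratio_def[abs_def] expo_def
  by (rule borel_measurable_lebesgue_integral) (simp add: case_prod_unfold, measurable)

lemma dratio_measurable [measurable]: "dratio \<theta> h \<beta> \<in> borel_measurable borel"
  unfolding dratio_def[abs_def] expo_def dexpo_def
  by (rule borel_measurable_lebesgue_integral) (simp add: case_prod_unfold, measurable)

section \<open>Differentiation in the parameter\<close>

lemma linear_dratio:
  assumes \<beta>: "\<beta> \<in> {0..1}"
  shows "linear (\<lambda>h. dratio \<theta> h \<beta> y)"
proof (rule linearI)
  fix h g :: "real ^ 'm"
  have "dexpo \<theta> (h + g) z \<beta> y * exp (expo \<theta> z \<beta> y) =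
      dexpo \<theta> h z \<beta> y * exp (expo \<theta> z \<beta> y) + dexpo \<theta> g z \<beta> y * exp (expo \<theta> z \<beta> y)" for z
    by (simp add: dexpo_def matrix_vector_right_distrib inner_add_right algebra_simps add_divide_distrib diff_divide_distrib)
  then show "dratio \<theta> (h + g) \<beta> y = dratio \<theta> h \<beta> y + dratio \<theta> g \<beta> y"
    unfolding dratio_def by (simp add: integrable_dexpo_exp_expo[OF \<beta>])
next
  fix c :: real and h :: "real ^ 'm"
  have "dexpo \<theta> (c *\<^sub>R h) z \<beta> y * exp (expo \<theta> z \<beta> y) = c * (dexpo \<theta> h z \<beta> y * exp (expo \<theta> z \<beta> y))" for z
    by (simp add: dexpo_def matrix_vector_mult_scaleR algebra_simps diff_divide_distrib)
  then show "dratio \<theta> (c *\<^sub>R h) \<beta> y = c *\<^sub>R dratio \<theta> h \<beta> y"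
    unfolding dratio_def by (simp only: integral_mult_right_zero real_scaleR_def)
qed

text \<open>Majorant for the second-order remainder of \<open>ratio\<close>, independent of \<beta>,
  h and z. The first factor bounds the exponential at \<theta>; in the bracket, the first summand
  bounds the exponential of the increment beyond first order, the second the part of the exponent
  quadratic in h.\<close>

definition quad_rem :: "real ^ 'm \<Rightarrow> real ^ 'd \<Rightarrow> real" where
  "quad_rem \<theta> y = exp (K\<^sub>0 \<theta> * (1 + norm y)) *
     (((K\<^sub>1 \<theta> + a\<^sup>2 / \<sigma>\<^sup>2) * (1 + norm y))\<^sup>2 * exp ((K\<^sub>1 \<theta> + a\<^sup>2 / \<sigma>\<^sup>2) * (1 + norm y)) + a\<^sup>2 / \<sigma>\<^sup>2)"

lemma quad_rem_exp_bounded: "exp_bounded S (\<lambda>_. quad_rem \<theta>)"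
proof -
  have "K\<^sub>1 \<theta> + a\<^sup>2 / \<sigma>\<^sup>2 \<ge> 0" using K_nonneg[of \<theta>] by simp
  then show ?thesis
    unfolding quad_rem_def by (intro exp_bounded_intros K_nonneg)
qed

lemma quad_rem_measurable [measurable]: "quad_rem \<theta> \<in> borel_measurable borel"
  unfolding quad_rem_def[abs_def] by measurable

lemma ratio_quadratic:
  assumes \<beta>: "\<beta> \<in> {0..1}" and h: "norm h \<le> 1"
  shows "\<bar>ratio (\<theta> + h) \<beta> y - ratio \<theta> \<beta> y - dratio \<theta> h \<beta> y\<bar> \<le> (norm h)\<^sup>2 * quad_rem \<theta> y"
proof -
  let ?u = "\<lambda>\<theta> z. expo \<theta> z \<beta> y" and ?g = "\<lambda>z. dexpo \<theta> h z \<beta> y" and ?b = "a\<^sup>2 / \<sigma>\<^sup>2"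
  let ?K = "(K\<^sub>1 \<theta> + ?b) * (1 + norm y)"
  have b0: "?b \<ge> 0" and K0: "?K \<ge> 0" using K_nonneg[of \<theta>] by auto
  have hh: "(norm h)\<^sup>2 \<le> norm h"
    using mult_left_mono[OF h, of "norm h"] by (simp add: power2_eq_square)
  have pt: "\<bar>exp (?u (\<theta> + h) z) - exp (?u \<theta> z) - ?g z * exp (?u \<theta> z)\<bar> \<le> (norm h)\<^sup>2 * quad_rem \<theta> y" for z
  proof -
    \<comment> \<open>The exponent is quadratic in \<theta>, so its increment differs from the
      linear term \<open>dexpo\<close> by exactly one explicit quadratic term. What remains is exp
      \<delta> - 1 - \<delta>.\<close>
    define \<delta> where "\<delta> = ?u (\<theta> + h) z - ?u \<theta> z"
    have \<delta>: "\<delta> - ?g z = - (\<beta>\<^sup>2 / 2 * (norm (A z *v h))\<^sup>2 / \<sigma>\<^sup>2)"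
      unfolding \<delta>_def expo_def dexpo_def power2_norm_eq_inner
      by (simp add: matrix_vector_right_distrib inner_add_left inner_add_right inner_commute
          diff_divide_distrib[symmetric] add_divide_distrib[symmetric] algebra_simps)
    have "\<beta>\<^sup>2 / 2 * (norm (A z *v h))\<^sup>2 \<le> 1 * (a * norm h)\<^sup>2"
      using \<beta> power_le_one[of \<beta> 2] by (intro mult_mono power_mono A_bound) auto
    then have "\<beta>\<^sup>2 / 2 * (norm (A z *v h))\<^sup>2 / \<sigma>\<^sup>2 \<le> (a * norm h)\<^sup>2 / \<sigma>\<^sup>2"
      by (intro divide_right_mono) auto
    also have "\<dots> = (norm h)\<^sup>2 * ?b" by (simp add: power_mult_distrib)
    finally have d1: "\<bar>\<delta> - ?g z\<bar> \<le> (norm h)\<^sup>2 * ?b"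
      unfolding \<delta> by simp
    have "\<bar>\<delta>\<bar> \<le> \<bar>?g z\<bar> + \<bar>\<delta> - ?g z\<bar>" by linarith
    also have "\<dots> \<le> norm h * (K\<^sub>1 \<theta> * (1 + norm y)) + norm h * (?b * (1 + norm y))"
    proof (intro add_mono dexpo_bound[OF \<beta>] order_trans[OF d1])
      have "(norm h)\<^sup>2 * ?b \<le> norm h * ?b" using hh b0 by (intro mult_right_mono)
      also have "\<dots> \<le> norm h * (?b * (1 + norm y))"
        using mult_left_mono[of 1 "1 + norm y" ?b] b0 by (intro mult_left_mono) auto
      finally show "(norm h)\<^sup>2 * ?b \<le> norm h * (?b * (1 + norm y))" .
    qed
    also have "\<dots> = norm h * ?K" by (simp add: algebra_simps)
    finally have d2: "\<bar>\<delta>\<bar> \<le> norm h * ?K" .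
    also have "\<dots> \<le> 1 * ?K" using h K0 by (intro mult_right_mono)
    finally have d3: "\<bar>\<delta>\<bar> \<le> ?K" by simp
    have "\<bar>exp \<delta> - (\<Sum>k<2. \<delta> ^ k / fact k)\<bar> \<le> \<bar>\<delta>\<bar>\<^sup>2 * exp \<bar>\<delta>\<bar>" by (rule exp_taylor_bound)
    also have "\<dots> \<le> (norm h * ?K)\<^sup>2 * exp ?K" using d2 d3 by (intro mult_mono power_mono) auto
    finally have d4: "\<bar>exp \<delta> - 1 - \<delta>\<bar> \<le> (norm h)\<^sup>2 * (?K\<^sup>2 * exp ?K)"
      by (simp add: numeral_2_eq_2 power_mult_distrib algebra_simps)
    have "exp (?u (\<theta> + h) z) = exp (?u \<theta> z) * exp \<delta>" by (simp add: \<delta>_def exp_diff)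
    then have "exp (?u (\<theta> + h) z) - exp (?u \<theta> z) - ?g z * exp (?u \<theta> z) =
        exp (?u \<theta> z) * ((exp \<delta> - 1 - \<delta>) + (\<delta> - ?g z))" by (simp add: algebra_simps)
    also have "\<bar>\<dots>\<bar> \<le> exp (K\<^sub>0 \<theta> * (1 + norm y)) * ((norm h)\<^sup>2 * (?K\<^sup>2 * exp ?K) + (norm h)\<^sup>2 * ?b)"
      unfolding abs_mult
    proof (intro mult_mono)
      show "\<bar>exp (?u \<theta> z)\<bar> \<le> exp (K\<^sub>0 \<theta> * (1 + norm y))"
        using expo_bound'[OF \<beta>, of \<theta> z y] by simp
      show "\<bar>exp \<delta> - 1 - \<delta> + (\<delta> - ?g z)\<bar> \<le> (norm h)\<^sup>2 * (?K\<^sup>2 * exp ?K) + (norm h)\<^sup>2 * ?b"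
        using d1 d4 by linarith
    qed auto
    also have "\<dots> = (norm h)\<^sup>2 * quad_rem \<theta> y" by (simp add: quad_rem_def algebra_simps)
    finally show ?thesis .
  qed
  have "ratio (\<theta> + h) \<beta> y - ratio \<theta> \<beta> y - dratio \<theta> h \<beta> y =
      (\<integral>z. exp (?u (\<theta> + h) z) - exp (?u \<theta> z) - ?g z * exp (?u \<theta> z) \<partial>\<mu>)"
    unfolding ratio_def dratio_def
    by (simp add: integrable_exp_expo[OF \<beta>] integrable_dexpo_exp_expo[OF \<beta>])
  also have "\<bar>\<dots>\<bar> \<le> (norm h)\<^sup>2 * quad_rem \<theta> y"
    by (intro order_trans[OF integral_abs_bound] integral_le_const AE_I2 pt integrable_abs
        Bochner_Integration.integrable_diff integrable_exp_expo[OF \<beta>] integrable_dexpo_exp_expo[OF \<beta>])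
  finally show ?thesis .
qed

definition dscore :: "real ^ 'm \<Rightarrow> real \<Rightarrow> real ^ 'd \<Rightarrow> real ^ 'm \<Rightarrow> real" where
  "dscore \<theta> \<beta> y h = dratio \<theta> h \<beta> y / ratio \<theta> \<beta> y"

text \<open>The Gaussian factor is free of \<theta> and cancels from the logarithmic derivative,
  leaving the quotient of \<open>dratio\<close> by \<open>ratio\<close>.\<close>

lemma score_inner:
  assumes \<beta>: "\<beta> \<in> {0..1}"
  shows "score \<mu> A \<sigma> \<theta> \<beta> y \<bullet> h = dscore \<theta> \<beta> y h"
proof -
  have lin: "linear (\<lambda>h. dscore \<theta> \<beta> y h)"
    by (rule linearI)
      (simp_all add: dscore_def linear_add[OF linear_dratio[OF \<beta>]] linear_scale[OF linear_dratio[OF \<beta>]]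
        add_divide_distrib)
  define D where "D = (\<chi> i. dscore \<theta> \<beta> y (axis i 1))"
  have D: "dscore \<theta> \<beta> y h = h \<bullet> D" for h
    unfolding D_def by (rule linear_axis_expansion[OF lin])
  have "((\<lambda>t. ratio t \<beta> y) has_derivative (\<lambda>h. dratio \<theta> h \<beta> y)) (at \<theta>)"
  proof (rule has_derivative_quadratic_remainder)
    show "bounded_linear (\<lambda>h. dratio \<theta> h \<beta> y)"
      using linear_dratio[OF \<beta>] by (simp add: linear_conv_bounded_linear)
    show "norm h \<le> 1 \<Longrightarrow> norm (ratio (\<theta> + h) \<beta> y - ratio \<theta> \<beta> y - dratio \<theta> h \<beta> y) \<le> quad_rem \<theta> y * (norm h)\<^sup>2" for h
      using ratio_quadratic[OF \<beta>, of h \<theta> y] by (simp add: mult.commute)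
  qed
  then have "((\<lambda>t. gauss_density \<sigma> y * ratio t \<beta> y) has_derivative (\<lambda>h. gauss_density \<sigma> y * dratio \<theta> h \<beta> y)) (at \<theta>)"
    by (rule has_derivative_mult_right)
  then have "((\<lambda>t. ln (gauss_density \<sigma> y * ratio t \<beta> y)) has_derivative
      (\<lambda>h. gauss_density \<sigma> y * dratio \<theta> h \<beta> y * inverse (gauss_density \<sigma> y * ratio \<theta> \<beta> y))) (at \<theta>)"
    using gauss_density_pos[OF \<sigma>_pos, of y] ratio_pos[OF \<beta>, of \<theta> y] by (intro has_derivative_ln) auto
  moreover have "gauss_density \<sigma> y * dratio \<theta> h \<beta> y * inverse (gauss_density \<sigma> y * ratio \<theta> \<beta> y) = h \<bullet> D" for h
    using gauss_density_pos[OF \<sigma>_pos, of y] ratio_pos[OF \<beta>, of \<theta> y]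
    by (simp add: D[symmetric] dscore_def field_simps)
  ultimately have G: "GDERIV (\<lambda>t. ln (obs_density \<mu> A \<sigma> t \<beta> y)) \<theta> :> D"
    by (simp add: gderiv_def obs_density_eq)
  have "score \<mu> A \<sigma> \<theta> \<beta> y = D"
    unfolding score_def gradient_def
  proof (rule the_equality[where P = "\<lambda>D. GDERIV (\<lambda>t. ln (obs_density \<mu> A \<sigma> t \<beta> y)) \<theta> :> D", OF G])
    fix D' assume "GDERIV (\<lambda>t. ln (obs_density \<mu> A \<sigma> t \<beta> y)) \<theta> :> D'"
    then have "(\<lambda>h. h \<bullet> D') = (\<lambda>h. h \<bullet> D)"
      using G unfolding gderiv_def by (rule has_derivative_unique)
    then show "D' = D" by (metis vector_eq_ldot)
  qed
  with D show ?thesis by (simp add: inner_commute)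
qed

text \<open>Numerator and denominator are averaged exponentials, hence graded up to order L; the
  denominator is 1 + O(\<beta>) with exponentially bounded inverse, so the division lemma
  applies.\<close>

lemma graded_upto_dscore: "graded_upto \<mu> L (\<lambda>\<beta> y. dscore \<theta> \<beta> y h)"
  unfolding dscore_def
proof (rule graded_upto_divide)
  show "graded_upto \<mu> L (dratio \<theta> h)"
    unfolding dratio_def[abs_def]
    by (rule graded_upto_integral_exp[OF graded_dexpo graded_expo K_nonneg(1) expo_bound])
  show "graded_upto \<mu> L (ratio \<theta>)"
    using graded_upto_integral_exp[OF graded_const[of \<mu> 1] graded_expo K_nonneg(1) expo_bound, of L \<theta>]
    by (simp add: ratio_def[abs_def])
  show "ratio \<theta> \<beta> y \<noteq> 0" if "\<beta> \<in> {0..1}" for \<beta> y using ratio_pos[OF that, of \<theta> y] by simp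
  have "exp_bounded {0..1::real} (\<lambda>_ y :: real ^ 'd. exp (K\<^sub>0 \<theta> * (1 + norm y)))"
    by (intro exp_bounded_intros K_nonneg)
  then show "exp_bounded {0..1} (\<lambda>\<beta> y. 1 / ratio \<theta> \<beta> y)"
  proof (rule exp_bounded_mono)
    fix \<beta> :: real and y :: "real ^ 'd" assume \<beta>: "\<beta> \<in> {0..1}"
    have "1 / ratio \<theta> \<beta> y \<le> 1 / exp (- (K\<^sub>0 \<theta> * (1 + norm y)))"
      using ratio_bounds(1)[OF \<beta>] by (intro divide_left_mono) (auto intro!: mult_pos_pos ratio_pos[OF \<beta>])
    also have "\<dots> = exp (K\<^sub>0 \<theta> * (1 + norm y))" by (simp only: exp_minus divide_inverse inverse_inverse_eq mult_1)
    finally show "\<bar>1 / ratio \<theta> \<beta> y\<bar> \<le> \<bar>exp (K\<^sub>0 \<theta> * (1 + norm y))\<bar>"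
      using ratio_pos[OF \<beta>, of \<theta> y] by simp
  qed
  show "exp_bounded {0..1} (\<lambda>_ y. K\<^sub>0 \<theta> * (1 + norm y) * exp (K\<^sub>0 \<theta> * (1 + norm y)))"
    by (intro exp_bounded_intros K_nonneg)
  fix \<beta> :: real and y :: "real ^ 'd" assume \<beta>: "\<beta> \<in> {0..1}"
  let ?k = "K\<^sub>0 \<theta> * (1 + norm y)"
  have k: "?k \<ge> 0" using K_nonneg by simp
  have pt: "\<bar>1 - exp (expo \<theta> z \<beta> y)\<bar> \<le> \<beta> * (?k * exp ?k)" for z
  proof -
    have "\<bar>1 - exp (expo \<theta> z \<beta> y)\<bar> \<le> \<bar>expo \<theta> z \<beta> y\<bar> * exp \<bar>expo \<theta> z \<beta> y\<bar>"
      using exp_taylor_bound[of "expo \<theta> z \<beta> y" 1] by simp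
    also have "\<dots> \<le> (\<beta> * ?k) * exp ?k"
      using expo_bound[OF \<beta>, of \<theta> z y] expo_bound'[OF \<beta>, of \<theta> z y] \<beta> k by (intro mult_mono) auto
    finally show ?thesis by (simp add: mult.assoc)
  qed
  have "1 - ratio \<theta> \<beta> y = (\<integral>z. 1 - exp (expo \<theta> z \<beta> y) \<partial>\<mu>)"
    unfolding ratio_def by (simp add: integrable_exp_expo[OF \<beta>] prob_space)
  also have "\<bar>\<dots>\<bar> \<le> \<beta> * (?k * exp ?k)"
    by (intro order_trans[OF integral_abs_bound] integral_le_const AE_I2 pt integrable_abs
        Bochner_Integration.integrable_diff integrable_exp_expo[OF \<beta>]) auto
  finally show "\<bar>1 - ratio \<theta> \<beta> y\<bar> \<le> \<beta> * (?k * exp ?k)" .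
qed

end


subsection \<open>Features and polynomials\<close>

text \<open>Intermediate form between polynomials and features, graded by the same degree
  bound.\<close>

inductive hermite_span :: "nat \<Rightarrow> (real ^ 'd::finite \<Rightarrow> real) \<Rightarrow> bool" where
  hermite_span_hermite_mv: "size M \<le> n \<Longrightarrow> hermite_span n (\<lambda>x. c * hermite_mv M x)"
| hermite_span_add: "hermite_span n f \<Longrightarrow> hermite_span n g \<Longrightarrow> hermite_span n (\<lambda>x. f x + g x)"

text \<open>The recurrence solved for the product: multiplying by a coordinate gives one polynomial
  of the next order and one of the previous.\<close>

lemma hermite_span_coord: "hermite_span n f \<Longrightarrow> hermite_span (Suc n) (\<lambda>x. x $ i * f x)"
proof (induction rule: hermite_span.induct)
  case (hermite_span_hermite_mv M n c)
  have "size (M - {#i#}) \<le> Suc n" using hermite_span_hermite_mv size_Diff_submset[of "{#i#}" M]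
    by (meson diff_subset_eq_self le_SucI order_trans size_mset_mono)
  then have "hermite_span (Suc n) (\<lambda>x. c * hermite_mv (add_mset i M) x + (c * real (count M i)) * hermite_mv (M - {#i#}) x)"
    using hermite_span_hermite_mv by (intro hermite_span.intros) auto
  then show ?case by (simp add: hermite_mv_add_mset algebra_simps)
next
  case (hermite_span_add n f g)
  then show ?case by (simp add: distrib_left hermite_span.hermite_span_add)
qed

lemma poly_deg_imp_hermite_span: "poly_deg n f \<Longrightarrow> hermite_span n f"
proof (induction rule: poly_deg.induct)
  case (poly_deg_const n c)
  then show ?case using hermite_span_hermite_mv[of "{#}" n c] by simp
qed (auto intro: hermite_span_add hermite_span_coord)

lemma hermite_span_features:
  assumes onb: "symmetric_tensor_onbs L deg B"
  shows "hermite_span n f \<Longrightarrow> n \<le> L \<Longrightarrow> \<exists>c b. \<forall>y. f ((1 / \<sigma>) *\<^sub>R y) = c + b \<bullet> features deg B \<sigma> y"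
proof (induction rule: hermite_span.induct)
  case (hermite_span_hermite_mv M n c)
  show ?case
  proof (cases "M = {#}")
    case True
    then show ?thesis by (intro exI[of _ c] exI[of _ 0]) simp
  next
    case False
    then have "size M \<in> {1..L}" using hermite_span_hermite_mv by (cases M) auto
    from hermite_mv_in_span_features[OF onb this] obtain b
      where "\<And>y. hermite_mv M ((1 / \<sigma>) *\<^sub>R y) = b \<bullet> features deg B \<sigma> y" by blast
    then show ?thesis by (intro exI[of _ 0] exI[of _ "c *\<^sub>R b"]) simp
  qed
next
  case (hermite_span_add n f g)
  then obtain c b c' b' where "\<And>y. f ((1 / \<sigma>) *\<^sub>R y) = c + b \<bullet> features deg B \<sigma> y"
    "\<And>y. g ((1 / \<sigma>) *\<^sub>R y) = c' + b' \<bullet> features deg B \<sigma> y" by blast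
  then show ?case by (intro exI[of _ "c + c'"] exI[of _ "b + b'"]) (simp add: inner_add_left)
qed

lemma poly_deg_features:
  assumes "symmetric_tensor_onbs L deg B" "\<sigma> > 0" "poly_deg L p"
  obtains c b where "\<And>y. p y = c + b \<bullet> features deg B \<sigma> y"
proof -
  \<comment> \<open>The features see y / \<sigma>, so p is first rescaled by \<sigma>, which does
    not change its degree.\<close>
  obtain c b where cb: "\<And>y. p (\<sigma> *\<^sub>R ((1 / \<sigma>) *\<^sub>R y)) = c + b \<bullet> features deg B \<sigma> y"
    using hermite_span_features[OF assms(1) poly_deg_imp_hermite_span[OF poly_deg_scale[OF assms(3), of \<sigma>]], of \<sigma>]
    by auto
  from that[of c b] cb assms(2) show thesis by simp
qed

section \<open>Growth and regularity of the features\<close>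

lemma exp_bounded_hermite1: "exp_bounded S (\<lambda>p (y :: real ^ 'd::finite). hermite1 n ((c *\<^sub>R y) $ i))"
proof -
  have nth: "exp_bounded S (\<lambda>p (y :: real ^ 'd). (c *\<^sub>R y) $ i)"
    using poly_deg_scale[OF poly_deg_nth, of c i] by (rule exp_bounded_poly_deg)
  show ?thesis
  proof (induction n rule: induct_nat_012)
    case (ge2 n)
    then show ?case
      unfolding hermite1.simps by (intro exp_bounded_diff exp_bounded_mult exp_bounded_const nth)
  qed (use nth in \<open>simp_all add: exp_bounded_const\<close>)
qed

lemma exp_bounded_prod:
  "(\<And>i. i \<in> I \<Longrightarrow> exp_bounded S (f i)) \<Longrightarrow> exp_bounded S (\<lambda>p y. \<Prod>i\<in>I. f i p y)"
  by (induction I rule: infinite_finite_induct) (auto intro: exp_bounded_const exp_bounded_mult)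

lemma exp_bounded_features_nth: "exp_bounded S (\<lambda>p y. features deg B \<sigma> y $ i)"
  unfolding features_nth hermite_mv_def
  by (intro exp_bounded_sum exp_bounded_mult exp_bounded_const exp_bounded_prod exp_bounded_hermite1)

lemma exp_bounded_features: "exp_bounded S (\<lambda>p y. (features deg B \<sigma> y - m) \<bullet> c)"
  unfolding inner_vec_def inner_real_def vector_minus_component
  by (intro exp_bounded_sum exp_bounded_mult exp_bounded_diff exp_bounded_const exp_bounded_features_nth)

lemma continuous_on_features: "continuous_on UNIV (\<lambda>y. features deg B \<sigma> y $ i)"
  unfolding features_nth hermite_mv_def by (intro continuous_intros)

lemma continuous_on_features_inner: "continuous_on UNIV (\<lambda>y. (features deg B \<sigma> y - m) \<bullet> c)"
  unfolding inner_vec_def inner_real_def vector_minus_component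
  by (intro continuous_intros continuous_on_features)

lemma features_inner_measurable: "(\<lambda>y. (features deg B \<sigma> y - m) \<bullet> c) \<in> borel_measurable borel"
  by (intro borel_measurable_continuous_onI continuous_on_features_inner)

lemma features_nth_measurable: "(\<lambda>y. features deg B \<sigma> y $ i) \<in> borel_measurable borel"
  by (intro borel_measurable_continuous_onI continuous_on_features)

text \<open>The order of quantifiers matters: C is fixed before \<beta>, while the polynomial may
  vary with \<beta>. The two errors, from approximation and from truncation, are merged into one
  constant.\<close>

lemma graded_upto_truncate:
  fixes f :: "real \<Rightarrow> real ^ 'd::finite \<Rightarrow> real"
  assumes "graded_upto M L f"
  obtains C where "\<And>\<beta>. \<beta> \<in> {0..1} \<Longrightarrow>
    \<exists>p. poly_deg L p \<and> (\<forall>y. \<bar>f \<beta> y - p y\<bar> \<le> \<beta> ^ Suc L * (C * exp (C * norm y)))"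
proof -
  obtain q r where q: "graded M (\<lambda>_. q)" "exp_bounded {0..1} r"
    "\<And>\<beta> y. \<beta> \<in> {0..1} \<Longrightarrow> \<bar>f \<beta> y - q \<beta> y\<bar> \<le> \<beta> ^ Suc L * r \<beta> y"
    using assms unfolding graded_upto_def by blast
  obtain r' where r': "exp_bounded {0..1} r'" "\<And>\<beta>. \<beta> \<in> {0..1} \<Longrightarrow>
     \<exists>p. poly_deg L p \<and> (\<forall>y. \<bar>q \<beta> y - p y\<bar> \<le> \<beta> ^ Suc L * r' \<beta> y)"
    using graded_truncate[OF q(1), of L] by blast
  obtain C where C: "\<And>\<beta> y. \<beta> \<in> {0..1} \<Longrightarrow> \<bar>r \<beta> y + r' \<beta> y\<bar> \<le> C * exp (C * norm y)"
    using exp_bounded_add[OF q(2) r'(1)] unfolding exp_bounded_def by blast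
  show thesis
  proof (rule that)
    fix \<beta> :: real assume \<beta>: "\<beta> \<in> {0..1}"
    obtain p where p: "poly_deg L p" "\<And>y. \<bar>q \<beta> y - p y\<bar> \<le> \<beta> ^ Suc L * r' \<beta> y"
      using r'(2)[OF \<beta>] by blast
    have "\<bar>f \<beta> y - p y\<bar> \<le> \<beta> ^ Suc L * (C * exp (C * norm y))" for y
    proof -
      have "\<bar>f \<beta> y - p y\<bar> \<le> \<beta> ^ Suc L * (r \<beta> y + r' \<beta> y)"
        unfolding distrib_left using q(3)[OF \<beta>, of y] p(2)[of y] by linarith
      also have "\<dots> \<le> \<beta> ^ Suc L * (C * exp (C * norm y))"
        using C[OF \<beta>, of y] \<beta> by (intro mult_left_mono) auto
      finally show ?thesis .
    qed
    with p(1) show "\<exists>p. poly_deg L p \<and> (\<forall>y. \<bar>f \<beta> y - p y\<bar> \<le> \<beta> ^ Suc L * (C * exp (C * norm y)))"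
      by blast
  qed
qed


subsection \<open>Best affine prediction\<close>

lemma integral_vec_nth: "integrable M f \<Longrightarrow> (\<integral>x. f x \<partial>M) $ i = (\<integral>x. f x $ i \<partial>M)"
  for f :: "'a \<Rightarrow> 'b::euclidean_space ^ 'n::finite"
  by (rule integral_bounded_linear[OF bounded_linear_vec_nth, symmetric])

lemma integral_outer_product:
  fixes V :: "'a \<Rightarrow> real ^ 'k::finite"
  assumes int: "\<And>i j. integrable M (\<lambda>x. V x $ i * V x $ j)"
  shows "c \<bullet> ((\<integral>x. (\<chi> i j. V x $ i * V x $ j) \<partial>M) *v d) = (\<integral>x. (V x \<bullet> c) * (V x \<bullet> d) \<partial>M)"
proof -
  let ?f = "\<lambda>x. (\<chi> i j. V x $ i * V x $ j) :: real ^ 'k ^ 'k"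
  have int_row: "integrable M (\<lambda>x. ?f x $ i)" for i
    by (rule integrable_cart) (simp add: int)
  then have int_f: "integrable M ?f" by (rule integrable_cart)
  have entry: "(\<integral>x. ?f x \<partial>M) $ i $ j = (\<integral>x. V x $ i * V x $ j \<partial>M)" for i j
    unfolding integral_vec_nth[OF int_f] integral_vec_nth[OF int_row] by simp
  have "c \<bullet> ((\<integral>x. ?f x \<partial>M) *v d) = (\<Sum>i\<in>UNIV. \<Sum>j\<in>UNIV. (c $ i * d $ j) * (\<integral>x. V x $ i * V x $ j \<partial>M))"
    unfolding inner_vec_def matrix_vector_mult_def by (simp add: entry sum_distrib_left mult_ac)
  also have "\<dots> = (\<integral>x. (\<Sum>i\<in>UNIV. \<Sum>j\<in>UNIV. (c $ i * d $ j) * (V x $ i * V x $ j)) \<partial>M)"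
    by (simp add: int)
  also have "\<dots> = (\<integral>x. (V x \<bullet> c) * (V x \<bullet> d) \<partial>M)"
    unfolding inner_vec_def by (simp add: sum_product mult_ac)
  finally show ?thesis .
qed

context prob_space
begin

lemma affine_prediction_error:
  fixes X :: "'a \<Rightarrow> real" and U :: "'a \<Rightarrow> real ^ 'n::finite"
  assumes "integrable M X" "integrable M (\<lambda>x. (X x)\<^sup>2)"
    and "integrable M (\<lambda>x. U x \<bullet> b)" "integrable M (\<lambda>x. (U x \<bullet> b) * (U x \<bullet> b))"
    and "integrable M (\<lambda>x. X x * (U x \<bullet> b))"
    and "expectation X = 0" "expectation (\<lambda>x. U x \<bullet> b) = 0"
  shows "expectation (\<lambda>x. (X x - (c + U x \<bullet> b))\<^sup>2) =
    expectation (\<lambda>x. (X x)\<^sup>2) + expectation (\<lambda>x. (U x \<bullet> b) * (U x \<bullet> b))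
      - 2 * expectation (\<lambda>x. X x * (U x \<bullet> b)) + c\<^sup>2"
proof -
  have "(X x - (c + U x \<bullet> b))\<^sup>2 = (X x)\<^sup>2 + (U x \<bullet> b) * (U x \<bullet> b) - 2 * (X x * (U x \<bullet> b))
      + (c\<^sup>2 + (2 * c * (U x \<bullet> b) - 2 * c * X x))" for x
    by (simp add: power2_eq_square algebra_simps)
  then show ?thesis using assms by (simp add: prob_space)
qed

text \<open>Least squares with normal equations S a = F. For every competitor the squared error
  exceeds the minimum by the quadratic form of S at b - a plus the square of c, both nonnegative;
  the minimum itself is a mean square.\<close>

lemma best_affine_prediction:
  fixes X :: "'a \<Rightarrow> real" and U :: "'a \<Rightarrow> real ^ 'n::finite" and S :: "real ^ 'n ^ 'n"
  assumes X: "integrable M X" "integrable M (\<lambda>x. (X x)\<^sup>2)" "expectation X = 0"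
    and U: "\<And>b. integrable M (\<lambda>x. U x \<bullet> b)" "\<And>b. integrable M (\<lambda>x. (U x \<bullet> b) * (U x \<bullet> b))"
      "\<And>b. integrable M (\<lambda>x. X x * (U x \<bullet> b))" "\<And>b. expectation (\<lambda>x. U x \<bullet> b) = 0"
    and S: "\<And>b d. b \<bullet> (S *v d) = expectation (\<lambda>x. (U x \<bullet> b) * (U x \<bullet> d))"
    and F: "\<And>b. expectation (\<lambda>x. X x * (U x \<bullet> b)) = F \<bullet> b"
    and a: "S *v a = F"
  shows "0 \<le> expectation (\<lambda>x. (X x)\<^sup>2) - F \<bullet> a"
    and "expectation (\<lambda>x. (X x)\<^sup>2) - F \<bullet> a \<le> expectation (\<lambda>x. (X x - (c + U x \<bullet> b))\<^sup>2)"
proof -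
  have err: "expectation (\<lambda>x. (X x - (c + U x \<bullet> b))\<^sup>2) =
      expectation (\<lambda>x. (X x)\<^sup>2) + b \<bullet> (S *v b) - 2 * (F \<bullet> b) + c\<^sup>2" for b c
    using affine_prediction_error[of X U b c] X U by (simp add: S F)
  \<comment> \<open>At b = a and c = 0 the error equals the claimed minimum, because a paired with S
    a is F paired with a.\<close>
  have "0 \<le> expectation (\<lambda>x. (X x - (0 + U x \<bullet> a))\<^sup>2)" by (rule Bochner_Integration.integral_nonneg) auto
  then show "0 \<le> expectation (\<lambda>x. (X x)\<^sup>2) - F \<bullet> a"
    unfolding err by (simp add: a inner_commute)
  have "0 \<le> (b - a) \<bullet> (S *v (b - a))"
    unfolding S by (rule Bochner_Integration.integral_nonneg) auto
  also have "\<dots> = b \<bullet> (S *v b) - b \<bullet> F - a \<bullet> (S *v b) + a \<bullet> F"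
    by (simp add: matrix_vector_mult_diff_distrib a inner_diff_left inner_diff_right)
  also have "a \<bullet> (S *v b) = b \<bullet> F"
    unfolding a[symmetric] S by (simp add: mult.commute)
  finally have "0 \<le> b \<bullet> (S *v b) - F \<bullet> b - F \<bullet> b + F \<bullet> a" by (simp only: inner_commute)
  then show "expectation (\<lambda>x. (X x)\<^sup>2) - F \<bullet> a \<le> expectation (\<lambda>x. (X x - (c + U x \<bullet> b))\<^sup>2)"
    unfolding err using zero_le_power2[of c] by linarith
qed

end


subsection \<open>Integrals against the law of an observation\<close>

context obs_model
begin

abbreviation law :: "real ^ 'm \<Rightarrow> real \<Rightarrow> (real ^ 'd) measure" where
  "law \<theta> \<beta> \<equiv> obs_law \<mu> A \<sigma> \<theta> \<beta>"

lemma law_eq: "law \<theta> \<beta> = density lborel (\<lambda>y. ennreal (gauss_density \<sigma> y * ratio \<theta> \<beta> y))"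
  by (simp add: obs_law_def obs_density_eq)

lemma sets_law [simp, measurable_cong]: "sets (law \<theta> \<beta>) = sets borel"
  by (simp add: law_eq)

lemma prob_space_law:
  assumes \<beta>: "\<beta> \<in> {0..1}"
  shows "prob_space (law \<theta> \<beta>)"
proof (rule prob_spaceI)
  interpret pair_sigma_finite "lborel :: (real ^ 'd) measure" \<mu> ..
  have meas: "(\<lambda>p. ennreal (gauss_density \<sigma> (fst p - \<beta> *\<^sub>R (A (snd p) *v \<theta>)))) \<in> borel_measurable (lborel \<Otimes>\<^sub>M \<mu>)"
  proof -
    have "(\<lambda>p. A (snd p) *v \<theta>) \<in> borel_measurable ((lborel :: (real ^ 'd) measure) \<Otimes>\<^sub>M \<mu>)"
      using measurable_compose[OF measurable_snd A_mult_measurable] .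
    then show ?thesis by measurable
  qed
  have "emeasure (law \<theta> \<beta>) (space (law \<theta> \<beta>)) = (\<integral>\<^sup>+y. ennreal (gauss_density \<sigma> y * ratio \<theta> \<beta> y) \<partial>lborel)"
    unfolding law_eq by (subst emeasure_density) auto
  also have "\<dots> = (\<integral>\<^sup>+y. (\<integral>\<^sup>+z. ennreal (gauss_density \<sigma> (y - \<beta> *\<^sub>R (A z *v \<theta>))) \<partial>\<mu>) \<partial>lborel)"
  proof (intro nn_integral_cong)
    fix y
    have "(\<integral>\<^sup>+z. ennreal (gauss_density \<sigma> (y - \<beta> *\<^sub>R (A z *v \<theta>))) \<partial>\<mu>) =
        ennreal (\<integral>z. gauss_density \<sigma> y * exp (expo \<theta> z \<beta> y) \<partial>\<mu>)"
      unfolding gauss_density_shift using gauss_density_pos[OF \<sigma>_pos, of y]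
      by (intro nn_integral_eq_integral integrable_mult_right integrable_exp_expo[OF \<beta>]) auto
    then show "ennreal (gauss_density \<sigma> y * ratio \<theta> \<beta> y) = (\<integral>\<^sup>+z. ennreal (gauss_density \<sigma> (y - \<beta> *\<^sub>R (A z *v \<theta>))) \<partial>\<mu>)"
      by (simp add: ratio_def)
  qed
  \<comment> \<open>After the exchange the inner integral is the mass of a shifted Gaussian.\<close>
  also have "\<dots> = (\<integral>\<^sup>+z. (\<integral>\<^sup>+y. ennreal (gauss_density \<sigma> (y - \<beta> *\<^sub>R (A z *v \<theta>))) \<partial>lborel) \<partial>\<mu>)"
    using Fubini[OF meas] by simp
  also have "\<dots> = 1"
    by (simp add: nn_integral_gauss_density_shift[OF \<sigma>_pos] emeasure_space_1)
  finally show "emeasure (law \<theta> \<beta>) (space (law \<theta> \<beta>)) = 1" .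
qed

lemma ratio_exp_bounded: "exp_bounded {0..1} (ratio \<theta>)"
  using graded_upto_exp_bounded[OF graded_upto_integral_exp[OF graded_const[of \<mu> 1] graded_expo K_nonneg(1) expo_bound, of 0 \<theta>]]
  by (simp add: ratio_def[abs_def])

lemma density_nonneg: "\<beta> \<in> {0..1} \<Longrightarrow> 0 \<le> gauss_density \<sigma> y * ratio \<theta> \<beta> y"
  by (intro mult_nonneg_nonneg less_imp_le gauss_density_pos \<sigma>_pos ratio_pos)

lemma integral_law:
  fixes f :: "real ^ 'd \<Rightarrow> real"
  assumes "\<beta> \<in> {0..1}" "f \<in> borel_measurable borel"
  shows "(\<integral>y. f y \<partial>law \<theta> \<beta>) = (\<integral>y. gauss_density \<sigma> y * (ratio \<theta> \<beta> y * f y) \<partial>lborel)"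
  unfolding law_eq using assms density_nonneg[OF assms(1)]
  by (subst integral_density) (auto simp: mult.assoc)

lemma integrable_law:
  assumes "exp_bounded {0..1} f" "\<beta> \<in> {0..1}" "f \<beta> \<in> borel_measurable borel"
  shows "integrable (law \<theta> \<beta>) (f \<beta>)"
proof -
  have "integrable lborel (\<lambda>y. gauss_density \<sigma> y * (ratio \<theta> \<beta> y * f \<beta> y))"
    using assms by (intro exp_bounded_integrable_gauss[OF \<sigma>_pos exp_bounded_mult[OF ratio_exp_bounded assms(1)]]) auto
  then show ?thesis
    unfolding law_eq using assms density_nonneg[OF assms(2)]
    by (subst integrable_density) (auto simp: mult.assoc)
qed

text \<open>The law varies with \<beta>, but moving \<open>ratio\<close> into the integrand leaves a
  fixed Gaussian, for which the growth class gives a uniform bound.\<close>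

lemma integral_law_bounded:
  fixes f :: "real \<Rightarrow> real ^ 'd \<Rightarrow> real"
  assumes "exp_bounded {0..1} f" "\<And>\<beta>. \<beta> \<in> {0..1} \<Longrightarrow> f \<beta> \<in> borel_measurable borel"
  obtains K where "K \<ge> 0" "\<And>\<beta>. \<beta> \<in> {0..1} \<Longrightarrow> \<bar>\<integral>y. f \<beta> y \<partial>law \<theta> \<beta>\<bar> \<le> K"
proof (rule exp_bounded_integral_gauss_bound[OF \<sigma>_pos exp_bounded_mult[OF ratio_exp_bounded[of \<theta>] assms(1)]])
  fix K :: real
  assume K: "K \<ge> 0"
    "\<And>\<beta>. \<beta> \<in> {0..1} \<Longrightarrow> \<bar>\<integral>y. gauss_density \<sigma> y * (ratio \<theta> \<beta> y * f \<beta> y) \<partial>lborel\<bar> \<le> K"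
  show thesis
  proof (rule that[OF K(1)])
    fix \<beta> :: real assume \<beta>: "\<beta> \<in> {0..1}"
    show "\<bar>\<integral>y. f \<beta> y \<partial>law \<theta> \<beta>\<bar> \<le> K"
      unfolding integral_law[OF \<beta> assms(2)[OF \<beta>]] by (rule K(2)[OF \<beta>])
  qed
qed (intro borel_measurable_times ratio_measurable assms(2))

lemma dscore_exp_bounded: "exp_bounded {0..1} (\<lambda>\<beta> y. dscore \<theta> \<beta> y h)"
  by (rule graded_upto_exp_bounded[OF graded_upto_dscore[of 0]])

lemma dscore_measurable [measurable]: "(\<lambda>y. dscore \<theta> \<beta> y h) \<in> borel_measurable borel"
  unfolding dscore_def by measurable

lemma linear_dscore:
  assumes \<beta>: "\<beta> \<in> {0..1}"
  shows "linear (\<lambda>h. dscore \<theta> \<beta> y h)"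
  unfolding score_inner[OF \<beta>, symmetric] by (intro bounded_linear.linear bounded_linear_inner_right)

lemma integrable_mult_dscore:
  assumes \<beta>: "\<beta> \<in> {0..1}" and f: "f \<in> borel_measurable borel" "exp_bounded {0..1::real} (\<lambda>_. f)"
  shows "integrable (law \<theta> \<beta>) (\<lambda>y. f y * dscore \<theta> \<beta> y h)"
  using integrable_law[OF exp_bounded_mult[OF f(2) dscore_exp_bounded] \<beta>] f(1) by simp

text \<open>The remainder bound for \<open>ratio\<close> is integrated against f and the Gaussian;
  the majorant \<open>quad_rem\<close> keeps it finite. Dividing and multiplying by
  \<open>ratio\<close> turns the derivative into an expectation of f times the score.\<close>

lemma expectation_has_derivative:
  assumes \<beta>: "\<beta> \<in> {0..1}" and f: "f \<in> borel_measurable borel" "exp_bounded {0..1::real} (\<lambda>_. f)"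
  shows "((\<lambda>t. \<integral>y. f y \<partial>law t \<beta>) has_derivative (\<lambda>h. \<integral>y. f y * dscore \<theta> \<beta> y h \<partial>law \<theta> \<beta>)) (at \<theta>)"
proof (rule has_derivative_quadratic_remainder)
  have "linear (\<lambda>h. \<integral>y. f y * dscore \<theta> \<beta> y h \<partial>law \<theta> \<beta>)"
    by (rule linearI)
      (simp_all add: linear_add[OF linear_dscore[OF \<beta>]] linear_scale[OF linear_dscore[OF \<beta>]] distrib_left
        integrable_mult_dscore[OF \<beta> f] mult.left_commute[of "f _"])
  then show "bounded_linear (\<lambda>h. \<integral>y. f y * dscore \<theta> \<beta> y h \<partial>law \<theta> \<beta>)"
    by (simp add: linear_conv_bounded_linear)
  fix h :: "real ^ 'm" assume h: "norm h \<le> 1"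
  let ?K = "\<integral>y. gauss_density \<sigma> y * (quad_rem \<theta> y * \<bar>f y\<bar>) \<partial>lborel"
  have int: "integrable lborel (\<lambda>y. gauss_density \<sigma> y * (ratio t \<beta> y * f y))" for t
    using exp_bounded_integrable_gauss[OF \<sigma>_pos exp_bounded_mult[OF ratio_exp_bounded f(2)] \<beta>] f(1) by simp
  have dscore: "ratio \<theta> \<beta> y * (f y * dscore \<theta> \<beta> y h) = dratio \<theta> h \<beta> y * f y" for y
    using ratio_pos[OF \<beta>, of \<theta> y] by (simp add: dscore_def)
  have "integrable lborel (\<lambda>y. gauss_density \<sigma> y * (ratio \<theta> \<beta> y * (f y * dscore \<theta> \<beta> y h)))"
    using exp_bounded_integrable_gauss[OF \<sigma>_pos exp_bounded_mult[OF ratio_exp_bounded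
      exp_bounded_mult[OF f(2) dscore_exp_bounded]] \<beta>] f(1) by simp
  then have int': "integrable lborel (\<lambda>y. gauss_density \<sigma> y * (dratio \<theta> h \<beta> y * f y))"
    by (simp only: dscore)
  have int_rem: "integrable lborel (\<lambda>y. gauss_density \<sigma> y * (quad_rem \<theta> y * \<bar>f y\<bar>))"
    using exp_bounded_integrable_gauss[OF \<sigma>_pos exp_bounded_mult[OF quad_rem_exp_bounded exp_bounded_abs[OF f(2)]] \<beta>]
      f(1) by simp
  have diff: "(\<integral>y. f y \<partial>law (\<theta> + h) \<beta>) - (\<integral>y. f y \<partial>law \<theta> \<beta>) - (\<integral>y. f y * dscore \<theta> \<beta> y h \<partial>law \<theta> \<beta>) =
     (\<integral>y. gauss_density \<sigma> y * (ratio (\<theta> + h) \<beta> y * f y) - gauss_density \<sigma> y * (ratio \<theta> \<beta> y * f y)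
        - gauss_density \<sigma> y * (dratio \<theta> h \<beta> y * f y) \<partial>lborel)"
    using f(1) by (simp add: integral_law[OF \<beta>] int int' dscore)
  have "norm (\<integral>y. gauss_density \<sigma> y * (ratio (\<theta> + h) \<beta> y * f y) - gauss_density \<sigma> y * (ratio \<theta> \<beta> y * f y)
        - gauss_density \<sigma> y * (dratio \<theta> h \<beta> y * f y) \<partial>lborel)
      \<le> (\<integral>y. (norm h)\<^sup>2 * (gauss_density \<sigma> y * (quad_rem \<theta> y * \<bar>f y\<bar>)) \<partial>lborel)"
  proof (rule Bochner_Integration.integral_norm_bound_integral)
    fix y
    let ?d = "ratio (\<theta> + h) \<beta> y - ratio \<theta> \<beta> y - dratio \<theta> h \<beta> y"
    have "norm (gauss_density \<sigma> y * (ratio (\<theta> + h) \<beta> y * f y) - gauss_density \<sigma> y * (ratio \<theta> \<beta> y * f y)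
        - gauss_density \<sigma> y * (dratio \<theta> h \<beta> y * f y)) = norm (gauss_density \<sigma> y * (?d * f y))"
      by (simp add: algebra_simps)
    also have "\<dots> = gauss_density \<sigma> y * (\<bar>?d\<bar> * \<bar>f y\<bar>)"
      using gauss_density_pos[OF \<sigma>_pos, of y] by (simp add: abs_mult)
    also have "\<dots> \<le> gauss_density \<sigma> y * (((norm h)\<^sup>2 * quad_rem \<theta> y) * \<bar>f y\<bar>)"
      using gauss_density_pos[OF \<sigma>_pos, of y]
      by (intro mult_left_mono mult_right_mono ratio_quadratic[OF \<beta> h]) auto
    finally show "norm (gauss_density \<sigma> y * (ratio (\<theta> + h) \<beta> y * f y) - gauss_density \<sigma> y * (ratio \<theta> \<beta> y * f y)
        - gauss_density \<sigma> y * (dratio \<theta> h \<beta> y * f y)) \<le> (norm h)\<^sup>2 * (gauss_density \<sigma> y * (quad_rem \<theta> y * \<bar>f y\<bar>))"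
      by (simp add: mult_ac)
  qed (intro Bochner_Integration.integrable_diff int int' integrable_mult_right int_rem)+
  also have "\<dots> = ?K * (norm h)\<^sup>2"
    by (subst integral_mult_right_zero) (rule mult.commute)
  finally show "norm ((\<integral>y. f y \<partial>law (\<theta> + h) \<beta>) - (\<integral>y. f y \<partial>law \<theta> \<beta>) - (\<integral>y. f y * dscore \<theta> \<beta> y h \<partial>law \<theta> \<beta>))
     \<le> ?K * (norm h)\<^sup>2" unfolding diff .
qed

text \<open>The derivative of the total mass, which is constantly 1.\<close>

lemma expectation_dscore:
  assumes \<beta>: "\<beta> \<in> {0..1}"
  shows "(\<integral>y. dscore \<theta> \<beta> y h \<partial>law \<theta> \<beta>) = 0"
proof -
  have "((\<lambda>t. \<integral>y. 1 \<partial>law t \<beta>) has_derivative (\<lambda>h. \<integral>y. 1 * dscore \<theta> \<beta> y h \<partial>law \<theta> \<beta>)) (at \<theta>)"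
    by (intro expectation_has_derivative \<beta> exp_bounded_const) auto
  moreover have "(\<integral>y. 1 \<partial>law t \<beta>) = (1::real)" for t
    using prob_space.prob_space[OF prob_space_law[OF \<beta>, of t]] by simp
  ultimately have "((\<lambda>t. 1 :: real) has_derivative (\<lambda>h. \<integral>y. dscore \<theta> \<beta> y h \<partial>law \<theta> \<beta>)) (at \<theta>)"
    by simp
  then have "(\<lambda>h. \<integral>y. dscore \<theta> \<beta> y h \<partial>law \<theta> \<beta>) = (\<lambda>h. 0)"
    by (rule has_derivative_unique) (rule has_derivative_const)
  then show ?thesis by (rule fun_cong)
qed

end


subsection \<open>Residual information\<close>

context obs_model
begin

lemma integrable_features_nth:
  assumes \<beta>: "\<beta> \<in> {0..1}"
  shows "integrable (law \<theta> \<beta>) (\<lambda>y. features deg B \<sigma> y $ k)"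
  using integrable_law[OF exp_bounded_features_nth \<beta> features_nth_measurable] .

lemma features_mean_nth:
  assumes \<beta>: "\<beta> \<in> {0..1}"
  shows "feature_mean deg B \<mu> A \<sigma> \<theta> \<beta> $ k = (\<integral>y. features deg B \<sigma> y $ k \<partial>law \<theta> \<beta>)"
  unfolding feature_mean_def
  by (rule integral_vec_nth[OF integrable_cart[OF integrable_features_nth[OF \<beta>]]])

lemma features_mean_inner:
  assumes \<beta>: "\<beta> \<in> {0..1}"
  shows "(\<integral>y. (features deg B \<sigma> y - feature_mean deg B \<mu> A \<sigma> \<theta> \<beta>) \<bullet> b \<partial>law \<theta> \<beta>) = 0"
proof -
  note int = integrable_features_nth[OF \<beta>]
  interpret law: prob_space "law \<theta> \<beta>" by (rule prob_space_law[OF \<beta>])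
  show ?thesis
    unfolding inner_vec_def by (simp add: int features_mean_nth[OF \<beta>] law.prob_space)
qed

lemma feature_mean_has_derivative:
  fixes deg :: "'n::finite \<Rightarrow> nat" and B :: "'n \<Rightarrow> 'd list \<Rightarrow> real"
  assumes \<beta>: "\<beta> \<in> {0..1}"
  shows "((\<lambda>t. feature_mean deg B \<mu> A \<sigma> t \<beta>) has_derivative
    (\<lambda>h. \<chi> k. \<integral>y. features deg B \<sigma> y $ k * dscore \<theta> \<beta> y h \<partial>law \<theta> \<beta>)) (at \<theta>)"
proof (rule iffD2[OF has_derivative_componentwise_within], rule ballI)
  fix i :: "real ^ 'n" assume "i \<in> Basis"
  then obtain k where k: "i = axis k 1" by (auto simp: Basis_vec_def)
  show "((\<lambda>t. feature_mean deg B \<mu> A \<sigma> t \<beta> \<bullet> i) has_derivative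
      (\<lambda>h. (\<chi> k. \<integral>y. features deg B \<sigma> y $ k * dscore \<theta> \<beta> y h \<partial>law \<theta> \<beta>) \<bullet> i)) (at \<theta>)"
    using expectation_has_derivative[OF \<beta> features_nth_measurable[of deg B \<sigma> k] exp_bounded_features_nth, of \<theta>]
    by (simp add: k inner_axis features_mean_nth[OF \<beta>])
qed

lemma feature_mean_deriv_eq:
  assumes \<beta>: "\<beta> \<in> {0..1}"
  shows "feature_mean_deriv deg B \<mu> A \<sigma> \<theta> \<beta> =
    (\<lambda>h. \<chi> k. \<integral>y. features deg B \<sigma> y $ k * dscore \<theta> \<beta> y h \<partial>law \<theta> \<beta>)"
  unfolding feature_mean_deriv_def
  by (rule frechet_derivative_at[OF feature_mean_has_derivative[OF \<beta>], symmetric])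

lemma linear_feature_mean_deriv:
  assumes \<beta>: "\<beta> \<in> {0..1}"
  shows "linear (feature_mean_deriv deg B \<mu> A \<sigma> \<theta> \<beta>)"
  unfolding feature_mean_deriv_eq[OF \<beta>] using feature_mean_has_derivative[OF \<beta>] by (rule has_derivative_linear)

text \<open>Centring the features is free because the score has mean zero, so this covariance is the
  uncentred moment that differentiation produces.\<close>

lemma feature_mean_deriv_inner:
  assumes \<beta>: "\<beta> \<in> {0..1}"
  shows "(\<integral>y. dscore \<theta> \<beta> y h * ((features deg B \<sigma> y - feature_mean deg B \<mu> A \<sigma> \<theta> \<beta>) \<bullet> b) \<partial>law \<theta> \<beta>) =
    feature_mean_deriv deg B \<mu> A \<sigma> \<theta> \<beta> h \<bullet> b"
proof -
  let ?m = "feature_mean deg B \<mu> A \<sigma> \<theta> \<beta>"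
  have int: "integrable (law \<theta> \<beta>) (\<lambda>y. features deg B \<sigma> y $ k * dscore \<theta> \<beta> y h)" for k
    by (rule integrable_mult_dscore[OF \<beta> features_nth_measurable exp_bounded_features_nth])
  have int': "integrable (law \<theta> \<beta>) (\<lambda>y. dscore \<theta> \<beta> y h)"
    by (rule integrable_law[OF dscore_exp_bounded \<beta> dscore_measurable])
  have "dscore \<theta> \<beta> y h * ((features deg B \<sigma> y - ?m) \<bullet> b) =
      (\<Sum>k\<in>UNIV. b $ k * (features deg B \<sigma> y $ k * dscore \<theta> \<beta> y h)) - (?m \<bullet> b) * dscore \<theta> \<beta> y h" for y
    unfolding inner_diff_left by (simp add: inner_vec_def sum_distrib_left algebra_simps)
  then show ?thesis
    unfolding feature_mean_deriv_eq[OF \<beta>]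
    by (simp add: int int' expectation_dscore[OF \<beta>]) (simp add: inner_vec_def mult.commute)
qed

lemma integrable_features_dscore:
  assumes \<beta>: "\<beta> \<in> {0..1}"
  shows "integrable (law \<theta> \<beta>) (\<lambda>y. (features deg B \<sigma> y - m) \<bullet> b)"
    and "integrable (law \<theta> \<beta>) (\<lambda>y. ((features deg B \<sigma> y - m) \<bullet> b) * ((features deg B \<sigma> y - m) \<bullet> d))"
    and "integrable (law \<theta> \<beta>) (\<lambda>y. dscore \<theta> \<beta> y h * ((features deg B \<sigma> y - m) \<bullet> b))"
    and "integrable (law \<theta> \<beta>) (\<lambda>y. dscore \<theta> \<beta> y h)"
    and "integrable (law \<theta> \<beta>) (\<lambda>y. dscore \<theta> \<beta> y h * dscore \<theta> \<beta> y g)"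
  using integrable_law[OF exp_bounded_features \<beta> features_inner_measurable]
    integrable_law[OF exp_bounded_mult[OF exp_bounded_features exp_bounded_features] \<beta>
      borel_measurable_times[OF features_inner_measurable features_inner_measurable]]
    integrable_law[OF exp_bounded_mult[OF dscore_exp_bounded exp_bounded_features] \<beta>
      borel_measurable_times[OF dscore_measurable features_inner_measurable]]
    integrable_law[OF dscore_exp_bounded \<beta> dscore_measurable]
    integrable_law[OF exp_bounded_mult[OF dscore_exp_bounded dscore_exp_bounded] \<beta>
      borel_measurable_times[OF dscore_measurable dscore_measurable]]
  by - assumption

lemma feature_cov_inner:
  assumes \<beta>: "\<beta> \<in> {0..1}"
  shows "b \<bullet> (feature_cov deg B \<mu> A \<sigma> \<theta> \<beta> *v d) =
    (\<integral>y. ((features deg B \<sigma> y - feature_mean deg B \<mu> A \<sigma> \<theta> \<beta>) \<bullet> b) *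
         ((features deg B \<sigma> y - feature_mean deg B \<mu> A \<sigma> \<theta> \<beta>) \<bullet> d) \<partial>law \<theta> \<beta>)"
  unfolding feature_cov_def
proof (rule integral_outer_product)
  let ?V = "\<lambda>y. features deg B \<sigma> y - feature_mean deg B \<mu> A \<sigma> \<theta> \<beta>"
  fix i j
  show "integrable (law \<theta> \<beta>) (\<lambda>y. ?V y $ i * ?V y $ j)"
    using integrable_features_dscore(2)[OF \<beta>, of \<theta> deg B "feature_mean deg B \<mu> A \<sigma> \<theta> \<beta>" "axis i 1" "axis j 1"]
    by (simp add: inner_axis)
qed

text \<open>A kernel vector gives a combination of features with zero variance. It is constant
  almost surely, then Lebesgue almost everywhere because the density is positive, then everywhere by
  continuity, which affine independence excludes unless it is trivial.\<close>

lemma feature_cov_kernel: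
  assumes onb: "symmetric_tensor_onbs L deg B" and \<beta>: "\<beta> \<in> {0..1}"
    and x: "feature_cov deg B \<mu> A \<sigma> \<theta> \<beta> *v x = 0"
  shows "x = 0"
proof -
  let ?m = "feature_mean deg B \<mu> A \<sigma> \<theta> \<beta>"
  let ?f = "\<lambda>y. (features deg B \<sigma> y - ?m) \<bullet> x"
  have "(\<integral>y. ?f y * ?f y \<partial>law \<theta> \<beta>) = 0"
    unfolding feature_cov_inner[OF \<beta>, symmetric] x by simp
  then have "AE y in law \<theta> \<beta>. ?f y * ?f y = 0"
    using integrable_features_dscore(2)[OF \<beta>, of \<theta> deg B ?m x x]
    by (subst (asm) integral_nonneg_eq_0_iff_AE) auto
  then have "AE y in lborel. 0 < ennreal (gauss_density \<sigma> y * ratio \<theta> \<beta> y) \<longrightarrow> ?f y * ?f y = 0"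
    unfolding law_eq by (subst (asm) AE_density) auto
  moreover have "0 < ennreal (gauss_density \<sigma> y * ratio \<theta> \<beta> y)" for y
    using gauss_density_pos[OF \<sigma>_pos, of y] ratio_pos[OF \<beta>, of \<theta> y] by simp
  ultimately have "AE y in lborel. ?f y = 0" by simp
  then have "?f y = 0" for y
    by (rule AE_lborel_continuous_zero[OF continuous_on_features_inner])
  then have "x \<bullet> features deg B \<sigma> y = ?m \<bullet> x" for y
    by (simp add: inner_diff_left inner_diff_right inner_commute)
  then show ?thesis by (rule features_affinely_independent[OF onb \<sigma>_pos])
qed

lemma fisher_obs_inner:
  assumes \<beta>: "\<beta> \<in> {0..1}"
  shows "h \<bullet> (fisher_obs \<mu> A \<sigma> \<theta> \<beta> *v g) = (\<integral>y. dscore \<theta> \<beta> y h * dscore \<theta> \<beta> y g \<partial>law \<theta> \<beta>)"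
  unfolding fisher_obs_def score_inner[OF \<beta>, symmetric]
proof (rule integral_outer_product)
  fix i j
  have "score \<mu> A \<sigma> \<theta> \<beta> y $ i = dscore \<theta> \<beta> y (axis i 1)" for y i
    using score_inner[OF \<beta>, of \<theta> y "axis i 1"] by (simp add: inner_axis)
  then show "integrable (law \<theta> \<beta>) (\<lambda>y. score \<mu> A \<sigma> \<theta> \<beta> y $ i * score \<mu> A \<sigma> \<theta> \<beta> y $ j)"
    using integrable_features_dscore(5)[OF \<beta>] by simp
qed

text \<open>The remainder on the whole parameter space, before compression to a subspace.\<close>

definition residual_op ::
  "('n::finite \<Rightarrow> nat) \<Rightarrow> ('n \<Rightarrow> 'd list \<Rightarrow> real) \<Rightarrow> real ^ 'm \<Rightarrow> real \<Rightarrow> real ^ 'm \<Rightarrow> real ^ 'm" where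
  "residual_op deg B \<theta> \<beta> g = fisher_obs \<mu> A \<sigma> \<theta> \<beta> *v g -
     adjoint (feature_mean_deriv deg B \<mu> A \<sigma> \<theta> \<beta>)
       (matrix_inv (feature_cov deg B \<mu> A \<sigma> \<theta> \<beta>) *v feature_mean_deriv deg B \<mu> A \<sigma> \<theta> \<beta> g)"

context
  fixes L :: nat and deg :: "'n::finite \<Rightarrow> nat" and B :: "'n \<Rightarrow> 'd list \<Rightarrow> real"
  assumes onb: "symmetric_tensor_onbs L deg B"
begin

lemma residual_op_inner:
  assumes \<beta>: "\<beta> \<in> {0..1}"
  shows "h \<bullet> residual_op deg B \<theta> \<beta> g = (\<integral>y. dscore \<theta> \<beta> y h * dscore \<theta> \<beta> y g \<partial>law \<theta> \<beta>) -
     feature_mean_deriv deg B \<mu> A \<sigma> \<theta> \<beta> h \<bullet>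
       (matrix_inv (feature_cov deg B \<mu> A \<sigma> \<theta> \<beta>) *v feature_mean_deriv deg B \<mu> A \<sigma> \<theta> \<beta> g)"
  unfolding residual_op_def inner_diff_right fisher_obs_inner[OF \<beta>]
    adjoint_works[OF linear_feature_mean_deriv[OF \<beta>]] ..

lemma linear_residual_op:
  assumes \<beta>: "\<beta> \<in> {0..1}"
  shows "linear (residual_op deg B \<theta> \<beta>)"
  unfolding residual_op_def
  by (intro linear_compose_sub linear_compose[unfolded o_def, OF _ adjoint_linear]
      linear_compose[unfolded o_def, OF linear_feature_mean_deriv[OF \<beta>]] matrix_vector_mul_linear
      linear_feature_mean_deriv[OF \<beta>])

lemma feature_cov_inv:
  assumes \<beta>: "\<beta> \<in> {0..1}"
  shows "feature_cov deg B \<mu> A \<sigma> \<theta> \<beta> *v (matrix_inv (feature_cov deg B \<mu> A \<sigma> \<theta> \<beta>) *v v) = v"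
  by (rule matrix_inv_mult_vec[OF feature_cov_kernel[OF onb \<beta>]])

lemma residual_op_sym:
  assumes \<beta>: "\<beta> \<in> {0..1}"
  shows "h \<bullet> residual_op deg B \<theta> \<beta> g = residual_op deg B \<theta> \<beta> h \<bullet> g"
proof -
  let ?S = "feature_cov deg B \<mu> A \<sigma> \<theta> \<beta>"
  have S: "(?S *v p) \<bullet> q = p \<bullet> (?S *v q)" for p q
    unfolding inner_commute[of "?S *v p" q] feature_cov_inner[OF \<beta>] by (simp add: mult.commute)
  have "u \<bullet> (matrix_inv ?S *v v) = v \<bullet> (matrix_inv ?S *v u)" for u v
    using S[of "matrix_inv ?S *v u" "matrix_inv ?S *v v"] by (simp add: feature_cov_inv[OF \<beta>] inner_commute)
  then show ?thesis
    unfolding inner_commute[of "residual_op deg B \<theta> \<beta> h" g] residual_op_inner[OF \<beta>]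
    by (simp add: mult.commute)
qed

lemma residual_op_bounds:
  assumes \<beta>: "\<beta> \<in> {0..1}"
  shows "0 \<le> h \<bullet> residual_op deg B \<theta> \<beta> h"
    and "poly_deg L p \<Longrightarrow> h \<bullet> residual_op deg B \<theta> \<beta> h \<le> (\<integral>y. (dscore \<theta> \<beta> y h - p y)\<^sup>2 \<partial>law \<theta> \<beta>)"
proof -
  let ?m = "feature_mean deg B \<mu> A \<sigma> \<theta> \<beta>"
  interpret law: prob_space "law \<theta> \<beta>" by (rule prob_space_law[OF \<beta>])
  have sq: "integrable (law \<theta> \<beta>) (\<lambda>y. (dscore \<theta> \<beta> y h)\<^sup>2)"
    using integrable_features_dscore(5)[OF \<beta>, of \<theta> h h] by (simp add: power2_eq_square)
  have eq: "h \<bullet> residual_op deg B \<theta> \<beta> h = law.expectation (\<lambda>y. (dscore \<theta> \<beta> y h)\<^sup>2) -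
      feature_mean_deriv deg B \<mu> A \<sigma> \<theta> \<beta> h \<bullet>
       (matrix_inv (feature_cov deg B \<mu> A \<sigma> \<theta> \<beta>) *v feature_mean_deriv deg B \<mu> A \<sigma> \<theta> \<beta> h)"
    unfolding residual_op_inner[OF \<beta>] by (simp add: power2_eq_square)
  \<comment> \<open>Instance: the score along h is predicted from the centred features, with their
    covariance as S and the derivative of the feature mean along h as F.\<close>
  note best = law.best_affine_prediction[OF integrable_features_dscore(4)[OF \<beta>] sq expectation_dscore[OF \<beta>]
      integrable_features_dscore(1)[OF \<beta>] integrable_features_dscore(2)[OF \<beta>] integrable_features_dscore(3)[OF \<beta>]
      features_mean_inner[OF \<beta>] feature_cov_inner[OF \<beta>] feature_mean_deriv_inner[OF \<beta>] feature_cov_inv[OF \<beta>]]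
  show "0 \<le> h \<bullet> residual_op deg B \<theta> \<beta> h"
    unfolding eq by (rule best(1))
  assume "poly_deg L p"
  then obtain c b where "\<And>y. p y = c + b \<bullet> features deg B \<sigma> y"
    using poly_deg_features[OF onb \<sigma>_pos] by metis
  \<comment> \<open>Centring moves the mean of the features into the constant term, so p is an
    admissible competitor.\<close>
  then have "p y = (c + b \<bullet> ?m) + (features deg B \<sigma> y - ?m) \<bullet> b" for y
    by (simp add: inner_diff_left inner_diff_right inner_commute)
  then show "h \<bullet> residual_op deg B \<theta> \<beta> h \<le> (\<integral>y. (dscore \<theta> \<beta> y h - p y)\<^sup>2 \<partial>law \<theta> \<beta>)"
    unfolding eq by (simp only:) (rule best(2))
qed

text \<open>The truncated score is a competitor whose error carries \<beta> ^ (L + 1), and its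
  square produces the stated power. The direction h is fixed and K may depend on it.\<close>

lemma residual_op_rate:
  obtains K where "\<And>\<beta>. \<beta> \<in> {0..1} \<Longrightarrow> h \<bullet> residual_op deg B \<theta> \<beta> h \<le> K * (\<beta>\<^sup>2) ^ (L + 1)"
proof -
  obtain C where C: "\<And>\<beta>. \<beta> \<in> {0..1} \<Longrightarrow>
    \<exists>p. poly_deg L p \<and> (\<forall>y. \<bar>dscore \<theta> \<beta> y h - p y\<bar> \<le> \<beta> ^ Suc L * (C * exp (C * norm y)))"
    using graded_upto_truncate[OF graded_upto_dscore] by metis
  define f where "f = (\<lambda>(_ :: real) (y :: real ^ 'd). (C * exp (C * norm y))\<^sup>2)"
  have "exp_bounded {0..1} (\<lambda>_ y. C * exp (C * norm (y :: real ^ 'd)))"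
    \<comment> \<open>No sign of C is recorded by the truncation lemma, hence the absolute
      values.\<close>
    by (rule exp_boundedI[of "\<bar>C\<bar>" "\<bar>C\<bar>"]) (auto simp: abs_mult intro!: mult_left_mono mult_right_mono)
  then have f: "exp_bounded {0..1} f" unfolding f_def by (rule exp_bounded_power)
  have f_meas: "f \<beta> \<in> borel_measurable borel" for \<beta> unfolding f_def by measurable
  obtain K where K: "K \<ge> 0" "\<And>\<beta>. \<beta> \<in> {0..1} \<Longrightarrow> \<bar>\<integral>y. f \<beta> y \<partial>law \<theta> \<beta>\<bar> \<le> K"
    using integral_law_bounded[OF f f_meas] by metis
  have "h \<bullet> residual_op deg B \<theta> \<beta> h \<le> K * (\<beta>\<^sup>2) ^ (L + 1)" if \<beta>: "\<beta> \<in> {0..1}" for \<beta>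
  proof -
    obtain p where p: "poly_deg L p" "\<And>y. \<bar>dscore \<theta> \<beta> y h - p y\<bar> \<le> \<beta> ^ Suc L * (C * exp (C * norm y))"
      using C[OF \<beta>] by blast
    have p_meas: "p \<in> borel_measurable borel"
      by (intro borel_measurable_continuous_onI continuous_on_poly_deg[OF p(1)])
    have "(\<integral>y. (dscore \<theta> \<beta> y h - p y)\<^sup>2 \<partial>law \<theta> \<beta>) \<le> (\<integral>y. (\<beta>\<^sup>2) ^ (L + 1) * f \<beta> y \<partial>law \<theta> \<beta>)"
    proof (rule integral_mono)
      show "integrable (law \<theta> \<beta>) (\<lambda>y. (dscore \<theta> \<beta> y h - p y)\<^sup>2)"
        using integrable_law[OF exp_bounded_power[OF exp_bounded_diff[OF dscore_exp_bounded exp_bounded_poly_deg[OF p(1)]]] \<beta>]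
          p_meas by simp
      show "integrable (law \<theta> \<beta>) (\<lambda>y. (\<beta>\<^sup>2) ^ (L + 1) * f \<beta> y)"
        by (intro integrable_mult_right integrable_law[OF f \<beta>] f_meas)
      fix y
      have "(dscore \<theta> \<beta> y h - p y)\<^sup>2 \<le> (\<beta> ^ Suc L * (C * exp (C * norm y)))\<^sup>2"
        using p(2)[of y] by (metis abs_ge_zero power2_abs power_mono)
      also have "\<dots> = (\<beta>\<^sup>2) ^ (L + 1) * f \<beta> y"
        unfolding f_def power_mult_distrib[of "\<beta> ^ Suc L"] by (simp only: power_mult[symmetric] mult.commute Suc_eq_plus1)
      finally show "(dscore \<theta> \<beta> y h - p y)\<^sup>2 \<le> (\<beta>\<^sup>2) ^ (L + 1) * f \<beta> y" .
    qed
    also have "\<dots> \<le> (\<beta>\<^sup>2) ^ (L + 1) * K"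
      unfolding integral_mult_right_zero using K(2)[OF \<beta>] by (intro mult_left_mono) auto
    finally show ?thesis using residual_op_bounds(2)[OF \<beta> p(1), of h \<theta>] by (simp add: mult.commute)
  qed
  with that show thesis by blast
qed

text \<open>The finitely many coordinate directions share one constant, and positivity upgrades
  their diagonal bounds to an operator bound. The power of \<sigma> in C converts \<beta> into the
  SNR.\<close>

lemma residual_op_norm_rate:
  obtains C where "C \<ge> 0"
    "\<And>\<beta> g. \<beta> \<in> {0..1} \<Longrightarrow> norm (residual_op deg B \<theta> \<beta> g) \<le> C * snr \<beta> \<sigma> ^ (L + 1) * norm g"
proof -
  have "\<exists>K. \<forall>\<beta>\<in>{0..1}. axis i 1 \<bullet> residual_op deg B \<theta> \<beta> (axis i 1) \<le> K * (\<beta>\<^sup>2) ^ (L + 1)" for i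
    using residual_op_rate[of "axis i 1" \<theta>] by metis
  then obtain K where K: "\<And>i \<beta>. \<beta> \<in> {0..1} \<Longrightarrow>
      axis i 1 \<bullet> residual_op deg B \<theta> \<beta> (axis i 1) \<le> K i * (\<beta>\<^sup>2) ^ (L + 1)"
    by metis
  define K' where "K' = (\<Sum>i\<in>UNIV. \<bar>K i\<bar>)"
  have K': "K i \<le> K'" for i
    using member_le_sum[of i UNIV "\<lambda>i. \<bar>K i\<bar>"] by (auto simp: K'_def)
  have K'0: "K' \<ge> 0" by (simp add: K'_def sum_nonneg)
  define C where "C = (real CARD('m))\<^sup>2 * K' * (\<sigma>\<^sup>2) ^ (L + 1)"
  have "norm (residual_op deg B \<theta> \<beta> g) \<le> C * snr \<beta> \<sigma> ^ (L + 1) * norm g" if \<beta>: "\<beta> \<in> {0..1}" for \<beta> g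
  proof -
    have "axis i 1 \<bullet> residual_op deg B \<theta> \<beta> (axis i 1) \<le> K' * (\<beta>\<^sup>2) ^ (L + 1)" for i
      using K[OF \<beta>, of i] mult_right_mono[OF K'[of i], of "(\<beta>\<^sup>2) ^ (L + 1)"] by (simp del: power_Suc)
    then have "norm (residual_op deg B \<theta> \<beta> g) \<le> (real CARD('m))\<^sup>2 * (K' * (\<beta>\<^sup>2) ^ (L + 1)) * norm g"
      by (rule psd_norm_bound[OF linear_residual_op[OF \<beta>] residual_op_sym[OF \<beta>] residual_op_bounds(1)[OF \<beta>]])
    moreover have "(\<beta>\<^sup>2) ^ (L + 1) = (\<sigma>\<^sup>2) ^ (L + 1) * snr \<beta> \<sigma> ^ (L + 1)"
      unfolding snr_def power_mult_distrib[symmetric] using \<sigma>_pos by simp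
    ultimately show ?thesis by (simp only: C_def mult.assoc)
  qed
  moreover have "C \<ge> 0" using K'0 by (simp add: C_def)
  ultimately show thesis using that by blast
qed

text \<open>On the whole space the identity holds by construction of \<open>residual_op\<close>;
  projecting onto W is additive, so it descends.\<close>

lemma fisher_decomposition:
  assumes W: "subspace W" and \<beta>: "\<beta> \<in> {0..1}"
  shows "fisher_obs_on W \<mu> A \<sigma> \<theta> \<beta> g =
    fisher_gmom_on W deg B \<mu> A \<sigma> \<theta> \<beta> g + riesz_on W (\<lambda>h. h \<bullet> residual_op deg B \<theta> \<beta> g)"
proof -
  let ?J = "feature_mean_deriv deg B \<mu> A \<sigma> \<theta> \<beta>"
  let ?v = "matrix_inv (feature_cov deg B \<mu> A \<sigma> \<theta> \<beta>) *v ?J g"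
  have gmom: "fisher_gmom_on W deg B \<mu> A \<sigma> \<theta> \<beta> g = riesz_on W (\<lambda>h. h \<bullet> adjoint ?J ?v)"
    unfolding fisher_gmom_on_def adjoint_on_def adjoint_works[OF linear_feature_mean_deriv[OF \<beta>]] ..
  show ?thesis
    unfolding fisher_obs_on_def gmom
  proof (rule riesz_on_eqI[OF W])
    show "riesz_on W (\<lambda>h. h \<bullet> adjoint ?J ?v) + riesz_on W (\<lambda>h. h \<bullet> residual_op deg B \<theta> \<beta> g) \<in> W"
      by (intro subspace_add[OF W] riesz_on_properties(1)[OF W])
    show "h \<bullet> (riesz_on W (\<lambda>h. h \<bullet> adjoint ?J ?v) + riesz_on W (\<lambda>h. h \<bullet> residual_op deg B \<theta> \<beta> g)) =
        h \<bullet> (fisher_obs \<mu> A \<sigma> \<theta> \<beta> *v g)" if "h \<in> W" for h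
      by (simp add: inner_add_right riesz_on_properties(2)[OF W that]) (simp add: residual_op_def inner_diff_right)
  qed
qed

lemma fisher_gmom_remainder:
  assumes W: "subspace W"
  shows "\<exists>R :: real \<Rightarrow> real ^ 'm \<Rightarrow> real ^ 'm.
    (\<forall>\<^sub>F \<beta> in at_right 0.
       (\<forall>g\<in>W. fisher_obs_on W \<mu> A \<sigma> \<theta> \<beta> g
              = fisher_gmom_on W deg B \<mu> A \<sigma> \<theta> \<beta> g + R \<beta> g) \<and>
       operator_on W (R \<beta>) \<and> self_adjoint_on W (R \<beta>) \<and> psd_on W (R \<beta>)) \<and>
    (\<exists>\<beta>\<^sub>0>0. \<exists>C. \<forall>\<beta>. 0 < \<beta> \<and> \<beta> < \<beta>\<^sub>0 \<longrightarrow>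
       onorm_on W (R \<beta>) \<le> C * snr \<beta> \<sigma> ^ (L + 1))"
proof -
  define R where "R = (\<lambda>\<beta> g. riesz_on W (\<lambda>h. h \<bullet> residual_op deg B \<theta> \<beta> g))"
  have R_in: "R \<beta> g \<in> W" for \<beta> g
    unfolding R_def by (rule riesz_on_properties(1)[OF W])
  have R_inner: "h \<bullet> R \<beta> g = h \<bullet> residual_op deg B \<theta> \<beta> g" if "h \<in> W" for h \<beta> g
    unfolding R_def by (rule riesz_on_properties(2)[OF W that])
  have alg: "(\<forall>g\<in>W. fisher_obs_on W \<mu> A \<sigma> \<theta> \<beta> g = fisher_gmom_on W deg B \<mu> A \<sigma> \<theta> \<beta> g + R \<beta> g) \<and>
       operator_on W (R \<beta>) \<and> self_adjoint_on W (R \<beta>) \<and> psd_on W (R \<beta>)"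
    if \<beta>: "\<beta> \<in> {0..1}" for \<beta>
  proof (intro conjI ballI)
    show "fisher_obs_on W \<mu> A \<sigma> \<theta> \<beta> g = fisher_gmom_on W deg B \<mu> A \<sigma> \<theta> \<beta> g + R \<beta> g" for g
      unfolding R_def by (rule fisher_decomposition[OF W \<beta>])
    have "R \<beta> (g + h) = R \<beta> g + R \<beta> h" for g h
      \<comment> \<open>Only this instance of R is unfolded. The right-hand side is then shown to be
        the representative, which proves additivity by uniqueness.\<close>
      unfolding R_def[THEN fun_cong, THEN fun_cong, of \<beta> "g + h"]
      by (rule riesz_on_eqI[OF W])
        (auto intro: subspace_add[OF W] R_in simp: R_inner inner_add_right linear_add[OF linear_residual_op[OF \<beta>]])
    moreover have "R \<beta> (c *\<^sub>R g) = c *\<^sub>R R \<beta> g" for c g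
      unfolding R_def[THEN fun_cong, THEN fun_cong, of \<beta> "c *\<^sub>R g"]
      by (rule riesz_on_eqI[OF W])
        (auto intro: subspace_scale[OF W] R_in simp: R_inner linear_scale[OF linear_residual_op[OF \<beta>]])
    ultimately show "operator_on W (R \<beta>)" by (simp add: operator_on_def R_in)
    show "self_adjoint_on W (R \<beta>)"
      unfolding self_adjoint_on_def
    proof (intro ballI)
      fix h g assume "h \<in> W" "g \<in> W"
      then show "h \<bullet> R \<beta> g = R \<beta> h \<bullet> g"
        using residual_op_sym[OF \<beta>, of h \<theta> g] by (simp add: R_inner inner_commute[of _ g])
    qed
    show "psd_on W (R \<beta>)"
      unfolding psd_on_def using residual_op_bounds(1)[OF \<beta>] by (simp add: R_inner)
  qed
  obtain C where C: "C \<ge> 0"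
    "\<And>\<beta> g. \<beta> \<in> {0..1} \<Longrightarrow> norm (residual_op deg B \<theta> \<beta> g) \<le> C * snr \<beta> \<sigma> ^ (L + 1) * norm g"
    using residual_op_norm_rate by metis
  have onorm: "onorm_on W (R \<beta>) \<le> C * snr \<beta> \<sigma> ^ (L + 1)" if \<beta>: "\<beta> \<in> {0..1}" for \<beta>
    unfolding onorm_on_def
  proof (rule cSUP_least)
    \<comment> \<open>The supremum ranges over all of W including 0, where the quotient is 0 by the
      convention for division by zero; this also covers the trivial subspace.\<close>
    show "W \<noteq> {}" using subspace_0[OF W] by blast
    fix g
    have "norm (R \<beta> g) \<le> C * snr \<beta> \<sigma> ^ (L + 1) * norm g"
      unfolding R_def using norm_riesz_on_le[OF W] C(2)[OF \<beta>] by (rule order_trans)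
    moreover have "0 \<le> C * snr \<beta> \<sigma> ^ (L + 1)" using C(1) by (simp add: snr_def)
    ultimately show "norm (R \<beta> g) / norm g \<le> C * snr \<beta> \<sigma> ^ (L + 1)"
      by (cases "g = 0") (auto simp: divide_simps)
  qed
  show ?thesis
  proof (intro exI[of _ R] conjI)
    show "\<forall>\<^sub>F \<beta> in at_right 0.
       (\<forall>g\<in>W. fisher_obs_on W \<mu> A \<sigma> \<theta> \<beta> g = fisher_gmom_on W deg B \<mu> A \<sigma> \<theta> \<beta> g + R \<beta> g) \<and>
       operator_on W (R \<beta>) \<and> self_adjoint_on W (R \<beta>) \<and> psd_on W (R \<beta>)"
      by (rule eventually_at_rightI[of 0 1]) (use alg in auto)
    have "\<forall>\<beta>. 0 < \<beta> \<and> \<beta> < 1 \<longrightarrow> onorm_on W (R \<beta>) \<le> C * snr \<beta> \<sigma> ^ (L + 1)"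
      using onorm by auto
    then show "\<exists>\<beta>\<^sub>0>0. \<exists>C. \<forall>\<beta>. 0 < \<beta> \<and> \<beta> < \<beta>\<^sub>0 \<longrightarrow> onorm_on W (R \<beta>) \<le> C * snr \<beta> \<sigma> ^ (L + 1)"
      using zero_less_one by blast
  qed
qed

end

end

section \<open>From the almost sure bound to a pointwise one\<close>

lemma obs_density_cong_AE:
  fixes A A' :: "'z \<Rightarrow> real ^ 'm::finite ^ 'd::finite"
  assumes "A \<in> borel_measurable \<mu>" "A' \<in> borel_measurable \<mu>" "AE z in \<mu>. A z = A' z"
  shows "obs_density \<mu> A = obs_density \<mu> A'"
proof (intro ext)
  fix \<sigma> \<theta> \<beta> y
  have meas: "(\<lambda>z. gauss_density \<sigma> (y - \<beta> *\<^sub>R (A z *v \<theta>))) \<in> borel_measurable \<mu>"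
    if "A \<in> borel_measurable \<mu>" for A :: "'z \<Rightarrow> real ^ 'm ^ 'd"
    using matrix_vector_mult_measurable[OF that, of \<theta>] by measurable
  show "obs_density \<mu> A \<sigma> \<theta> \<beta> y = obs_density \<mu> A' \<sigma> \<theta> \<beta> y"
    unfolding obs_density_def
    by (intro integral_cong_AE meas assms) (use assms(3) in eventually_elim, simp)
qed

theorem theorem4p7:
  fixes \<mu> :: "'z measure"
    and A :: "'z \<Rightarrow> real ^ 'm ^ 'd"
    and \<Theta> :: "(real ^ 'm) set"
    and \<theta>s :: "real ^ 'm"
    and \<sigma> :: real
    and L :: nat
    and deg :: "'n::finite \<Rightarrow> nat"
    and B :: "'n \<Rightarrow> 'd list \<Rightarrow> real"
    and W :: "(real ^ 'm) set"
  assumes "\<sigma> > 0"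
    and "prob_space \<mu>"
    and "A \<in> borel_measurable \<mu>"
    and "C2_submanifold_full_dim \<Theta>"
    and "\<theta>s \<in> interior \<Theta>"
    and "cond_R \<mu> A \<Theta>"
    and "cond_Q \<mu> A \<Theta> \<theta>s"
    and "L \<ge> 1"
    and "symmetric_tensor_onbs L deg B"
    and "W = class_normal \<mu> A \<Theta> \<theta>s"
  shows "\<exists>R :: real \<Rightarrow> real ^ 'm \<Rightarrow> real ^ 'm.
    (\<forall>\<^sub>F \<beta> in at_right 0.
       (\<forall>g\<in>W. fisher_obs_on W \<mu> A \<sigma> \<theta>s \<beta> g
              = fisher_gmom_on W deg B \<mu> A \<sigma> \<theta>s \<beta> g + R \<beta> g) \<and>
       operator_on W (R \<beta>) \<and> self_adjoint_on W (R \<beta>) \<and> psd_on W (R \<beta>)) \<and>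
    (\<exists>\<beta>\<^sub>0>0. \<exists>C. \<forall>\<beta>. 0 < \<beta> \<and> \<beta> < \<beta>\<^sub>0 \<longrightarrow>
       onorm_on W (R \<beta>) \<le> C * snr \<beta> \<sigma> ^ (L + 1))"
proof -
  have W: "subspace W"
    using assms(10) by (simp add: class_normal_def subspace_orthogonal_comp)
  obtain a where "AE z in \<mu>. onorm ((*v) (A z)) \<le> a"
    using assms(6) unfolding cond_R_def by blast
  \<comment> \<open>Changing \<open>A\<close> on a null set leaves every density unchanged and makes the bound hold everywhere.\<close>
  then obtain N where N: "{z \<in> space \<mu>. \<not> onorm ((*v) (A z)) \<le> a} \<subseteq> N" "N \<in> null_sets \<mu>"
    by (auto elim!: AE_E simp: null_sets_def)
  define A' where "A' = (\<lambda>z. indicator (space \<mu> - N) z *\<^sub>R A z)"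
  have N_sets: "space \<mu> - N \<in> sets \<mu>" using N(2) by auto
  have meas: "A' \<in> borel_measurable \<mu>"
    unfolding A'_def by (intro borel_measurable_scaleR borel_measurable_indicator N_sets assms(3))
  have "AE z in \<mu>. A z = A' z"
    using AE_not_in[OF N(2)] AE_space by eventually_elim (simp add: A'_def)
  note density = obs_density_cong_AE[OF assms(3) meas this]
  \<comment> \<open>Off the good set \<open>A'\<close> is zero, so any nonnegative constant works
    there; \<open>max a 0\<close> is nonnegative whatever the sign of a.\<close>
  have bound: "norm (A' z *v v) \<le> max a 0 * norm v" for z v
  proof (cases "z \<in> space \<mu> - N")
    case True
    then have "norm (A z *v v) \<le> onorm ((*v) (A z)) * norm v" "onorm ((*v) (A z)) \<le> max a 0"
      using N(1) by (auto intro: onorm[OF matrix_vector_mul_bounded_linear])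
    then have "norm (A z *v v) \<le> max a 0 * norm v"
      by (meson mult_right_mono norm_ge_zero order_trans)
    with True show ?thesis by (simp add: A'_def)
  next
    case False
    then show ?thesis by (simp add: A'_def matrix_vector_mult_def zero_vec_def[symmetric])
  qed
  interpret obs_model \<mu> A' \<sigma> "max a 0"
    using assms(1,2) meas bound by (simp add: obs_model_def obs_model_axioms_def)
  \<comment> \<open>Both information operators see A only through the observation density, so the
    exchange is exact. The subspace W stays the one defined from A.\<close>
  have "fisher_obs_on W \<mu> A \<sigma> \<theta>s = fisher_obs_on W \<mu> A' \<sigma> \<theta>s"
    by (simp add: fun_eq_iff fisher_obs_on_def fisher_obs_def score_def obs_law_def density)
  moreover have "fisher_gmom_on W deg B \<mu> A \<sigma> \<theta>s = fisher_gmom_on W deg B \<mu> A' \<sigma> \<theta>s"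
    by (simp add: fun_eq_iff fisher_gmom_on_def feature_mean_deriv_def feature_cov_def feature_mean_def
        obs_law_def density)
  ultimately show ?thesis
    using fisher_gmom_remainder[OF assms(9) W, of \<theta>s] by simp
qed

end
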